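(* Let $\mathcal{E}$ be a separable complex Hilbert space, and let $A \in \mathcal{B}(H^2_{\mathcal{E}}(\mathbb{T}))$. Then the following are equivalent: (1) $A$ is a Toeplitz + Hankel operator, i.e. there exist $\Phi, \Psi \in L^\infty_{\mathcal{B}(\mathcal{E})}(\mathbb{T})$ such that $A = T_\Phi + H_\Psi$. (2) $A T_z - T_z^* A$ is a Toeplitz operator. (3) $T_z^* A T_z - A$ is a Hankel operator. (4) $A T_z + T_z^{*2} A T_z = T_z^* A + T_z^* A T_z^2$.
   Context: $\mathbb{T}$ is the unit circle in $\mathbb{C}$; all Hilbert spaces are separable and over $\mathbb{C}$; $\mathcal{B}(\mathcal{H})$ denotes the bounded linear operators on a Hilbert space $\mathcal{H}$. $L^2_{\mathcal{E}}(\mathbb{T})$ is the Lebesgue-Bochner space of measurable $f:\mathbb{T}\to\mathcal{E}$ with $\|f\|^2 = \frac{1}{2\pi}\int_0^{2\pi}\|f(e^{i\theta})\|^2\,d\theta<\infty$. The Hardy space $H^2_{\mathcal{E}}(\mathbb{T})$ is the closed subspace of those $f \in L^2_{\mathcal{E}}(\mathbb{T})$ whose Fourier coefficients of negative index all vanish, and $P_{H^2_{\mathcal{E}}(\mathbb{T})}$ is the orthogonal projection of $L^2_{\mathcal{E}}(\mathbb{T})$ onto it. $L^\infty_{\mathcal{B}(\mathcal{E})}(\mathbb{T})$ is the space of measurable $\Phi:\mathbb{T}\to\mathcal{B}(\mathcal{E})$ with $\|\Phi\|_\infty = \operatorname{ess\,sup}_{\theta}\|\Phi(e^{i\theta})\|<\infty$.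 For such $\Phi$, $M_\Phi f = \Phi f$ on $L^2_{\mathcal{E}}(\mathbb{T})$. The Toeplitz operator with symbol $\Phi\in L^\infty_{\mathcal{B}(\mathcal{E})}(\mathbb{T})$ is $T_\Phi = P_{H^2_{\mathcal{E}}(\mathbb{T})} M_\Phi|_{H^2_{\mathcal{E}}(\mathbb{T})}$, and the Hankel operator with symbol $\Phi\in L^\infty_{\mathcal{B}(\mathcal{E})}(\mathbb{T})$ is $H_\Phi = P_{H^2_{\mathcal{E}}(\mathbb{T})} M_\Phi J|_{H^2_{\mathcal{E}}(\mathbb{T})}$, where $(Jf)(z) = f(\bar z)$ for $f\in L^2_{\mathcal{E}}(\mathbb{T})$, $z\in\mathbb{T}$. Both are bounded operators on $H^2_{\mathcal{E}}(\mathbb{T})$. An operator on $H^2_{\mathcal{E}}(\mathbb{T})$ is called a Toeplitz (respectively Hankel) operator if it equals $T_\Phi$ (respectively $H_\Phi$) for some $\Phi\in L^\infty_{\mathcal{B}(\mathcal{E})}(\mathbb{T})$. $T_z$ denotes the Toeplitz operator with symbol $z I_{\mathcal{E}}$ (the shift). *)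

theory Defs
  imports "HOL-Analysis.Analysis"
begin

section \<open>Complex inner product spaces\<close>

class complex_vector = real_vector +
  fixes scaleC :: "complex \<Rightarrow> 'a \<Rightarrow> 'a"  (infixr "*\<^sub>C" 75)
  assumes scaleC_add_right: "a *\<^sub>C (x + y) = a *\<^sub>C x + a *\<^sub>C y"
    and scaleC_add_left: "(a + b) *\<^sub>C x = a *\<^sub>C x + b *\<^sub>C x"
    and scaleC_scaleC: "a *\<^sub>C b *\<^sub>C x = (a * b) *\<^sub>C x"
    and scaleR_scaleC: "r *\<^sub>R x = complex_of_real r *\<^sub>C x"

text \<open>
  The complex inner product is linear in its first argument. Its real part is the inner product of
  the underlying real inner product space, so norm, metric and topology are those of
  \<^class>\<open>real_inner\<close>; in particular the norm of x is the square root of the inner product of x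
  with itself, and positive definiteness is inherited. For metric
  spaces, \<^class>\<open>second_countable_topology\<close> is separability.
\<close>

class complex_inner = real_inner + complex_vector +
  fixes cinner :: "'a \<Rightarrow> 'a \<Rightarrow> complex"
  assumes cinner_commute: "cinner x y = cnj (cinner y x)"
    and cinner_add_left: "cinner (x + y) z = cinner x z + cinner y z"
    and cinner_scaleC_left: "cinner (a *\<^sub>C x) y = a * cinner x y"
    and Re_cinner: "Re (cinner x y) = x \<bullet> y"

lemma scaleC_zero_right: "a *\<^sub>C 0 = 0" for a :: complex
  using scaleC_add_right[of a 0 0] by simp

lemma scaleC_minus1: "(- 1) *\<^sub>C x = - x" for x :: "'a::complex_vector"
  using scaleR_scaleC[of "- 1" x] by simp

lemma cinner_scaleC_right: "cinner x (a *\<^sub>C y) = cnj a * cinner x y"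
  for x y :: "'a::complex_inner"
  by (metis cinner_commute cinner_scaleC_left complex_cnj_mult)

lemma cinner_eq: "cinner x y = Complex (x \<bullet> y) (x \<bullet> (\<i> *\<^sub>C y))"
  for x y :: "'a::complex_inner"
proof -
  have "x \<bullet> (\<i> *\<^sub>C y) = Re (cnj \<i> * cinner x y)"
    by (metis Re_cinner cinner_scaleC_right)
  then show ?thesis by (simp add: complex_eq_iff Re_cinner)
qed

lemma cinner_self: "cinner x x = complex_of_real ((norm x)\<^sup>2)"
  for x :: "'a::complex_inner"
proof -
  have "Im (cinner x x) = 0"
    using cinner_commute[of x x] by (simp add: complex_eq_iff)
  then show ?thesis
    by (simp add: complex_eq_iff Re_cinner power2_norm_eq_inner)
qed

lemma norm_scaleC: "norm (a *\<^sub>C x) = cmod a * norm x"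
  for x :: "'a::complex_inner"
proof -
  have "complex_of_real ((norm (a *\<^sub>C x))\<^sup>2) = (a * cnj a) * complex_of_real ((norm x)\<^sup>2)"
    unfolding cinner_self[symmetric] by (simp add: cinner_scaleC_left cinner_scaleC_right)
  also have "\<dots> = complex_of_real ((cmod a * norm x)\<^sup>2)"
    by (simp add: complex_norm_square[symmetric] power_mult_distrib)
  finally have "(norm (a *\<^sub>C x))\<^sup>2 = (cmod a * norm x)\<^sup>2"
    using of_real_eq_iff by blast
  then show ?thesis by simp
qed

lemma bounded_bilinear_scaleC: "bounded_bilinear (scaleC :: complex \<Rightarrow> 'a::complex_inner \<Rightarrow> 'a)"
proof
  show "(r *\<^sub>R a) *\<^sub>C b = r *\<^sub>R (a *\<^sub>C b)" for r a and b :: 'a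
    by (simp add: scaleR_scaleC scaleC_scaleC scaleR_conv_of_real)
  show "a *\<^sub>C (r *\<^sub>R b) = r *\<^sub>R (a *\<^sub>C b)" for r a and b :: 'a
    by (simp add: scaleR_scaleC scaleC_scaleC mult.commute)
  show "\<exists>K. \<forall>a (b::'a). norm (a *\<^sub>C b) \<le> norm a * norm b * K"
    by (rule exI[of _ 1]) (simp add: norm_scaleC)
qed (simp_all add: scaleC_add_right scaleC_add_left)

lemmas bounded_linear_scaleC_right = bounded_bilinear.bounded_linear_right[OF bounded_bilinear_scaleC]

lemma borel_measurable_scaleC [measurable]:
  fixes f :: "'x \<Rightarrow> 'a::{complex_inner, second_countable_topology}"
  assumes [measurable]: "g \<in> borel_measurable M" "f \<in> borel_measurable M"
  shows "(\<lambda>x. g x *\<^sub>C f x) \<in> borel_measurable M"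
  by (rule borel_measurable_continuous_Pair[OF assms])
     (intro bounded_bilinear.continuous_on[OF bounded_bilinear_scaleC] continuous_intros)

lemma borel_measurable_cinner [measurable]:
  fixes f g :: "'x \<Rightarrow> 'a::{complex_inner, second_countable_topology}"
  assumes [measurable]: "f \<in> borel_measurable M" "g \<in> borel_measurable M"
  shows "(\<lambda>x. cinner (f x) (g x)) \<in> borel_measurable M"
  unfolding cinner_eq complex_eq_iff Complex_eq by measurable

instantiation complex :: complex_inner
begin
definition scaleC_complex_def [simp]: "a *\<^sub>C (x::complex) = a * x"
definition cinner_complex_def [simp]: "cinner (x::complex) y = x * cnj y"
instance
  by standard (auto simp: algebra_simps scaleR_conv_of_real inner_complex_def)
end

class separable_hilbert_space = complex_inner + complete_space + second_countable_topology
begin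
subclass banach ..
end

instance complex :: separable_hilbert_space ..

definition bounded_clinear :: "('a::complex_inner \<Rightarrow> 'b::complex_inner) \<Rightarrow> bool" where
  "bounded_clinear f \<longleftrightarrow> bounded_linear f \<and> (\<forall>c x. f (c *\<^sub>C x) = c *\<^sub>C f x)"

definition hilbert_adjoint ::
  "('a::complex_inner \<Rightarrow> 'b::complex_inner) \<Rightarrow> 'b \<Rightarrow> 'a" where
  "hilbert_adjoint T = (THE S. \<forall>x y. cinner (T x) y = cinner x (S y))"

section \<open>The unit circle and vector-valued square-integrable functions\<close>

text \<open>Normalized arc length measure: the push-forward of the uniform measure on the interval from 0
  to 2 pi; its underlying space is exactly the unit circle.\<close>

definition circle :: "complex measure" where
  "circle = distr (uniform_measure lborel {0..2*pi}) (restrict_space borel (sphere 0 1)) cis"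

lemma space_circle [simp]: "space circle = sphere 0 1"
  by (simp add: circle_def)

lemma sets_circle [measurable_cong]: "sets circle = sets (restrict_space borel (sphere 0 1))"
  by (simp add: circle_def)

lemma cis_measurable [measurable]:
  "cis \<in> measurable (uniform_measure lborel {0..2*pi}) (restrict_space borel (sphere 0 1))"
proof -
  have "cis \<in> borel_measurable borel"
    by (intro borel_measurable_continuous_onI continuous_on_cis continuous_on_id)
  then show ?thesis
    by (auto intro!: measurable_restrict_space2 simp: measurable_cong_sets[OF sets_uniform_measure refl])
qed

lemma prob_space_circle: "emeasure circle (space circle) = 1"
  proof -
  have "sphere 0 1 \<in> sets (restrict_space borel (sphere (0::complex) 1))"
    by (metis sets.top space_restrict_space space_borel Int_UNIV_right)
  then show ?thesis
    unfolding circle_def by (subst emeasure_distr) (auto simp: vimage_def)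
qed

lemma finite_measure_circle: "finite_measure circle"
  by (rule finite_measureI) (use prob_space_circle in simp)

lemma borel_circle_measurable:
  "f \<in> borel_measurable borel \<Longrightarrow> f \<in> borel_measurable circle"
  by (simp add: measurable_cong_sets[OF sets_circle refl] measurable_restrict_space1)

lemma AE_circle_iff:
  assumes [measurable]: "Measurable.pred circle P"
  shows "(AE z in circle. P z) \<longleftrightarrow> (AE t in lborel. t \<in> {0..2*pi} \<longrightarrow> P (cis t))"
proof -
  have "{x \<in> space (restrict_space borel (sphere 0 1)). P x} \<in> sets (restrict_space borel (sphere 0 1))"
    using assms by (simp add: pred_def sets_circle)
  then show ?thesis
    unfolding circle_def by (subst AE_distr_iff) (auto simp: AE_uniform_measure)
qed

lemma uniform_measure_circle:
  "uniform_measure lborel {0..2*pi} = density lborel (\<lambda>t. ennreal (indicator {0..2*pi} t / (2*pi)))"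
proof -
  have "ennreal 1 / ennreal (2*pi) = ennreal (1 / (2*pi))"
    by (rule divide_ennreal) auto
  then have "indicator {0..2*pi} t / emeasure lborel {0..2*pi} = ennreal (indicator {0..2*pi} t / (2*pi))"
    for t :: real
    by (auto split: split_indicator)
  then show ?thesis by (simp add: uniform_measure_def)
qed

lemma integral_circle:
  fixes f :: "complex \<Rightarrow> 'e::{banach, second_countable_topology}"
  assumes "f \<in> borel_measurable circle"
  shows "(LINT z|circle. f z) = (1 / (2*pi)) *\<^sub>R (LINT t:{0..2*pi}|lborel. f (cis t))"
proof -
  have f[measurable]: "f \<in> borel_measurable (restrict_space borel (sphere 0 1))"
    using assms by (simp add: measurable_cong_sets[OF sets_circle refl])
  have "(\<lambda>t. f (cis t)) \<in> borel_measurable (uniform_measure lborel {0..2*pi})"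
    by measurable
  then have [measurable]: "(\<lambda>t. f (cis t)) \<in> borel_measurable lborel"
    by (simp add: measurable_cong_sets[OF sets_uniform_measure refl])
  have "(LINT z|circle. f z) = (LINT t|uniform_measure lborel {0..2*pi}. f (cis t))"
    unfolding circle_def by (rule integral_distr) measurable
  also have "\<dots> = (LINT t|lborel. (indicator {0..2*pi} t / (2*pi)) *\<^sub>R f (cis t))"
    unfolding uniform_measure_circle by (rule integral_density) (auto intro!: AE_I2)
  also have "\<dots> = (LINT t|lborel. (1 / (2*pi)) *\<^sub>R (indicator {0..2*pi} t *\<^sub>R f (cis t)))"
    by simp
  finally show ?thesis
    unfolding set_lebesgue_integral_def by (simp only: integral_scaleR_right)
qed

lemma distr_circle_cnj: "distr circle circle cnj = circle"
proof -
  let ?U = "uniform_measure lborel {0..2*pi}"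
  let ?R = "restrict_space borel (sphere 0 1) :: complex measure"
  let ?r = "\<lambda>t. 2*pi - t :: real"
  let ?g = "\<lambda>t::real. ennreal (indicator {0..2*pi} t / (2*pi))"
  have "lborel = density (distr lborel borel (\<lambda>x. 2*pi + (-1) * x)) (\<lambda>_. ennreal \<bar>-1\<bar>)"
    by (rule lborel_real_affine) simp
  then have lb: "distr lborel lborel ?r = lborel"
    by (simp add: density_1 cong: distr_cong)
  have g: "?g (?r t) = ?g t" for t
    by (auto simp: indicator_def)
  have "distr ?U ?U ?r = distr (density lborel (\<lambda>t. ?g (?r t))) lborel ?r"
    unfolding g uniform_measure_circle by (rule distr_cong) auto
  also have "\<dots> = density (distr lborel lborel ?r) ?g"
    by (rule density_distr[symmetric]) measurable
  also have "\<dots> = ?U"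
    unfolding lb uniform_measure_circle ..
  finally have U: "distr ?U ?U ?r = ?U" .
  have r: "?r \<in> measurable ?U ?U" by measurable
  have c: "cnj \<in> measurable ?R ?R"
    by (intro measurable_restrict_space2 measurable_restrict_space1 borel_measurable_continuous_onI
        continuous_intros) (auto simp: space_restrict_space)
  have cc: "cnj \<circ> cis = cis \<circ> ?r"
    by (auto simp: fun_eq_iff complex_eq_iff cos_diff sin_diff)
  have "distr circle circle cnj = distr (distr ?U ?R cis) ?R cnj"
    by (rule distr_cong) (auto simp: circle_def)
  also have "\<dots> = distr ?U ?R (cnj \<circ> cis)"
    by (rule distr_distr[OF c cis_measurable])
  also have "\<dots> = distr (distr ?U ?U ?r) ?R cis"
    unfolding cc by (rule distr_distr[OF cis_measurable r, symmetric])
  finally show ?thesis unfolding U circle_def .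
qed


definition square_integrable :: "(complex \<Rightarrow> 'e::separable_hilbert_space) \<Rightarrow> bool" where
  "square_integrable f \<longleftrightarrow>
     f \<in> borel_measurable circle \<and> integrable circle (\<lambda>z. (norm (f z))\<^sup>2)"

lemma square_integrable_measurable: "square_integrable f \<Longrightarrow> f \<in> borel_measurable circle"
  by (simp add: square_integrable_def)

lemma square_integrable_zero: "square_integrable (\<lambda>_. 0)"
  by (simp add: square_integrable_def)

lemma square_integrable_bound:
  assumes f: "square_integrable f" and [measurable]: "g \<in> borel_measurable circle"
    and "AE z in circle. norm (g z) \<le> C * norm (f z)"
  shows "square_integrable g"
proof -
  have "integrable circle (\<lambda>z. C\<^sup>2 * (norm (f z))\<^sup>2)"
    using f by (simp add: square_integrable_def)
  then have "integrable circle (\<lambda>z. (norm (g z))\<^sup>2)"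
  proof (rule Bochner_Integration.integrable_bound)
    show "AE z in circle. norm ((norm (g z))\<^sup>2) \<le> norm (C\<^sup>2 * (norm (f z))\<^sup>2)"
      using assms(3)
    proof eventually_elim
      case (elim z)
      then have "(norm (g z))\<^sup>2 \<le> (C * norm (f z))\<^sup>2"
        by (intro power_mono) auto
      then show ?case by (simp add: power_mult_distrib)
    qed
  qed measurable
  then show ?thesis by (simp add: square_integrable_def)
qed

lemma square_integrable_add:
  assumes f: "square_integrable f" and g: "square_integrable g"
  shows "square_integrable (\<lambda>z. f z + g z)"
proof -
  note [measurable] = f[THEN square_integrable_measurable] g[THEN square_integrable_measurable]
  have "integrable circle (\<lambda>z. 2 * (norm (f z))\<^sup>2 + 2 * (norm (g z))\<^sup>2)"
    using f g by (simp add: square_integrable_def)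
  then have "integrable circle (\<lambda>z. (norm (f z + g z))\<^sup>2)"
  proof (rule Bochner_Integration.integrable_bound)
    have "(norm (f z + g z))\<^sup>2 \<le> 2 * (norm (f z))\<^sup>2 + 2 * (norm (g z))\<^sup>2" for z
    proof -
      have "(norm (f z + g z))\<^sup>2 \<le> (norm (f z) + norm (g z))\<^sup>2"
        by (intro power_mono norm_triangle_ineq) auto
      also have "\<dots> \<le> 2 * (norm (f z))\<^sup>2 + 2 * (norm (g z))\<^sup>2"
        using sum_squares_ge_zero[of "norm (f z) - norm (g z)" 0]
        by (simp add: power2_eq_square algebra_simps)
      finally show ?thesis .
    qed
    then show "AE z in circle. norm ((norm (f z + g z))\<^sup>2)
        \<le> norm (2 * (norm (f z))\<^sup>2 + 2 * (norm (g z))\<^sup>2)"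
      by (intro AE_I2) simp
  qed measurable
  then show ?thesis by (simp add: square_integrable_def)
qed

lemma square_integrable_scaleC:
  assumes "square_integrable f"
  shows "square_integrable (\<lambda>z. a *\<^sub>C f z)"
proof -
  note [measurable] = assms[THEN square_integrable_measurable]
  show ?thesis
    by (rule square_integrable_bound[OF assms, of _ "cmod a"]) (auto simp: norm_scaleC)
qed

lemma integrable_square_integrable:
  assumes f: "square_integrable f"
  shows "integrable circle f"
proof (rule Bochner_Integration.integrable_bound)
  interpret finite_measure circle by (rule finite_measure_circle)
  show "integrable circle (\<lambda>z. 1 + (norm (f z))\<^sup>2)"
    using f by (simp add: square_integrable_def)
  show "f \<in> borel_measurable circle"
    using f by (rule square_integrable_measurable)
  have "x \<le> 1 + x\<^sup>2" for x :: real
    using zero_le_power2[of "x - 1/2"] by (simp add: power2_eq_square algebra_simps)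
  then show "AE z in circle. norm (f z) \<le> norm (1 + (norm (f z))\<^sup>2)"
    by (intro AE_I2) (simp add: order_trans[OF _ abs_ge_self])
qed

lemma integrable_cinner:
  assumes f: "square_integrable f" and g: "square_integrable g"
  shows "integrable circle (\<lambda>z. cinner (f z) (g z))"
proof (rule Bochner_Integration.integrable_bound)
  note [measurable] = f[THEN square_integrable_measurable] g[THEN square_integrable_measurable]
  show "integrable circle (\<lambda>z. (norm (f z))\<^sup>2 + (norm (g z))\<^sup>2)"
    using f g by (simp add: square_integrable_def)
  show "(\<lambda>z. cinner (f z) (g z)) \<in> borel_measurable circle" by measurable
  have "cmod (cinner x y) \<le> (norm x)\<^sup>2 + (norm y)\<^sup>2" for x y :: 'a
  proof -
    have "\<bar>x \<bullet> y\<bar> \<le> norm x * norm y"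
      by (rule Cauchy_Schwarz_ineq2)
    moreover have "\<bar>x \<bullet> (\<i> *\<^sub>C y)\<bar> \<le> norm x * norm y"
      using Cauchy_Schwarz_ineq2[of x "\<i> *\<^sub>C y"] by (simp add: norm_scaleC)
    ultimately have "cmod (cinner x y) \<le> 2 * (norm x * norm y)"
      using cmod_le[of "cinner x y"] by (simp add: cinner_eq)
    also have "\<dots> \<le> (norm x)\<^sup>2 + (norm y)\<^sup>2"
      using zero_le_power2[of "norm x - norm y"] by (simp add: power2_eq_square algebra_simps)
    finally show ?thesis .
  qed
  then show "AE z in circle. norm (cinner (f z) (g z)) \<le> norm ((norm (f z))\<^sup>2 + (norm (g z))\<^sup>2)"
    by (intro AE_I2) (simp add: order_trans[OF _ abs_ge_self])
qed

definition L2_rel :: "(complex \<Rightarrow> 'e::separable_hilbert_space) \<Rightarrow> (complex \<Rightarrow> 'e) \<Rightarrow> bool" where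
  "L2_rel f g \<longleftrightarrow> square_integrable f \<and> square_integrable g \<and> (AE z in circle. f z = g z)"

lemma part_equivp_L2_rel: "part_equivp (L2_rel :: (complex \<Rightarrow> 'a::separable_hilbert_space) \<Rightarrow> _)"
proof (rule part_equivpI)
  show "\<exists>f. L2_rel f (f :: complex \<Rightarrow> 'a)"
    using square_integrable_zero by (auto simp: L2_rel_def)
  show "symp (L2_rel :: (complex \<Rightarrow> 'a) \<Rightarrow> _)"
    by (rule sympI) (auto simp: L2_rel_def elim: eventually_mono)
  show "transp (L2_rel :: (complex \<Rightarrow> 'a) \<Rightarrow> _)"
  proof (rule transpI)
    fix f g h :: "complex \<Rightarrow> 'a"
    assume *: "L2_rel f g" "L2_rel g h"
    then have "AE z in circle. f z = g z" "AE z in circle. g z = h z"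
      by (auto simp: L2_rel_def)
    then have "AE z in circle. f z = h z" by eventually_elim simp
    with * show "L2_rel f h" by (auto simp: L2_rel_def)
  qed
qed

quotient_type (overloaded) 'e L2 = "complex \<Rightarrow> 'e::separable_hilbert_space" / partial: L2_rel
  by (rule part_equivp_L2_rel)

instantiation L2 :: (separable_hilbert_space) complex_inner
begin

lift_definition zero_L2 :: "'a L2" is "\<lambda>_. 0"
  by (simp add: L2_rel_def square_integrable_zero)

lift_definition plus_L2 :: "'a L2 \<Rightarrow> 'a L2 \<Rightarrow> 'a L2" is "\<lambda>f g z. f z + g z"
  by (auto simp: L2_rel_def square_integrable_add elim: eventually_elim2)

lift_definition scaleC_L2 :: "complex \<Rightarrow> 'a L2 \<Rightarrow> 'a L2" is "\<lambda>a f z. a *\<^sub>C f z"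
  by (auto simp: L2_rel_def square_integrable_scaleC)

lift_definition cinner_L2 :: "'a L2 \<Rightarrow> 'a L2 \<Rightarrow> complex"
  is "\<lambda>f g. LINT z|circle. cinner (f z) (g z)"
proof (unfold L2_rel_def, elim conjE)
  fix f f' g g' :: "complex \<Rightarrow> 'a"
  assume "square_integrable f" "square_integrable f'" "square_integrable g" "square_integrable g'"
  note [measurable] = this[THEN square_integrable_measurable]
  assume "AE z in circle. f z = f' z" "AE z in circle. g z = g' z"
  then have "AE z in circle. cinner (f z) (g z) = cinner (f' z) (g' z)"
    by eventually_elim simp
  then show "(LINT z|circle. cinner (f z) (g z)) = (LINT z|circle. cinner (f' z) (g' z))"
    by (intro integral_cong_AE) measurable
qed

definition scaleR_L2 :: "real \<Rightarrow> 'a L2 \<Rightarrow> 'a L2" where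
  "r *\<^sub>R F = complex_of_real r *\<^sub>C F" for F :: "'a L2"
definition uminus_L2 :: "'a L2 \<Rightarrow> 'a L2" where
  "- F = (- 1) *\<^sub>C F" for F :: "'a L2"
definition minus_L2 :: "'a L2 \<Rightarrow> 'a L2 \<Rightarrow> 'a L2" where
  "F - G = F + - G" for F G :: "'a L2"
definition inner_L2 :: "'a L2 \<Rightarrow> 'a L2 \<Rightarrow> real" where
  "F \<bullet> G = Re (cinner F G)" for F G :: "'a L2"
definition norm_L2 :: "'a L2 \<Rightarrow> real" where
  "norm F = sqrt (F \<bullet> F)" for F :: "'a L2"
definition sgn_L2 :: "'a L2 \<Rightarrow> 'a L2" where
  "sgn F = inverse (norm F) *\<^sub>R F" for F :: "'a L2"
definition dist_L2 :: "'a L2 \<Rightarrow> 'a L2 \<Rightarrow> real" where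
  "dist F G = norm (F - G)" for F G :: "'a L2"
definition uniformity_L2 :: "('a L2 \<times> 'a L2) filter" where
  "uniformity_L2 = (INF e\<in>{0<..}. principal {(F, G). dist F G < e})"
definition open_L2 :: "'a L2 set \<Rightarrow> bool" where
  "open_L2 U \<longleftrightarrow> (\<forall>F\<in>U. eventually (\<lambda>(F', G). F' = F \<longrightarrow> G \<in> U) uniformity)"

instance
proof
  fix F G H :: "'a L2" and a b :: complex and r s :: real
  have one: "1 *\<^sub>C x = x" for x :: 'a
    using scaleR_scaleC[of 1 x] by simp
  have zero: "0 *\<^sub>C x = 0" for x :: 'a
    using scaleR_scaleC[of 0 x] by simp
  note sq = square_integrable_zero square_integrable_add square_integrable_scaleC
  show add_assoc: "F + G + H = F + (G + H)"
    by transfer (auto simp: L2_rel_def sq add.assoc)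
  show "F + G = G + F"
    by transfer (auto simp: L2_rel_def sq add.commute)
  show "0 + F = F"
    by transfer (auto simp: L2_rel_def sq)
  show "- F + F = 0"
    unfolding uminus_L2_def
  proof transfer
    fix f :: "complex \<Rightarrow> 'a" assume "L2_rel f f"
    moreover have "(- 1) *\<^sub>C x + x = 0" for x :: 'a
      using scaleC_add_left[of "- 1" 1 x] by (simp add: one zero)
    ultimately show "L2_rel (\<lambda>z. (- 1) *\<^sub>C f z + f z) (\<lambda>_. 0)"
      by (simp add: L2_rel_def sq)
  qed
  show "F - G = F + - G" by (rule minus_L2_def)
  show cadd: "a *\<^sub>C (F + G) = a *\<^sub>C F + a *\<^sub>C G" for a
    by transfer (auto simp: L2_rel_def sq scaleC_add_right)
  show cadd': "(a + b) *\<^sub>C F = a *\<^sub>C F + b *\<^sub>C F" for a b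
    by transfer (auto simp: L2_rel_def sq scaleC_add_left)
  show cc: "a *\<^sub>C b *\<^sub>C F = (a * b) *\<^sub>C F" for a b
    by transfer (auto simp: L2_rel_def sq scaleC_scaleC)
  have one': "1 *\<^sub>C F = F"
    by transfer (auto simp: L2_rel_def one)
  show "r *\<^sub>R F = complex_of_real r *\<^sub>C F" by (rule scaleR_L2_def)
  show "r *\<^sub>R (F + G) = r *\<^sub>R F + r *\<^sub>R G" by (simp add: scaleR_L2_def cadd)
  show "(r + s) *\<^sub>R F = r *\<^sub>R F + s *\<^sub>R F" by (simp add: scaleR_L2_def cadd')
  show "r *\<^sub>R s *\<^sub>R F = (r * s) *\<^sub>R F" by (simp add: scaleR_L2_def cc)
  show "1 *\<^sub>R F = F" by (simp add: scaleR_L2_def one')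
  show ccomm: "cinner F G = cnj (cinner G F)" for F G :: "'a L2"
  proof transfer
    fix f g :: "complex \<Rightarrow> 'a"
    have "(LINT z|circle. cinner (f z) (g z)) = (LINT z|circle. cnj (cinner (g z) (f z)))"
      by (rule Bochner_Integration.integral_cong[OF refl]) (rule cinner_commute)
    then show "(LINT z|circle. cinner (f z) (g z)) = cnj (LINT z|circle. cinner (g z) (f z))"
      by simp
  qed
  show caddl: "cinner (F + G) H = cinner F H + cinner G H"
    by transfer (simp add: L2_rel_def cinner_add_left integrable_cinner)
  show cscl: "cinner (a *\<^sub>C F) G = a * cinner F G" for a
    by transfer (simp add: cinner_scaleC_left)
  show "Re (cinner F G) = F \<bullet> G" by (simp add: inner_L2_def)
  show "F \<bullet> G = G \<bullet> F" unfolding inner_L2_def by (subst ccomm) simp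
  show "(F + G) \<bullet> H = F \<bullet> H + G \<bullet> H" by (simp add: inner_L2_def caddl)
  show "r *\<^sub>R F \<bullet> G = r * (F \<bullet> G)" by (simp add: inner_L2_def scaleR_L2_def cscl)
  show "0 \<le> F \<bullet> F"
    unfolding inner_L2_def by transfer (simp add: cinner_self del: of_real_power)
  show "F \<bullet> F = 0 \<longleftrightarrow> F = 0"
    unfolding inner_L2_def
  proof transfer
    fix f :: "complex \<Rightarrow> 'a" assume "L2_rel f f"
    then have f: "square_integrable f" by (simp add: L2_rel_def)
    have "Re (LINT z|circle. cinner (f z) (f z)) = (LINT z|circle. (norm (f z))\<^sup>2)"
      by (simp add: cinner_self del: of_real_power)
    moreover have "(LINT z|circle. (norm (f z))\<^sup>2) = 0 \<longleftrightarrow> (AE z in circle. (norm (f z))\<^sup>2 = 0)"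
      using f by (intro integral_nonneg_eq_0_iff_AE) (auto simp: square_integrable_def)
    ultimately show "Re (LINT z|circle. cinner (f z) (f z)) = 0 \<longleftrightarrow> L2_rel f (\<lambda>_. 0)"
      using f by (simp add: L2_rel_def square_integrable_zero)
  qed
qed (simp_all add: norm_L2_def sgn_L2_def dist_L2_def uniformity_L2_def open_L2_def)

end

lemma measurable_cnj_circle: "cnj \<in> measurable circle circle"
proof -
  have "cnj \<in> measurable (restrict_space borel (sphere 0 1)) (restrict_space borel (sphere 0 1))"
    by (intro measurable_restrict_space2 measurable_restrict_space1 borel_measurable_continuous_onI
        continuous_intros) (auto simp: space_restrict_space)
  then show ?thesis
    by (simp add: measurable_cong_sets[OF sets_circle sets_circle])
qed

lemma AE_circle_cnj:
  assumes "AE z in circle. P z"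
  shows "AE z in circle. P (cnj z)"
proof -
  have "AE z in distr circle circle cnj. P z"
    unfolding distr_circle_cnj by (rule assms)
  then show ?thesis
    by (rule AE_distrD[OF measurable_cnj_circle])
qed

lemma square_integrable_cnj:
  assumes "square_integrable f"
  shows "square_integrable (\<lambda>z. f (cnj z))"
proof -
  have "integrable (distr circle circle cnj) (\<lambda>z. (norm (f z))\<^sup>2)"
    unfolding distr_circle_cnj using assms by (simp add: square_integrable_def)
  from integrable_distr[OF measurable_cnj_circle this] show ?thesis
    using assms measurable_compose[OF measurable_cnj_circle] by (auto simp: square_integrable_def)
qed

lemma measurable_powi_circle [measurable]: "(\<lambda>z. z powi n) \<in> borel_measurable circle"
proof -
  have "(\<lambda>z::complex. z powi n) \<in> borel_measurable borel"
    unfolding power_int_def by measurable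
  then show ?thesis by (rule borel_circle_measurable)
qed

lemma square_integrable_powi:
  assumes "square_integrable f"
  shows "square_integrable (\<lambda>z. (z powi n) *\<^sub>C f z)"
proof -
  note [measurable] = assms[THEN square_integrable_measurable]
  show ?thesis
    by (rule square_integrable_bound[OF assms, of _ 1])
      (auto intro!: AE_I2 simp: norm_scaleC norm_power_int)
qed

lift_definition fourier_coeff :: "'e::separable_hilbert_space L2 \<Rightarrow> int \<Rightarrow> 'e"
  is "\<lambda>f n. LINT z|circle. (z powi (- n)) *\<^sub>C f z"
proof (unfold L2_rel_def, elim conjE, rule ext)
  fix f f' :: "complex \<Rightarrow> 'e" and n
  assume "square_integrable f" "square_integrable f'"
  note [measurable] = this[THEN square_integrable_measurable]
  assume "AE z in circle. f z = f' z"
  then have "AE z in circle. (z powi (- n)) *\<^sub>C f z = (z powi (- n)) *\<^sub>C f' z"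
    by eventually_elim simp
  then show "(LINT z|circle. (z powi (- n)) *\<^sub>C f z) = (LINT z|circle. (z powi (- n)) *\<^sub>C f' z)"
    by (intro integral_cong_AE) measurable
qed

lemma fourier_coeff_add: "fourier_coeff (F + G) n = fourier_coeff F n + fourier_coeff G n"
  by transfer
    (simp add: L2_rel_def scaleC_add_right integrable_square_integrable square_integrable_powi)

lemma fourier_coeff_scaleC: "fourier_coeff (a *\<^sub>C F) n = a *\<^sub>C fourier_coeff F n"
proof transfer
  fix a n and f :: "complex \<Rightarrow> 'a"
  assume "L2_rel f f"
  then have f: "integrable circle (\<lambda>z. (z powi (- n)) *\<^sub>C f z)"
    by (simp add: L2_rel_def integrable_square_integrable square_integrable_powi)
  have "(LINT z|circle. a *\<^sub>C (z powi (- n)) *\<^sub>C f z) = a *\<^sub>C (LINT z|circle. (z powi (- n)) *\<^sub>C f z)"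
    by (rule integral_bounded_linear[OF bounded_linear_scaleC_right f])
  then show "(LINT z|circle. (z powi (- n)) *\<^sub>C a *\<^sub>C f z) = a *\<^sub>C (LINT z|circle. (z powi (- n)) *\<^sub>C f z)"
    by (simp add: scaleC_scaleC mult.commute)
qed

lemma fourier_coeff_zero: "fourier_coeff 0 n = 0"
  using fourier_coeff_add[of 0 0 n] by simp

lemma fourier_coeff_uminus: "fourier_coeff (- F) n = - fourier_coeff F n"
  using fourier_coeff_scaleC[of "- 1" F n] by (simp add: scaleC_minus1)

lift_definition conj_flip :: "'e::separable_hilbert_space L2 \<Rightarrow> 'e L2" is "\<lambda>f z. f (cnj z)"
proof (unfold L2_rel_def, elim conjE, intro conjI square_integrable_cnj)
  fix f g :: "complex \<Rightarrow> 'e"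
  assume "AE z in circle. f z = g z"
  then show "AE z in circle. f (cnj z) = g (cnj z)" by (rule AE_circle_cnj)
qed

section \<open>Operator-valued symbols\<close>

text \<open>
  Essentially bounded functions from the circle to the bounded operators, not identified up to null
  sets. Measurability is with respect to the strong operator topology (equivalently the weak one,
  by separability). For the norm topology the notion would be too narrow when the coefficient space
  is infinite-dimensional: z \<mapsto> diag (z, z^2, z^3, ...) is not norm measurable.
  Values off the circle are irrelevant.
\<close>

definition L_infinity :: "(complex \<Rightarrow> 'e::separable_hilbert_space \<Rightarrow> 'e) set" where
  "L_infinity = {\<Phi>. (\<forall>z\<in>sphere 0 1. bounded_clinear (\<Phi> z)) \<and>
     (\<forall>x. (\<lambda>z. \<Phi> z x) \<in> borel_measurable circle) \<and>
     (\<exists>C. AE z in circle. onorm (\<Phi> z) \<le> C)}"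

lemma measurable_L_infinity_apply:
  assumes \<Phi>: "\<Phi> \<in> L_infinity" and f: "f \<in> borel_measurable circle"
  shows "(\<lambda>z. \<Phi> z (f z)) \<in> borel_measurable circle"
proof -
  obtain s where s: "\<And>i. simple_function circle (s i)"
    and lim: "\<And>z. z \<in> space circle \<Longrightarrow> (\<lambda>i. s i z) \<longlonglongrightarrow> f z"
    using borel_measurable_implies_sequence_metric[OF f, of 0] by blast
  show ?thesis
  proof (rule borel_measurable_LIMSEQ_metric)
    fix i
    have fin: "finite (s i ` space circle)"
      using s by (rule simple_functionD)
    show "(\<lambda>z. \<Phi> z (s i z)) \<in> borel_measurable circle"
    proof (rule measurable_compose_countable'[where I = "s i ` space circle" and g = "s i" and f = "\<lambda>x z. \<Phi> z x"])
      show "(\<lambda>z. \<Phi> z x) \<in> borel_measurable circle" for x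
        using \<Phi> by (simp add: L_infinity_def)
      have "simple_function circle (s i)" by (rule s)
      then show "s i \<in> measurable circle (count_space (s i ` space circle))"
        using fin by (auto simp: measurable_count_space_eq2 simple_function_def)
      show "countable (s i ` space circle)"
        using fin by (rule countable_finite)
    qed
  next
    fix z assume z: "z \<in> space circle"
    then have "bounded_linear (\<Phi> z)"
      using \<Phi> by (simp add: L_infinity_def bounded_clinear_def)
    then show "(\<lambda>i. \<Phi> z (s i z)) \<longlonglongrightarrow> \<Phi> z (f z)"
      using lim[OF z] by (rule bounded_linear.tendsto)
  qed
qed

lemma square_integrable_L_infinity_apply:
  assumes \<Phi>: "\<Phi> \<in> L_infinity" and f: "square_integrable f"
  shows "square_integrable (\<lambda>z. \<Phi> z (f z))"
proof -
  obtain C where C: "AE z in circle. onorm (\<Phi> z) \<le> C"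
    using \<Phi> by (auto simp: L_infinity_def)
  have "AE z in circle. norm (\<Phi> z (f z)) \<le> C * norm (f z)"
    using C AE_space
  proof eventually_elim
    case (elim z)
    then have "bounded_linear (\<Phi> z)"
      using \<Phi> by (simp add: L_infinity_def bounded_clinear_def)
    then have "norm (\<Phi> z (f z)) \<le> onorm (\<Phi> z) * norm (f z)"
      by (rule onorm)
    also have "\<dots> \<le> C * norm (f z)"
      using elim by (intro mult_right_mono) auto
    finally show ?case .
  qed
  then show ?thesis
    by (rule square_integrable_bound[OF f measurable_L_infinity_apply[OF \<Phi> square_integrable_measurable[OF f]]])
qed

text \<open>For essentially bounded symbols this does not depend on the representative, see
  mult_op_abs_L2.\<close>

definition mult_op :: "(complex \<Rightarrow> 'e::separable_hilbert_space \<Rightarrow> 'e) \<Rightarrow> 'e L2 \<Rightarrow> 'e L2" where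
  "mult_op \<Phi> F = abs_L2 (\<lambda>z. \<Phi> z (rep_L2 F z))"

lemma mult_op_abs_L2:
  assumes \<Phi>: "\<Phi> \<in> L_infinity" and f: "square_integrable f"
  shows "mult_op \<Phi> (abs_L2 f) = abs_L2 (\<lambda>z. \<Phi> z (f z))"
proof -
  have "L2_rel f f" using f by (simp add: L2_rel_def)
  then have "L2_rel (rep_L2 (abs_L2 f)) f"
    by (metis Quotient3_L2 rep_abs_rsp_left)
  then have "L2_rel (\<lambda>z. \<Phi> z (rep_L2 (abs_L2 f) z)) (\<lambda>z. \<Phi> z (f z))"
    by (auto simp: L2_rel_def square_integrable_L_infinity_apply[OF \<Phi>])
  then show ?thesis
    unfolding mult_op_def by (rule Quotient3_rel_abs[OF Quotient3_L2])
qed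

section \<open>Hardy space, Toeplitz and Hankel operators\<close>

typedef (overloaded) 'e hardy =
  "{F :: 'e::separable_hilbert_space L2. \<forall>n<0. fourier_coeff F n = 0}"
  morphisms hardy_incl Abs_hardy
  by (rule exI[of _ 0]) (simp add: fourier_coeff_zero)

setup_lifting type_definition_hardy

instantiation hardy :: (separable_hilbert_space) complex_inner
begin

lift_definition zero_hardy :: "'a hardy" is 0
  by (simp add: fourier_coeff_zero)
lift_definition plus_hardy :: "'a hardy \<Rightarrow> 'a hardy \<Rightarrow> 'a hardy" is "(+)"
  by (simp add: fourier_coeff_add)
lift_definition scaleC_hardy :: "complex \<Rightarrow> 'a hardy \<Rightarrow> 'a hardy" is "(*\<^sub>C)"
  by (simp add: fourier_coeff_scaleC scaleC_zero_right)
lift_definition cinner_hardy :: "'a hardy \<Rightarrow> 'a hardy \<Rightarrow> complex" is cinner .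
lift_definition scaleR_hardy :: "real \<Rightarrow> 'a hardy \<Rightarrow> 'a hardy" is "(*\<^sub>R)"
  by (simp add: scaleR_scaleC fourier_coeff_scaleC scaleC_zero_right)
lift_definition uminus_hardy :: "'a hardy \<Rightarrow> 'a hardy" is uminus
  by (simp add: fourier_coeff_uminus)
lift_definition minus_hardy :: "'a hardy \<Rightarrow> 'a hardy \<Rightarrow> 'a hardy" is "(-)"
  by (simp add: fourier_coeff_add fourier_coeff_uminus diff_conv_add_uminus del: add_uminus_conv_diff)
lift_definition inner_hardy :: "'a hardy \<Rightarrow> 'a hardy \<Rightarrow> real" is "(\<bullet>)" .
lift_definition norm_hardy :: "'a hardy \<Rightarrow> real" is norm .
definition sgn_hardy :: "'a hardy \<Rightarrow> 'a hardy" where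
  "sgn F = inverse (norm F) *\<^sub>R F" for F :: "'a hardy"
lift_definition dist_hardy :: "'a hardy \<Rightarrow> 'a hardy \<Rightarrow> real" is dist .
definition uniformity_hardy :: "('a hardy \<times> 'a hardy) filter" where
  "uniformity_hardy = (INF e\<in>{0<..}. principal {(F, G). dist F G < e})"
definition open_hardy :: "'a hardy set \<Rightarrow> bool" where
  "open_hardy U \<longleftrightarrow> (\<forall>F\<in>U. eventually (\<lambda>(F', G). F' = F \<longrightarrow> G \<in> U) uniformity)"

instance
proof
  fix F G H :: "'a hardy" and a b :: complex and r s :: real
  show "F + G + H = F + (G + H)" by transfer (rule add.assoc)
  show "F + G = G + F" by transfer (rule add.commute)
  show "0 + F = F" by transfer simp
  show "- F + F = 0" by transfer simp
  show "F - G = F + - G" by transfer simp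
  show "a *\<^sub>C (F + G) = a *\<^sub>C F + a *\<^sub>C G" by transfer (rule scaleC_add_right)
  show "(a + b) *\<^sub>C F = a *\<^sub>C F + b *\<^sub>C F" by transfer (rule scaleC_add_left)
  show "a *\<^sub>C b *\<^sub>C F = (a * b) *\<^sub>C F" by transfer (rule scaleC_scaleC)
  show "r *\<^sub>R F = complex_of_real r *\<^sub>C F" by transfer (rule scaleR_scaleC)
  show "r *\<^sub>R (F + G) = r *\<^sub>R F + r *\<^sub>R G" by transfer (rule scaleR_add_right)
  show "(r + s) *\<^sub>R F = r *\<^sub>R F + s *\<^sub>R F" by transfer (rule scaleR_add_left)
  show "r *\<^sub>R s *\<^sub>R F = (r * s) *\<^sub>R F" by transfer (rule scaleR_scaleR)
  show "1 *\<^sub>R F = F" by transfer (rule scaleR_one)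
  show "cinner F G = cnj (cinner G F)" by transfer (rule cinner_commute)
  show "cinner (F + G) H = cinner F H + cinner G H" by transfer (rule cinner_add_left)
  show "cinner (a *\<^sub>C F) G = a * cinner F G" by transfer (rule cinner_scaleC_left)
  show "Re (cinner F G) = F \<bullet> G" by transfer (rule Re_cinner)
  show "F \<bullet> G = G \<bullet> F" by transfer (rule inner_commute)
  show "(F + G) \<bullet> H = F \<bullet> H + G \<bullet> H" by transfer (rule inner_add_left)
  show "r *\<^sub>R F \<bullet> G = r * (F \<bullet> G)" by transfer (rule inner_scaleR_left)
  show "0 \<le> F \<bullet> F" by transfer (rule inner_ge_zero)
  show "F \<bullet> F = 0 \<longleftrightarrow> F = 0" by transfer (rule inner_eq_zero_iff)
  show "norm F = sqrt (F \<bullet> F)" by transfer (rule norm_eq_sqrt_inner)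
  show "dist F G = norm (F - G)" by transfer (rule dist_norm)
qed (simp_all add: sgn_hardy_def uniformity_hardy_def open_hardy_def)

end

text \<open>The orthogonal projection of L2 onto the Hardy space, with its values taken in the type of the
  latter rather than in L2.\<close>

definition hardy_proj :: "'e::separable_hilbert_space L2 \<Rightarrow> 'e hardy" where
  "hardy_proj F = (THE G. \<forall>K. cinner (F - hardy_incl G) (hardy_incl K) = 0)"

definition toeplitz :: "(complex \<Rightarrow> 'e::separable_hilbert_space \<Rightarrow> 'e) \<Rightarrow> 'e hardy \<Rightarrow> 'e hardy" where
  "toeplitz \<Phi> F = hardy_proj (mult_op \<Phi> (hardy_incl F))"

definition hankel :: "(complex \<Rightarrow> 'e::separable_hilbert_space \<Rightarrow> 'e) \<Rightarrow> 'e hardy \<Rightarrow> 'e hardy" where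
  "hankel \<Phi> F = hardy_proj (mult_op \<Phi> (conj_flip (hardy_incl F)))"

definition is_toeplitz :: "('e::separable_hilbert_space hardy \<Rightarrow> 'e hardy) \<Rightarrow> bool" where
  "is_toeplitz A \<longleftrightarrow> (\<exists>\<Phi>\<in>L_infinity. A = toeplitz \<Phi>)"

definition is_hankel :: "('e::separable_hilbert_space hardy \<Rightarrow> 'e hardy) \<Rightarrow> bool" where
  "is_hankel A \<longleftrightarrow> (\<exists>\<Phi>\<in>L_infinity. A = hankel \<Phi>)"

definition shift :: "'e::separable_hilbert_space hardy \<Rightarrow> 'e hardy" where
  "shift = toeplitz (\<lambda>z x. z *\<^sub>C x)"

abbreviation shift_adj :: "'e::separable_hilbert_space hardy \<Rightarrow> 'e hardy" where
  "shift_adj \<equiv> hilbert_adjoint shift"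

end

theory Submission
  imports Defs
begin

text \<open>
  Let A(i,j) be the operator on the coefficient space that sends x to the i-th Fourier coefficient of
  A (z^j x). Bounded operators on the Hardy space are determined by these entries, and composing with the
  shift or its adjoint moves the column or row index by one. The two characterizations on which
  everything rests are that a bounded operator is a Toeplitz operator if and only if its entries are
  constant along diagonals (is_toeplitz_iff), and a Hankel operator if and only if they are constant along
  antidiagonals (is_hankel_iff). Read entrywise, the second, third and fourth condition of the theorem
  then all become the discrete wave equation
  A(i,j+1) + A(i+2,j+1) = A(i+1,j) + A(i+1,j+2), and a sum of a function of i - j and a function of i + j
  satisfies it.

  Conversely (toeplitz_plus_hankel_if_wave_equation), the wave equation says that moving the matrix n steps
  along its diagonals changes it by a Hankel matrix. Hence the increments
  A(i+k+n,j+k+n) - A(i+k,j+k) along a diagonal are also the differences of entries in two fixed columns,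
  and these are square summable with a bound independent of n. This forces A(i+n,j+n) x to converge in
  norm as n grows. The limits depend only on i - j and inherit the boundedness of A, so they belong to a
  Toeplitz operator; the difference of A and this operator is a bounded Hankel matrix.

  Symbols come from Fejer means. If the forms of all finite sections of the matrix \<gamma>(i - j) are
  bounded by C, testing them on the vectors z^(-j) x shows that the Fejer means of the series of
  \<gamma>(n) z^n have norm at most C at every point z of the circle, while for fixed x they converge in L2. Along
  one subsequence they converge strongly almost everywhere, and the limit is the symbol
  (bounded_toeplitz_form.symbol_exists).

  For Hankel matrices the coefficients of negative index are not given and have to be found (nehari, the
  operator-valued version of Nehari's theorem). One more coefficient is the unknown corner of a block matrix
  whose known rows and columns are copies of the given matrix; Parrott's theorem provides it with an
  arbitrarily small loss in the norm. Repeating this yields a doubly infinite bounded Hankel matrix, which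
  is a Toeplitz matrix with the order of the columns reversed.
\<close>

section \<open>Complex inner products\<close>

lemma scaleC_one [simp]: "1 *\<^sub>C x = (x::'a::complex_vector)"
  using scaleR_scaleC[of 1 x] by simp

lemma scaleC_zero_left [simp]: "0 *\<^sub>C x = (0::'a::complex_vector)"
  using scaleR_scaleC[of 0 x] by simp

declare scaleC_zero_right [simp]

lemma scaleC_minus_right: "a *\<^sub>C (- x) = - (a *\<^sub>C (x::'a::complex_vector))"
  using scaleC_add_right[of a x "- x"] by (simp add: eq_neg_iff_add_eq_0 add.commute)

lemma scaleC_diff_right: "a *\<^sub>C (x - y) = a *\<^sub>C x - a *\<^sub>C (y::'a::complex_vector)"
  unfolding diff_conv_add_uminus by (simp only: scaleC_add_right scaleC_minus_right)

lemma scaleC_sum_right: "a *\<^sub>C sum f S = (\<Sum>x\<in>S. a *\<^sub>C (f x :: 'a::complex_vector))"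
  by (induction S rule: infinite_finite_induct) (auto simp: scaleC_add_right)

lemma scaleC_scaleR_commute: "a *\<^sub>C (r *\<^sub>R x) = r *\<^sub>R (a *\<^sub>C (x::'a::complex_vector))"
  by (simp add: scaleR_scaleC scaleC_scaleC mult.commute)

lemma cinner_add_right: "cinner x (y + z) = cinner x y + cinner x (z::'a::complex_inner)"
  by (metis cinner_add_left cinner_commute complex_cnj_add)

lemma cinner_zero_left [simp]: "cinner 0 (x::'a::complex_inner) = 0"
  using cinner_add_left[of 0 0 x] by simp

lemma cinner_zero_right [simp]: "cinner (x::'a::complex_inner) 0 = 0"
  using cinner_add_right[of x 0 0] by simp

lemma cinner_diff_left: "cinner (x - y) z = cinner x z - cinner y (z::'a::complex_inner)"
  using cinner_add_left[of "x - y" y z] by simp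

lemma cinner_sum_left: "cinner (sum f S) y = (\<Sum>x\<in>S. cinner (f x :: 'a::complex_inner) y)"
  by (induction S rule: infinite_finite_induct) (auto simp: cinner_add_left)

lemma cinner_sum_right: "cinner x (sum f S) = (\<Sum>y\<in>S. cinner x (f y :: 'a::complex_inner))"
  by (induction S rule: infinite_finite_induct) (auto simp: cinner_add_right)

lemma cinner_scaleR_right: "cinner x (r *\<^sub>R y) = r *\<^sub>R cinner x (y::'a::complex_inner)"
  by (simp add: scaleR_scaleC cinner_scaleC_right)

lemma cinner_scaleR_left: "cinner (r *\<^sub>R x) y = r *\<^sub>R cinner x (y::'a::complex_inner)"
  by (simp add: scaleR_scaleC cinner_scaleC_left)

lemma cmod_cinner_le: "cmod (cinner x y) \<le> norm x * norm (y::'a::complex_inner)"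
proof -
  \<comment> \<open>rotate the first vector so that the complex inner product becomes the real one\<close>
  define a where "a = cnj (sgn (cinner x y))"
  have a: "cmod a \<le> 1"
    by (simp add: a_def norm_sgn)
  have "complex_of_real (cmod (cinner x y)) = cinner (a *\<^sub>C x) y"
    by (simp add: a_def cinner_scaleC_left sgn_eq complex_norm_square[symmetric] power2_eq_square
        mult.commute[of "cnj _"])
  then have "cmod (cinner x y) = Re (cinner (a *\<^sub>C x) y)"
    by (metis Re_complex_of_real)
  also have "\<dots> = (a *\<^sub>C x) \<bullet> y"
    by (rule Re_cinner)
  also have "\<dots> \<le> norm (a *\<^sub>C x) * norm y"
    by (rule norm_cauchy_schwarz)
  also have "\<dots> \<le> norm x * norm y"
    using a by (simp add: norm_scaleC mult_left_le_one_le mult_right_mono)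
  finally show ?thesis .
qed

lemma bounded_bilinear_cinner: "bounded_bilinear (cinner :: 'a::complex_inner \<Rightarrow> _)"
proof
  show "\<exists>K. \<forall>a b. cmod (cinner a (b::'a)) \<le> norm a * norm b * K"
    by (rule exI[of _ 1]) (simp add: cmod_cinner_le)
qed (simp_all add: cinner_add_left cinner_add_right cinner_scaleR_left cinner_scaleR_right)

lemmas tendsto_cinner = bounded_bilinear.tendsto[OF bounded_bilinear_cinner]

lemma cinner_ext:
  fixes x y :: "'a::complex_inner"
  assumes "\<And>z. cinner x z = cinner y z"
  shows "x = y"
proof -
  have "cinner (x - y) (x - y) = 0"
    using assms by (simp add: cinner_diff_left)
  then show ?thesis
    by (simp add: cinner_self)
qed

lemma inner_scaleC: "(a *\<^sub>C x) \<bullet> y = x \<bullet> (cnj a *\<^sub>C (y::'a::complex_inner))"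
  by (simp add: Re_cinner[symmetric] cinner_scaleC_left cinner_scaleC_right)

lemma norm_eq_if_cinner_self_eq:
  fixes x :: "'a::complex_inner" and y :: "'b::complex_inner"
  assumes "cinner x x = cinner y y"
  shows "norm x = norm y"
proof -
  have "(norm x)\<^sup>2 = (norm y)\<^sup>2"
    using assms unfolding cinner_self by (simp only: of_real_eq_iff)
  then show ?thesis by simp
qed

lemma bounded_clinear_add: "bounded_clinear A \<Longrightarrow> A (x + y) = A x + A y"
  by (simp add: bounded_clinear_def linear_simps)

lemma bounded_clinear_scaleC: "bounded_clinear A \<Longrightarrow> A (c *\<^sub>C x) = c *\<^sub>C A x"
  by (simp add: bounded_clinear_def)

lemma bounded_clinear_bounded_linear: "bounded_clinear A \<Longrightarrow> bounded_linear A"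
  by (simp add: bounded_clinear_def)

lemma bounded_clinear_zero: "bounded_clinear A \<Longrightarrow> A 0 = 0"
  by (simp add: bounded_clinear_def linear_simps)

lemma bounded_clinear_sum:
  "bounded_clinear A \<Longrightarrow> A (sum f S) = (\<Sum>x\<in>S. A (f x))"
  by (simp add: bounded_clinear_def linear_sum bounded_linear.linear)

lemma bounded_clinear_norm_le:
  assumes "bounded_clinear A"
  obtains C where "C > 0" "\<And>x. norm (A x) \<le> C * norm x"
  using bounded_linear.pos_bounded[of A] assms by (auto simp: bounded_clinear_def mult.commute)

lemma bounded_clinearI:
  assumes "\<And>x y. A (x + y) = A x + A y" "\<And>c x. A (c *\<^sub>C x) = c *\<^sub>C A x"
    "\<And>x. norm (A x) \<le> C * norm x"
  shows "bounded_clinear A"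
  unfolding bounded_clinear_def
  using assms by (auto intro!: bounded_linear_intro[of _ C] simp: scaleR_scaleC mult.commute)

lemma bounded_clinear_compose:
  "bounded_clinear A \<Longrightarrow> bounded_clinear B \<Longrightarrow> bounded_clinear (\<lambda>x. A (B x))"
  by (auto simp: bounded_clinear_def intro: bounded_linear_compose)

lemma bounded_clinear_minus:
  "bounded_clinear A \<Longrightarrow> bounded_clinear B \<Longrightarrow> bounded_clinear (\<lambda>x. A x - B x)"
  by (auto simp: bounded_clinear_def scaleC_diff_right intro: bounded_linear_sub)

lemma bounded_clinear_plus:
  "bounded_clinear A \<Longrightarrow> bounded_clinear B \<Longrightarrow> bounded_clinear (\<lambda>x. A x + B x)"
  by (auto simp: bounded_clinear_def scaleC_add_right intro: bounded_linear_add)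

section \<open>Fourier series determine a function on the circle\<close>

lemma sphere_nonzero: "z \<in> sphere 0 (1::real) \<Longrightarrow> (z::complex) \<noteq> 0"
  by auto

lemma cnj_on_circle: "z \<in> sphere 0 1 \<Longrightarrow> cnj z = inverse z"
  by (metis complex_norm_square inverse_unique mem_sphere_0 of_real_1 power_one)

lemma cnj_powi_on_circle: "z \<in> sphere 0 1 \<Longrightarrow> cnj (z powi n) = z powi (- n)"
  by (simp add: cnj_on_circle power_int_minus power_int_inverse)

lemma integral_circle_powi: "(LINT z|circle. z powi n) = (if n = 0 then 1 else 0)"
proof (cases "n = 0")
  case True
  have "measure circle (space circle) = 1"
    using prob_space_circle by (simp add: measure_def)
  then show ?thesis using True by simp
next
  case False
  let ?F = "\<lambda>t. cis (of_int n * t) / (\<i> * of_int n)"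
  have "(LINT z|circle. z powi n) = (1 / (2*pi)) *\<^sub>R (LINT t:{0..2*pi}|lborel. cis t powi n)"
    by (rule integral_circle) measurable
  also have "(LINT t:{0..2*pi}|lborel. cis t powi n) =
      (LINT t|lborel. indicator {0..2*pi} t *\<^sub>R cis (of_int n * t))"
    by (simp add: set_lebesgue_integral_def cis_power_int)
  also have "\<dots> = ?F (2*pi) - ?F 0"
  proof (rule integral_FTC_Icc)
    show "(?F has_vector_derivative cis (of_int n * x)) (at x within {0..2*pi})" for x
    proof -
      have "((\<lambda>w. exp (\<i> * of_int n * w) / (\<i> * of_int n)) has_field_derivative
          exp (\<i> * of_int n * of_real x)) (at (of_real x))"
        using False by (auto intro!: derivative_eq_intros)
      from has_vector_derivative_real_field[OF this, of "{0..2*pi}"] show ?thesis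
        by (simp add: cis_conv_exp mult.assoc)
    qed
    show "continuous_on {0..2*pi} (\<lambda>x. cis (of_int n * x))"
      by (intro continuous_intros)
  qed simp
  also have "\<dots> = 0"
    using cis_multiple_2pi[of n] by (simp add: mult_ac)
  finally show ?thesis using False by simp
qed

definition spectrally_null :: "(complex \<Rightarrow> 'e::separable_hilbert_space) \<Rightarrow> bool" where
  "spectrally_null f \<longleftrightarrow> integrable circle f \<and> (\<forall>n. (LINT z|circle. (z powi n) *\<^sub>C f z) = 0)"

lemma integrable_bounded_scaleC:
  fixes f :: "complex \<Rightarrow> 'e::separable_hilbert_space"
  assumes f: "integrable circle f" and [measurable]: "g \<in> borel_measurable circle"
    and "\<And>z. z \<in> sphere 0 1 \<Longrightarrow> cmod (g z) \<le> C"
  shows "integrable circle (\<lambda>z. g z *\<^sub>C f z)"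
proof (rule Bochner_Integration.integrable_bound)
  note [measurable] = borel_measurable_integrable[OF f]
  show "integrable circle (\<lambda>z. C *\<^sub>R f z)"
    using f by simp
  show "(\<lambda>z. g z *\<^sub>C f z) \<in> borel_measurable circle"
    by measurable
  show "AE z in circle. norm (g z *\<^sub>C f z) \<le> norm (C *\<^sub>R f z)"
    using assms(3) by (intro AE_I2) (fastforce simp: norm_scaleC intro!: mult_right_mono)
qed

lemma integral_scaleC:
  fixes f :: "complex \<Rightarrow> 'e::separable_hilbert_space"
  assumes "integrable M f"
  shows "(LINT z|M. c *\<^sub>C f z) = c *\<^sub>C (LINT z|M. f z)"
  by (rule integral_bounded_linear[OF bounded_linear_scaleC_right assms])

lemma spectrally_null_add:
  assumes f: "spectrally_null f" and g: "spectrally_null g"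
  shows "spectrally_null (\<lambda>z. f z + g z)"
proof -
  have "integrable circle (\<lambda>z. (z powi n) *\<^sub>C f z)" "integrable circle (\<lambda>z. (z powi n) *\<^sub>C g z)" for n
    using f g by (auto intro!: integrable_bounded_scaleC[where C = 1]
        simp: spectrally_null_def norm_power_int)
  then show ?thesis
    using f g by (simp add: spectrally_null_def scaleC_add_right)
qed

lemma spectrally_null_powi:
  assumes f: "spectrally_null f"
  shows "spectrally_null (\<lambda>z. (c * z powi m) *\<^sub>C f z)"
  unfolding spectrally_null_def
proof (intro conjI allI)
  have int: "integrable circle (\<lambda>z. (z powi n) *\<^sub>C f z)" for n
    using f by (auto intro!: integrable_bounded_scaleC[where C = 1]
        simp: spectrally_null_def norm_power_int)
  show "integrable circle (\<lambda>z. (c * z powi m) *\<^sub>C f z)"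
    using f by (auto intro!: integrable_bounded_scaleC[where C = "cmod c"]
        simp: spectrally_null_def norm_power_int norm_mult)
  fix n
  have "(LINT z|circle. (z powi n) *\<^sub>C (c * z powi m) *\<^sub>C f z) =
      (LINT z|circle. c *\<^sub>C (z powi (n + m)) *\<^sub>C f z)"
    by (rule Bochner_Integration.integral_cong)
      (use sphere_nonzero in \<open>auto simp: scaleC_scaleC power_int_add mult_ac\<close>)
  also have "\<dots> = 0"
    using f by (subst integral_scaleC[OF int]) (simp add: spectrally_null_def)
  finally show "(LINT z|circle. (z powi n) *\<^sub>C (c * z powi m) *\<^sub>C f z) = 0" .
qed

lemma spectrally_null_cong:
  assumes "\<And>z. z \<in> sphere 0 1 \<Longrightarrow> f z = g z"
  shows "spectrally_null f \<longleftrightarrow> spectrally_null g"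
proof -
  have "integrable circle f \<longleftrightarrow> integrable circle g"
    by (rule Bochner_Integration.integrable_cong) (use assms in auto)
  moreover have "(LINT z|circle. (z powi n) *\<^sub>C f z) = (LINT z|circle. (z powi n) *\<^sub>C g z)" for n
    by (rule Bochner_Integration.integral_cong) (use assms in auto)
  ultimately show ?thesis by (simp add: spectrally_null_def)
qed

text \<open>Multiplication by a polynomial in the real and imaginary part of z shifts and combines Fourier
  coefficients, since these parts are combinations of z and its inverse on the circle. Stating this
  for multiplication operators makes products of polynomials the composition of such operators.\<close>

lemma spectrally_null_real_polynomial:
  assumes "real_polynomial_function p" "spectrally_null f"
  shows "spectrally_null (\<lambda>z. p z *\<^sub>R f z)"
  using assms
proof (induction p arbitrary: f rule: real_polynomial_function.induct)
  case (linear p)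
  let ?c = "complex_of_real (p 1) / 2" and ?d = "- \<i> * complex_of_real (p \<i>) / 2"
  have "p z *\<^sub>R f z = (((?c + ?d) * z powi 1) *\<^sub>C f z + ((?c - ?d) * z powi (-1)) *\<^sub>C f z)"
    if z: "z \<in> sphere 0 1" for z
  proof -
    have "p (Re z *\<^sub>R 1 + Im z *\<^sub>R \<i>) = Re z * p 1 + Im z * p \<i>"
      by (simp only: linear_simps[OF linear(1)] real_scaleR_def)
    moreover have "Re z *\<^sub>R 1 + Im z *\<^sub>R \<i> = z"
      by (simp add: complex_eq_iff)
    ultimately have pz: "p z = Re z * p 1 + Im z * p \<i>"
      by simp
    have inv: "z powi (- 1) = cnj z"
      using z by (simp add: cnj_on_circle power_int_minus)
    have "complex_of_real (p z) = (?c + ?d) * z + (?c - ?d) * cnj z"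
      by (simp add: pz complex_eq_iff algebra_simps)
    then have "complex_of_real (p z) = (?c + ?d) * z powi 1 + (?c - ?d) * z powi (-1)"
      by (simp only: inv power_int_1_right)
    then show ?thesis
      by (simp add: scaleR_scaleC scaleC_add_left)
  qed
  then show ?case
    using spectrally_null_add[OF spectrally_null_powi spectrally_null_powi, OF linear(2) linear(2),
      of "?c + ?d" 1 "?c - ?d" "-1"]
    by (metis (no_types, lifting) spectrally_null_cong)
next
  case (const c)
  have "(c *\<^sub>R f z) = ((complex_of_real c * z powi 0) *\<^sub>C f z)" for z
    by (simp add: scaleR_scaleC)
  then show ?case
    using spectrally_null_powi[OF const, of c 0] by presburger
next
  case (add p q)
  then show ?case
    using spectrally_null_add[of "\<lambda>z. p z *\<^sub>R f z" "\<lambda>z. q z *\<^sub>R f z"] by (simp add: scaleR_add_left)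
next
  case (mult p q)
  then show ?case
    using mult(3)[of "\<lambda>z. q z *\<^sub>R f z"] by simp
qed

lemma spectrally_null_continuous:
  fixes g :: "complex \<Rightarrow> real"
  assumes f: "spectrally_null f" and g: "continuous_on UNIV g"
  shows "(LINT z|circle. g z *\<^sub>R f z) = 0"
proof -
  have int: "integrable circle f"
    using f by (simp add: spectrally_null_def)
  have bound: "norm (LINT z|circle. g z *\<^sub>R f z) \<le> e * (LINT z|circle. norm (f z))"
    if e: "e > 0" for e
  proof -
    obtain p where p: "real_polynomial_function p" "\<And>z. z \<in> sphere 0 1 \<Longrightarrow> \<bar>g z - p z\<bar> < e"
      using Stone_Weierstrass_real_polynomial_function[of "sphere 0 (1::real)" g e] g e
      by (metis compact_sphere continuous_on_subset subset_UNIV)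
    have null: "spectrally_null (\<lambda>z. p z *\<^sub>R f z)"
      by (rule spectrally_null_real_polynomial[OF p(1) f])
    then have ip: "integrable circle (\<lambda>z. p z *\<^sub>R f z)" "(LINT z|circle. p z *\<^sub>R f z) = 0"
      by (auto simp: spectrally_null_def dest: spec[of _ 0])
    have [measurable]: "g \<in> borel_measurable circle" "p \<in> borel_measurable circle"
      "f \<in> borel_measurable circle"
      using g int continuous_on_polymonial_function[of p] p(1)
      by (auto intro!: borel_circle_measurable borel_measurable_continuous_onI
        simp: continuous_on_polymonial_function real_polynomial_function_eq)
    have id: "integrable circle (\<lambda>z. (g z - p z) *\<^sub>R f z)"
    proof (rule Bochner_Integration.integrable_bound)
      show "integrable circle (\<lambda>z. e *\<^sub>R f z)" using int by simp
      show "AE z in circle. norm ((g z - p z) *\<^sub>R f z) \<le> norm (e *\<^sub>R f z)"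
        using p(2) e by (intro AE_I2) (fastforce intro!: mult_right_mono)
    qed measurable
    have "(LINT z|circle. g z *\<^sub>R f z) = (LINT z|circle. (g z - p z) *\<^sub>R f z + p z *\<^sub>R f z)"
      by (simp add: algebra_simps)
    also have "\<dots> = (LINT z|circle. (g z - p z) *\<^sub>R f z)"
      using id ip by (subst Bochner_Integration.integral_add) auto
    also have "norm \<dots> \<le> (LINT z|circle. norm ((g z - p z) *\<^sub>R f z))"
      by (rule integral_norm_bound)
    also have "\<dots> \<le> (LINT z|circle. e * norm (f z))"
      using id int p(2) by (intro integral_mono) (fastforce intro!: mult_right_mono)+
    finally show ?thesis by simp
  qed
  have "norm (LINT z|circle. g z *\<^sub>R f z) \<le> 0"
  proof (rule tendsto_lowerbound)
    show "((\<lambda>e. e * (LINT z|circle. norm (f z))) \<longlongrightarrow> 0) (at_right 0)"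
      by (auto intro!: tendsto_eq_intros)
    show "\<forall>\<^sub>F e in at_right 0. norm (LINT z|circle. g z *\<^sub>R f z) \<le> e * (LINT z|circle. norm (f z))"
      using bound by (auto intro: eventually_at_right_less[of 0, THEN eventually_mono])
  qed simp
  then show ?thesis by simp
qed

text \<open>The continuous functions 1 - n * dist, cut off at 0, decrease to the indicator of a closed set.\<close>

lemma spectrally_null_closed:
  assumes f: "spectrally_null f" and C: "closed C"
  shows "(LINT z|circle. indicator C z *\<^sub>R f z) = 0"
proof (cases "C = {}")
  case False
  let ?g = "\<lambda>n z. max 0 (1 - of_nat n * infdist z C) :: real"
  have int: "integrable circle f"
    using f by (simp add: spectrally_null_def)
  note [measurable] = borel_measurable_integrable[OF int]
  have g: "continuous_on UNIV (?g n)" for n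
    by (intro continuous_intros)
  note [measurable] = borel_circle_measurable[OF borel_measurable_continuous_onI[OF g]]
  have [measurable]: "indicator C \<in> borel_measurable circle"
    using C by (intro borel_circle_measurable) simp
  have lim: "(\<lambda>n. ?g n z) \<longlonglongrightarrow> indicator C z" for z
  proof (cases "z \<in> C")
    case True
    then show ?thesis by simp
  next
    case z: False
    then have pos: "infdist z C > 0"
      using infdist_pos_not_in_closed[OF C False] by blast
    then obtain N where N: "of_nat N * infdist z C > 1"
      using reals_Archimedean3 by blast
    have "\<forall>\<^sub>F n in sequentially. ?g n z = 0"
    proof (rule eventually_sequentiallyI[of N])
      fix n assume "N \<le> n"
      then have "of_nat N * infdist z C \<le> of_nat n * infdist z C"
        by (intro mult_right_mono infdist_nonneg) simp
      then show "?g n z = 0" using N by simp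
    qed
    then show ?thesis
      using z by (simp add: tendsto_eventually)
  qed
  have "(\<lambda>n. LINT z|circle. ?g n z *\<^sub>R f z) \<longlonglongrightarrow> (LINT z|circle. indicator C z *\<^sub>R f z)"
  proof (rule integral_dominated_convergence)
    show "integrable circle (\<lambda>z. norm (f z))"
      using int by simp
    show "AE z in circle. (\<lambda>n. ?g n z *\<^sub>R f z) \<longlonglongrightarrow> indicator C z *\<^sub>R f z"
      by (intro AE_I2 tendsto_intros lim)
    show "AE z in circle. norm (?g n z *\<^sub>R f z) \<le> norm (f z)" for n
      by (intro AE_I2) (auto intro!: mult_left_le_one_le simp: infdist_nonneg)
  qed measurable
  then show ?thesis
    by (simp add: spectrally_null_continuous[OF f g] LIMSEQ_const_iff)
qed simp

lemma spectrally_null_borel: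
  assumes f: "spectrally_null f" and B: "B \<in> sets borel"
  shows "(LINT z|circle. indicator B z *\<^sub>R f z) = 0"
proof -
  have int: "integrable circle f"
    using f by (simp add: spectrally_null_def)
  note [measurable] = borel_measurable_integrable[OF int]
  have ind [measurable]: "indicator A \<in> borel_measurable circle" if "A \<in> sets borel" for A :: "complex set"
    using that by (intro borel_circle_measurable) simp
  have int_ind: "integrable circle (\<lambda>z. indicator A z *\<^sub>R f z)" if [measurable]: "A \<in> sets borel" for A
    by (rule Bochner_Integration.integrable_bound[OF int]) (measurable, auto simp: indicator_def)
  have stable: "Int_stable (Collect closed :: complex set set)"
    by (auto simp: Int_stable_def)
  have "B \<in> sigma_sets UNIV (Collect closed)"
    using B by (simp add: borel_eq_closed)
  with stable have "Int_stable (Collect closed :: complex set set)"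
    "Collect closed \<subseteq> Pow (UNIV :: complex set)" "B \<in> sigma_sets UNIV (Collect closed)"
    by auto
  then show ?thesis
  proof (induction rule: sigma_sets_induct_disjoint)
    case (basic A)
    then show ?case using spectrally_null_closed[OF f] by simp
  next
    case empty
    then show ?case by simp
  next
    case (compl A)
    then have A: "A \<in> sets borel" by (simp add: borel_eq_closed)
    have "(LINT z|circle. indicator (UNIV - A) z *\<^sub>R f z) =
        (LINT z|circle. indicator UNIV z *\<^sub>R f z - indicator A z *\<^sub>R f z)"
      by (rule Bochner_Integration.integral_cong) (auto simp: indicator_def)
    also have "\<dots> = 0"
      using spectrally_null_closed[OF f, of UNIV] int compl int_ind[OF A]
      by (subst Bochner_Integration.integral_diff) auto
    finally show ?case .
  next
    case (union A)
    have Ai: "A i \<in> sets borel" for i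
      using union(2)[of] by (auto simp: borel_eq_closed)
    have [measurable]: "(\<Union>i. A i) \<in> sets borel" using Ai by auto
    let ?s = "\<lambda>n z. indicator (\<Union>i<n. A i) z *\<^sub>R f z"
    have "(\<lambda>n. LINT z|circle. ?s n z) \<longlonglongrightarrow> (LINT z|circle. indicator (\<Union>i. A i) z *\<^sub>R f z)"
    proof (rule integral_dominated_convergence)
      show "integrable circle (\<lambda>z. norm (f z))" using int by simp
      have "(\<lambda>n. indicator (\<Union>i<n. A i) z :: real) \<longlonglongrightarrow> indicator (\<Union>i. A i) z" for z
        by (rule LIMSEQ_indicator_UN)
      then show "AE z in circle. (\<lambda>n. ?s n z) \<longlonglongrightarrow> indicator (\<Union>i. A i) z *\<^sub>R f z"
        by (intro AE_I2 tendsto_intros)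
      show "AE z in circle. norm (?s n z) \<le> norm (f z)" for n
        by (auto simp: indicator_def)
      show "?s n \<in> borel_measurable circle" for n
        by (intro borel_measurable_scaleR ind) (use Ai in auto)
    qed measurable
    moreover have "(LINT z|circle. ?s n z) = 0" for n
    proof (induction n)
      case (Suc n)
      have "(LINT z|circle. ?s (Suc n) z) = (LINT z|circle. ?s n z + indicator (A n) z *\<^sub>R f z)"
      proof (rule Bochner_Integration.integral_cong)
        fix z
        have "z \<in> A n \<Longrightarrow> i < n \<Longrightarrow> z \<notin> A i" for i
          using disjoint_family_onD[OF union(1), of i n] by auto
        then show "?s (Suc n) z = ?s n z + indicator (A n) z *\<^sub>R f z"
          by (auto simp: indicator_def lessThan_Suc)
      qed simp
      also have "\<dots> = 0"
        using Suc union(3) int_ind Ai by (subst Bochner_Integration.integral_add) auto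
      finally show ?case .
    qed simp
    ultimately show ?case by (simp add: LIMSEQ_const_iff)
  qed
qed

theorem spectrally_null_AE_zero:
  assumes f: "spectrally_null f"
  shows "AE z in circle. f z = 0"
proof -
  interpret finite_measure circle by (rule finite_measure_circle)
  show ?thesis
  proof (rule density_zero)
    show "integrable circle f" using f by (simp add: spectrally_null_def)
    fix A assume "A \<in> sets circle"
    then obtain B where B: "B \<in> sets borel" "A = sphere 0 1 \<inter> B"
      by (auto simp: sets_circle sets_restrict_space)
    have "set_lebesgue_integral circle A f = (LINT z|circle. indicator B z *\<^sub>R f z)"
      unfolding set_lebesgue_integral_def B(2)
      by (rule Bochner_Integration.integral_cong) (auto simp: indicator_def)
    then show "set_lebesgue_integral circle A f = 0"
      using spectrally_null_borel[OF f B(1)] by simp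
  qed
qed

section \<open>Completeness of the space of square-integrable functions\<close>

lemma square_integrable_rep_L2: "square_integrable (rep_L2 F)"
  using Quotient3_rep_reflp[OF Quotient3_L2, of F] by (simp add: L2_rel_def)

lemma L2_rel_refl: "square_integrable f \<Longrightarrow> L2_rel f f"
  by (simp add: L2_rel_def)

lemma abs_rep_L2 [simp]: "abs_L2 (rep_L2 F) = F"
  by (rule Quotient3_abs_rep[OF Quotient3_L2])

lemma abs_L2_eqI:
  "square_integrable f \<Longrightarrow> square_integrable g \<Longrightarrow> (AE z in circle. f z = g z) \<Longrightarrow> abs_L2 f = abs_L2 g"
  by (rule Quotient3_rel_abs[OF Quotient3_L2]) (simp add: L2_rel_def)

lemma abs_L2_cong:
  assumes f: "square_integrable f" and eq: "\<And>z. z \<in> sphere 0 1 \<Longrightarrow> f z = g z"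
  shows "abs_L2 f = abs_L2 g"
proof (rule abs_L2_eqI[OF f])
  have "f \<in> borel_measurable circle \<longleftrightarrow> g \<in> borel_measurable circle"
    by (rule measurable_cong) (use eq in auto)
  moreover have "integrable circle (\<lambda>z. (norm (f z))\<^sup>2) \<longleftrightarrow> integrable circle (\<lambda>z. (norm (g z))\<^sup>2)"
    by (rule Bochner_Integration.integrable_cong) (use eq in auto)
  ultimately show "square_integrable g"
    using f by (simp add: square_integrable_def)
  show "AE z in circle. f z = g z"
    using eq by (intro AE_I2) auto
qed

lemma abs_L2_add:
  "square_integrable f \<Longrightarrow> square_integrable g \<Longrightarrow> abs_L2 f + abs_L2 g = abs_L2 (\<lambda>z. f z + g z)"
  by (simp add: plus_L2.abs_eq L2_rel_refl)

lemma abs_L2_scaleC: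
  "square_integrable f \<Longrightarrow> a *\<^sub>C abs_L2 f = abs_L2 (\<lambda>z. a *\<^sub>C f z)"
  by (simp add: scaleC_L2.abs_eq L2_rel_refl)

lemma square_integrable_diff:
  assumes "square_integrable f" "square_integrable g"
  shows "square_integrable (\<lambda>z. f z - g z)"
  using square_integrable_add[OF assms(1) square_integrable_scaleC[OF assms(2), of "- 1"]]
  by (simp add: scaleC_minus1)

lemma abs_L2_diff:
  assumes "square_integrable f" "square_integrable g"
  shows "abs_L2 f - abs_L2 g = abs_L2 (\<lambda>z. f z - g z)"
  using abs_L2_add[OF square_integrable_diff[OF assms] assms(2)] by (simp add: diff_eq_eq)

lemma abs_L2_sum:
  assumes "\<And>i. i \<in> S \<Longrightarrow> square_integrable (f i)"
  shows "(\<Sum>i\<in>S. abs_L2 (f i)) = abs_L2 (\<lambda>z. \<Sum>i\<in>S. f i z) \<and> square_integrable (\<lambda>z. \<Sum>i\<in>S. f i z)"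
  using assms
  by (induction S rule: infinite_finite_induct)
    (auto simp: abs_L2_add square_integrable_add square_integrable_zero zero_L2_def)

lemma cinner_abs_L2:
  "square_integrable f \<Longrightarrow> square_integrable g \<Longrightarrow>
    cinner (abs_L2 f) (abs_L2 g) = (LINT z|circle. cinner (f z) (g z))"
  by (simp add: cinner_L2.abs_eq L2_rel_refl)

lemma fourier_coeff_abs_L2:
  "square_integrable f \<Longrightarrow> fourier_coeff (abs_L2 f) n = (LINT z|circle. (z powi (- n)) *\<^sub>C f z)"
  by (simp add: fourier_coeff.abs_eq L2_rel_refl)

lemma norm_abs_L2:
  assumes "square_integrable f"
  shows "(norm (abs_L2 f))\<^sup>2 = (LINT z|circle. (norm (f z))\<^sup>2)"
proof -
  have "complex_of_real ((norm (abs_L2 f))\<^sup>2) = complex_of_real (LINT z|circle. (norm (f z))\<^sup>2)"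
    unfolding cinner_self[symmetric] cinner_abs_L2[OF assms assms]
    by (simp add: cinner_self del: of_real_power)
  then show ?thesis by (simp only: of_real_eq_iff)
qed

lemma norm_abs_L2_le:
  assumes f: "square_integrable f" and g: "square_integrable g" and "C \<ge> 0"
    and le: "AE z in circle. norm (f z) \<le> C * norm (g z)"
  shows "norm (abs_L2 f) \<le> C * norm (abs_L2 g)"
proof -
  have "(LINT z|circle. (norm (f z))\<^sup>2) \<le> (LINT z|circle. C\<^sup>2 * (norm (g z))\<^sup>2)"
  proof (rule integral_mono_AE)
    show "AE z in circle. (norm (f z))\<^sup>2 \<le> C\<^sup>2 * (norm (g z))\<^sup>2"
      using le by eventually_elim (metis norm_ge_zero power_mono power_mult_distrib)
  qed (use f g in \<open>auto simp: square_integrable_def\<close>)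
  then have "(norm (abs_L2 f))\<^sup>2 \<le> (C * norm (abs_L2 g))\<^sup>2"
    by (simp add: norm_abs_L2 f g power_mult_distrib)
  then show ?thesis
    by (rule power2_le_imp_le) (use \<open>C \<ge> 0\<close> in auto)
qed

lemma measure_circle [simp]: "measure circle (sphere 0 1) = 1"
  using prob_space_circle by (simp add: measure_def)

lemma square_integrable_const [simp]: "square_integrable (\<lambda>_. x)"
proof -
  interpret finite_measure circle by (rule finite_measure_circle)
  show ?thesis by (simp add: square_integrable_def)
qed

text \<open>On a probability space the norm in L1 is dominated by the norm in L2, by the Cauchy-Schwarz
  inequality against the constant 1.\<close>

lemma integral_norm_le_norm_L2:
  fixes f :: "complex \<Rightarrow> 'e::separable_hilbert_space"
  assumes f: "square_integrable f"
  shows "(LINT z|circle. norm (f z)) \<le> norm (abs_L2 f)"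
proof -
  let ?n = "\<lambda>z. complex_of_real (norm (f z))"
  have n: "square_integrable ?n"
    using f by (auto simp: square_integrable_def)
  have "(norm (abs_L2 ?n))\<^sup>2 = (norm (abs_L2 f))\<^sup>2"
    by (simp add: norm_abs_L2 n f)
  then have eq: "norm (abs_L2 ?n) = norm (abs_L2 f)"
    by simp
  have "(norm (abs_L2 (\<lambda>_. 1::complex)))\<^sup>2 = 1"
    by (simp add: norm_abs_L2)
  then have one: "norm (abs_L2 (\<lambda>_. 1::complex)) = 1"
    by (simp add: power2_eq_1_iff) (smt (verit) norm_ge_zero)
  have "(LINT z|circle. norm (f z)) = Re (cinner (abs_L2 ?n) (abs_L2 (\<lambda>_. 1)))"
    by (simp add: cinner_abs_L2 n)
  also have "\<dots> \<le> norm (abs_L2 ?n) * norm (abs_L2 (\<lambda>_. 1::complex))"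
    using cmod_cinner_le complex_Re_le_cmod order_trans by blast
  finally show ?thesis by (simp add: eq one)
qed

text \<open>If consecutive distances in L2 are summable, then so are, by the preceding lemma, the integrals
  of the consecutive differences; hence these differences sum absolutely almost everywhere.\<close>

lemma AE_convergent_of_summable_steps:
  fixes f :: "nat \<Rightarrow> complex \<Rightarrow> 'e::separable_hilbert_space"
  assumes f: "\<And>k. square_integrable (f k)"
    and b: "\<And>k. k \<ge> K \<Longrightarrow> norm (abs_L2 (f (Suc k)) - abs_L2 (f k)) \<le> b k" "summable b"
  shows "AE z in circle. convergent (\<lambda>k. f k z)"
proof -
  define g where "g k z = f (Suc (k + K)) z - f (k + K) z" for k z
  have g: "square_integrable (g k)" for k
    unfolding g_def by (intro square_integrable_diff f)
  note [measurable] = square_integrable_measurable[OF g]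
  have le: "(LINT z|circle. norm (g k z)) \<le> b (k + K)" for k
    using integral_norm_le_norm_L2[OF g[of k]] b(1)[of "k + K"]
    unfolding g_def by (simp add: abs_L2_diff f)
  have sb: "summable (\<lambda>k. b (k + K))"
    using b(2) by (rule summable_ignore_initial_segment)
  have b0: "b (k + K) \<ge> 0" for k
    using b(1)[of "k + K"] norm_ge_zero order_trans by (meson le_add2)
  have "(\<integral>\<^sup>+z. (\<Sum>k. ennreal (norm (g k z))) \<partial>circle) = (\<Sum>k. \<integral>\<^sup>+z. ennreal (norm (g k z)) \<partial>circle)"
    by (rule nn_integral_suminf) measurable
  also have "\<dots> = (\<Sum>k. ennreal (LINT z|circle. norm (g k z)))"
    using integrable_square_integrable[OF g] by (subst nn_integral_eq_integral) auto
  also have "\<dots> \<le> (\<Sum>k. ennreal (b (k + K)))"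
    by (intro suminf_le ennreal_leI le) auto
  also have "\<dots> = ennreal (\<Sum>k. b (k + K))"
    by (rule suminf_ennreal2[OF b0 sb])
  finally have fin: "(\<integral>\<^sup>+z. (\<Sum>k. ennreal (norm (g k z))) \<partial>circle) \<noteq> \<infinity>"
    by (auto simp: top_unique)
  have "AE z in circle. (\<Sum>k. ennreal (norm (g k z))) \<noteq> \<infinity>"
    by (rule nn_integral_noteq_infinite[OF _ fin]) measurable
  then show ?thesis
  proof eventually_elim
    case (elim z)
    then have "summable (\<lambda>k. norm (g k z))"
      by (intro summable_suminf_not_top) auto
    then have "summable (\<lambda>k. g k z)"
      by (rule summable_norm_cancel)
    then have "convergent (\<lambda>n. \<Sum>k<n. g k z)"
      by (simp add: summable_iff_convergent)
    then have "convergent (\<lambda>n. (\<Sum>k<n. g k z) + f K z)"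
      by (intro convergent_add convergent_const)
    moreover have "(\<Sum>k<n. g k z) + f K z = f (n + K) z" for n
    proof (induction n)
      case (Suc n)
      have "(\<Sum>k<Suc n. g k z) + f K z = ((\<Sum>k<n. g k z) + f K z) + g n z"
        by simp
      also have "\<dots> = f (Suc n + K) z"
        unfolding Suc.IH by (simp add: g_def)
      finally show ?case .
    qed simp
    ultimately show ?case
      using convergent_ignore_initial_segment[of "\<lambda>k. f k z" K] by simp
  qed
qed

lemma fast_subsequence:
  fixes P :: "nat \<Rightarrow> nat \<Rightarrow> nat \<Rightarrow> bool"
  assumes "\<And>k. \<exists>N. \<forall>m\<ge>N. \<forall>n\<ge>N. P k m n"
  obtains r where "strict_mono r" "\<And>k. P k (r (Suc k)) (r k)"
proof -
  obtain N where N: "\<And>k m n. m \<ge> N k \<Longrightarrow> n \<ge> N k \<Longrightarrow> P k m n"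
    using assms by metis
  define r where "r k = (\<Sum>i\<le>k. N i) + k" for k
  have mono: "r k < r (Suc k)" for k by (simp add: r_def)
  have ge: "r k \<ge> N k" for k
    by (cases k) (auto simp: r_def)
  show ?thesis
  proof
    show "strict_mono r" using mono by (simp add: strict_mono_Suc_iff)
    show "P k (r (Suc k)) (r k)" for k
      using N[of k "r (Suc k)" "r k"] ge[of k] mono[of k] by simp
  qed
qed

text \<open>The Riesz-Fischer theorem: a subsequence with geometrically decreasing steps converges almost
  everywhere, and Fatou's lemma bounds the distance of its terms to the pointwise limit.\<close>

lemma Cauchy_L2_convergent:
  fixes X :: "nat \<Rightarrow> 'e::separable_hilbert_space L2"
  assumes X: "Cauchy X"
  shows "convergent X"
proof -
  obtain r where r: "strict_mono r" "\<And>k. dist (X (r (Suc k))) (X (r k)) \<le> (1/2) ^ k"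
  proof -
    have "\<exists>N. \<forall>m\<ge>N. \<forall>n\<ge>N. dist (X m) (X n) \<le> (1/2) ^ k" for k :: nat
      using metric_CauchyD[OF X, of "(1/2) ^ k"] zero_less_power[of "1/2::real" k] by (auto intro: less_imp_le)
    then show ?thesis
      by (rule fast_subsequence[where P = "\<lambda>k m n. dist (X m) (X n) \<le> (1/2) ^ k"]) (rule that)
  qed
  define f where "f k = rep_L2 (X (r k))" for k
  have f: "square_integrable (f k)" and absf: "abs_L2 (f k) = X (r k)" for k
    by (simp_all add: f_def square_integrable_rep_L2)
  note [measurable] = square_integrable_measurable[OF f]
  have conv: "AE z in circle. convergent (\<lambda>k. f k z)"
    by (rule AE_convergent_of_summable_steps[OF f, where K = 0 and b = "\<lambda>k. (1/2) ^ k"])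
      (use r(2) in \<open>auto simp: absf dist_norm\<close>)
  define h where "h z = lim (\<lambda>k. f k z)" for z
  have [measurable]: "h \<in> borel_measurable circle"
    unfolding h_def by measurable
  have close: "square_integrable (\<lambda>z. h z - f k z) \<and> norm (abs_L2 (\<lambda>z. h z - f k z)) \<le> e"
    if "e \<ge> 0" and e: "\<And>l. l \<ge> k \<Longrightarrow> dist (X (r l)) (X (r k)) \<le> e" for k e
  proof -
    have diff: "square_integrable (\<lambda>z. f l z - f k z)" for l
      by (intro square_integrable_diff f)
    have "(\<integral>\<^sup>+z. ennreal ((norm (h z - f k z))\<^sup>2) \<partial>circle) =
        (\<integral>\<^sup>+z. liminf (\<lambda>l. ennreal ((norm (f l z - f k z))\<^sup>2)) \<partial>circle)"
    proof (rule nn_integral_cong_AE, use conv in eventually_elim)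
      case (elim z)
      then have "(\<lambda>l. f l z) \<longlonglongrightarrow> h z"
        by (simp add: h_def convergent_LIMSEQ_iff)
      then have "(\<lambda>l. ennreal ((norm (f l z - f k z))\<^sup>2)) \<longlonglongrightarrow> ennreal ((norm (h z - f k z))\<^sup>2)"
        by (intro tendsto_intros)
      then show ?case
        by (intro lim_imp_Liminf[symmetric]) auto
    qed
    also have "\<dots> \<le> liminf (\<lambda>l. \<integral>\<^sup>+z. ennreal ((norm (f l z - f k z))\<^sup>2) \<partial>circle)"
      by (rule nn_integral_liminf) measurable
    also have "\<dots> \<le> ennreal (e\<^sup>2)"
    proof (rule Liminf_le)
      show "\<forall>\<^sub>F l in sequentially. (\<integral>\<^sup>+z. ennreal ((norm (f l z - f k z))\<^sup>2) \<partial>circle) \<le> ennreal (e\<^sup>2)"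
      proof (rule eventually_sequentiallyI[of k])
        fix l assume "k \<le> l"
        then have "(norm (abs_L2 (\<lambda>z. f l z - f k z)))\<^sup>2 \<le> e\<^sup>2"
          using e[of l] by (simp add: abs_L2_diff[symmetric] f absf dist_norm power_mono)
        then show "(\<integral>\<^sup>+z. ennreal ((norm (f l z - f k z))\<^sup>2) \<partial>circle) \<le> ennreal (e\<^sup>2)"
          using diff[of l] unfolding norm_abs_L2[OF diff]
          by (subst nn_integral_eq_integral) (auto simp: square_integrable_def)
      qed
    qed simp
    finally have le: "(\<integral>\<^sup>+z. ennreal ((norm (h z - f k z))\<^sup>2) \<partial>circle) \<le> ennreal (e\<^sup>2)" .
    have "integrable circle (\<lambda>z. (norm (h z - f k z))\<^sup>2)"
    proof (rule integrableI_nonneg)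
      show "(\<integral>\<^sup>+z. ennreal ((norm (h z - f k z))\<^sup>2) \<partial>circle) < \<infinity>"
        using le by (rule order_le_less_trans) simp
    qed auto
    then have sq: "square_integrable (\<lambda>z. h z - f k z)"
      by (simp add: square_integrable_def)
    have "(norm (abs_L2 (\<lambda>z. h z - f k z)))\<^sup>2 \<le> e\<^sup>2"
      using le sq unfolding norm_abs_L2[OF sq]
      by (subst (asm) nn_integral_eq_integral) (auto simp: square_integrable_def)
    then have "norm (abs_L2 (\<lambda>z. h z - f k z)) \<le> e"
      using \<open>e \<ge> 0\<close> by (rule power2_le_imp_le)
    with sq show ?thesis by simp
  qed
  have "Cauchy (X \<circ> r)"
    using X r(1) by (rule Cauchy_subseq_Cauchy)
  then have cau: "\<exists>K. \<forall>k\<ge>K. \<forall>l\<ge>K. dist (X (r l)) (X (r k)) \<le> e" if "e > 0" for e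
    using metric_CauchyD[of "X \<circ> r" e] that by (auto intro!: less_imp_le)
  then obtain K where K: "\<And>l. l \<ge> K \<Longrightarrow> dist (X (r l)) (X (r K)) \<le> 1"
    using zero_less_one by blast
  then have "square_integrable (\<lambda>z. h z - f K z)"
    using close[of 1 K] by simp
  then have h: "square_integrable h"
    using square_integrable_add[OF _ f[of K]] by fastforce
  have "(X \<circ> r) \<longlonglongrightarrow> abs_L2 h"
  proof (rule metric_LIMSEQ_I)
    fix e :: real assume "0 < e"
    then obtain K where K: "\<And>k l. k \<ge> K \<Longrightarrow> l \<ge> K \<Longrightarrow> dist (X (r l)) (X (r k)) \<le> e/2"
      using cau[of "e/2"] by auto
    show "\<exists>N. \<forall>k\<ge>N. dist ((X \<circ> r) k) (abs_L2 h) < e"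
    proof (intro exI[of _ K] allI impI)
      fix k assume "k \<ge> K"
      then have "norm (abs_L2 (\<lambda>z. h z - f k z)) \<le> e/2"
        using close[of "e/2" k] K \<open>0 < e\<close> by simp
      then show "dist ((X \<circ> r) k) (abs_L2 h) < e"
        using \<open>0 < e\<close> by (simp add: abs_L2_diff[symmetric] h f absf dist_norm norm_minus_commute)
    qed
  qed
  with X r(1) have "X \<longlonglongrightarrow> abs_L2 h"
    by (rule Cauchy_converges_subseq)
  then show ?thesis by (rule convergentI)
qed

instance L2 :: (separable_hilbert_space) banach
  by standard (rule Cauchy_L2_convergent)

section \<open>Fourier coefficients and monomials\<close>

definition monomial :: "int \<Rightarrow> 'e \<Rightarrow> 'e::separable_hilbert_space L2" where
  "monomial n x = abs_L2 (\<lambda>z. (z powi n) *\<^sub>C x)"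

lemma square_integrable_monomial [simp]: "square_integrable (\<lambda>z. (z powi n) *\<^sub>C x)"
  by (rule square_integrable_powi) simp

lemma cinner_monomial: "cinner F (monomial n x) = cinner (fourier_coeff F n) x"
proof -
  define f where "f = rep_L2 F"
  have f: "square_integrable f" and F: "F = abs_L2 f"
    by (simp_all add: f_def square_integrable_rep_L2)
  have "cinner F (monomial n x) = (LINT z|circle. cinner (f z) ((z powi n) *\<^sub>C x))"
    by (simp add: F monomial_def cinner_abs_L2 f)
  also have "\<dots> = (LINT z|circle. cinner ((z powi (- n)) *\<^sub>C f z) x)"
    by (rule Bochner_Integration.integral_cong)
      (simp_all add: cinner_scaleC_left cinner_scaleC_right cnj_powi_on_circle del: complex_cnj_power_int)
  also have "\<dots> = cinner (LINT z|circle. (z powi (- n)) *\<^sub>C f z) x"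
    by (rule integral_bounded_linear[OF bounded_bilinear.bounded_linear_left[OF bounded_bilinear_cinner]
        integrable_square_integrable[OF square_integrable_powi[OF f]]])
  finally show ?thesis by (simp add: F fourier_coeff_abs_L2 f)
qed

lemma fourier_coeff_monomial: "fourier_coeff (monomial n x) m = (if m = n then x else 0)"
proof -
  have "fourier_coeff (monomial n x) m = (LINT z|circle. (z powi (n - m)) *\<^sub>C x)"
    unfolding monomial_def fourier_coeff_abs_L2[OF square_integrable_monomial]
    by (rule Bochner_Integration.integral_cong)
      (use sphere_nonzero in \<open>auto simp: scaleC_scaleC power_int_add[symmetric]\<close>)
  also have "\<dots> = (LINT z|circle. z powi (n - m)) *\<^sub>C x"
  proof (rule integral_bounded_linear[OF bounded_bilinear.bounded_linear_left[OF bounded_bilinear_scaleC]])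
    show "integrable circle (\<lambda>z::complex. z powi (n - m))"
      using integrable_square_integrable[OF square_integrable_monomial[of "n - m" "1::complex"]] by simp
  qed
  finally show ?thesis by (simp add: integral_circle_powi)
qed

lemma norm_monomial [simp]: "norm (monomial n x) = norm x"
  by (rule norm_eq_if_cinner_self_eq) (simp add: cinner_monomial fourier_coeff_monomial)

lemma fourier_coeff_diff: "fourier_coeff (F - G) n = fourier_coeff F n - fourier_coeff G n"
  by (simp add: fourier_coeff_add fourier_coeff_uminus diff_conv_add_uminus del: add_uminus_conv_diff)

lemma real_cinner_le:
  "complex_of_real a = cinner x y \<Longrightarrow> a \<le> norm x * norm (y::'a::complex_inner)"
  using cmod_cinner_le[of x y] by (metis norm_of_real abs_ge_self order_trans)

lemma le_if_square_le_mult: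
  fixes a b :: real
  assumes "a\<^sup>2 \<le> b * a" "0 \<le> a" "0 \<le> b"
  shows "a \<le> b"
  using assms by (cases "a = 0") (simp_all add: power2_eq_square)

lemma norm_fourier_coeff_le: "norm (fourier_coeff F n) \<le> norm F"
proof -
  have "complex_of_real ((norm (fourier_coeff F n))\<^sup>2) = cinner F (monomial n (fourier_coeff F n))"
    by (simp only: cinner_monomial cinner_self)
  then have "(norm (fourier_coeff F n))\<^sup>2 \<le> norm F * norm (fourier_coeff F n)"
    using real_cinner_le by fastforce
  then show ?thesis
    by (rule le_if_square_le_mult) simp_all
qed

lemma bounded_linear_fourier_coeff: "bounded_linear (\<lambda>F. fourier_coeff F n)"
  by (rule bounded_linear_intro[of _ 1])
    (simp_all add: fourier_coeff_add fourier_coeff_scaleC scaleR_scaleC norm_fourier_coeff_le)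

text \<open>Any representative of F - G is spectrally null.\<close>

lemma L2_eqI:
  assumes "\<And>n. fourier_coeff F n = fourier_coeff G n"
  shows "F = G"
proof -
  define f where "f = rep_L2 (F - G)"
  have f: "square_integrable f" and FG: "F - G = abs_L2 f"
    by (simp_all add: f_def square_integrable_rep_L2)
  have "spectrally_null f"
    unfolding spectrally_null_def
  proof (intro conjI allI)
    show "integrable circle f" by (rule integrable_square_integrable[OF f])
    show "(LINT z|circle. (z powi n) *\<^sub>C f z) = 0" for n
      using assms[of "- n"] fourier_coeff_diff[of F G "- n"] by (simp add: FG fourier_coeff_abs_L2 f)
  qed
  from spectrally_null_AE_zero[OF this] have "abs_L2 f = abs_L2 (\<lambda>_. 0)"
    by (intro abs_L2_eqI f) auto
  then have "F - G = 0"
    by (simp add: FG zero_L2_def)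
  then show ?thesis by simp
qed

lemma cinner_monomial_monomial:
  "cinner (monomial m x) (monomial n y) = (if m = n then cinner x y else 0)"
  by (simp add: cinner_monomial fourier_coeff_monomial)

lemma norm_sum_monomials:
  assumes "finite S" "inj_on e S"
  shows "(norm (\<Sum>i\<in>S. monomial (e i) (x i)))\<^sup>2 = (\<Sum>i\<in>S. (norm (x i))\<^sup>2)"
proof -
  have "pairwise (\<lambda>i j. orthogonal (monomial (e i) (x i)) (monomial (e j) (x j))) S"
    using assms(2) by (auto simp: pairwise_def orthogonal_def Re_cinner[symmetric]
        cinner_monomial_monomial inj_on_def)
  from norm_sum_Pythagorean[OF assms(1) this] show ?thesis by simp
qed

lemma bessel_inequality:
  assumes "finite S"
  shows "(\<Sum>n\<in>S. (norm (fourier_coeff F n))\<^sup>2) \<le> (norm F)\<^sup>2"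
proof -
  let ?G = "\<Sum>n\<in>S. monomial n (fourier_coeff F n)"
  have G: "(norm ?G)\<^sup>2 = (\<Sum>n\<in>S. (norm (fourier_coeff F n))\<^sup>2)"
    using norm_sum_monomials[OF assms, of "\<lambda>n. n" "fourier_coeff F"] by simp
  have "complex_of_real ((norm ?G)\<^sup>2) = cinner F ?G"
    by (simp add: G cinner_sum_right cinner_monomial cinner_self)
  then have "(norm ?G)\<^sup>2 \<le> norm F * norm ?G"
    by (rule real_cinner_le)
  then have "norm ?G \<le> norm F"
    by (rule le_if_square_le_mult) simp_all
  then show ?thesis
    unfolding G[symmetric] by (simp add: power_mono)
qed

lemma summable_orthogonal:
  fixes v :: "nat \<Rightarrow> 'a::{real_inner, banach}"
  assumes orth: "\<And>m n. m \<noteq> n \<Longrightarrow> v m \<bullet> v n = 0" and sq: "summable (\<lambda>n. (norm (v n))\<^sup>2)"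
  shows "summable v"
  unfolding summable_Cauchy
proof (intro allI impI)
  fix e :: real assume e: "e > 0"
  then obtain N where N: "\<And>m n. m \<ge> N \<Longrightarrow> norm (\<Sum>i=m..<n. (norm (v i))\<^sup>2) < e\<^sup>2"
    using sq unfolding summable_Cauchy by (meson zero_less_power)
  show "\<exists>N. \<forall>m\<ge>N. \<forall>n. norm (sum v {m..<n}) < e"
  proof (intro exI[of _ N] allI impI)
    fix m n assume "N \<le> m"
    have "(norm (sum v {m..<n}))\<^sup>2 = (\<Sum>i=m..<n. (norm (v i))\<^sup>2)"
      by (rule norm_sum_Pythagorean) (auto simp: pairwise_def orthogonal_def orth)
    also have "\<dots> < e\<^sup>2"
      using N[OF \<open>N \<le> m\<close>, of n] by (simp only: real_norm_def)
    finally show "norm (sum v {m..<n}) < e"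
      using e by (simp add: power2_less_imp_less)
  qed
qed

lemma summable_monomials:
  assumes "inj e" "summable (\<lambda>n. (norm (x n))\<^sup>2)"
  shows "summable (\<lambda>n::nat. monomial (e n) (x n))"
  by (rule summable_orthogonal)
    (use assms in \<open>simp_all add: Re_cinner[symmetric] cinner_monomial_monomial inj_eq\<close>)

section \<open>The Hardy space\<close>

definition hardy_coeff :: "'e::separable_hilbert_space hardy \<Rightarrow> nat \<Rightarrow> 'e" where
  "hardy_coeff F n = fourier_coeff (hardy_incl F) (int n)"

lemma hardy_incl_add: "hardy_incl (F + G) = hardy_incl F + hardy_incl G"
  by (rule plus_hardy.rep_eq)

lemma hardy_incl_diff: "hardy_incl (F - G) = hardy_incl F - hardy_incl G"
  by (rule minus_hardy.rep_eq)

lemma hardy_incl_scaleC: "hardy_incl (c *\<^sub>C F) = c *\<^sub>C hardy_incl F"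
  by (rule scaleC_hardy.rep_eq)

lemma norm_hardy_incl: "norm (hardy_incl F) = norm F"
  by (rule norm_hardy.rep_eq[symmetric])

lemma cinner_hardy_incl: "cinner (hardy_incl F) (hardy_incl G) = cinner F G"
  by (rule cinner_hardy.rep_eq[symmetric])

lemma fourier_coeff_hardy_neg: "n < 0 \<Longrightarrow> fourier_coeff (hardy_incl F) n = 0"
  using hardy_incl[of F] by auto

lemma bounded_linear_hardy_incl: "bounded_linear hardy_incl"
  by (rule bounded_linear_intro[of _ 1])
    (simp_all add: hardy_incl_add hardy_incl_scaleC scaleR_scaleC norm_hardy_incl)

lemma bounded_linear_hardy_coeff: "bounded_linear (\<lambda>F. hardy_coeff F n)"
  unfolding hardy_coeff_def
  by (rule bounded_linear_compose[OF bounded_linear_fourier_coeff bounded_linear_hardy_incl])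

lemma hardy_coeff_add: "hardy_coeff (F + G) n = hardy_coeff F n + hardy_coeff G n"
  by (simp add: hardy_coeff_def hardy_incl_add fourier_coeff_add)

lemma hardy_coeff_diff: "hardy_coeff (F - G) n = hardy_coeff F n - hardy_coeff G n"
  by (simp add: hardy_coeff_def hardy_incl_diff fourier_coeff_diff)

lemma hardy_coeff_scaleC: "hardy_coeff (c *\<^sub>C F) n = c *\<^sub>C hardy_coeff F n"
  by (simp add: hardy_coeff_def hardy_incl_scaleC fourier_coeff_scaleC)

lemma hardy_eqI:
  assumes "\<And>n. hardy_coeff F n = hardy_coeff G n"
  shows "F = G"
proof -
  have "fourier_coeff (hardy_incl F) n = fourier_coeff (hardy_incl G) n" for n
    using assms[of "nat n"] by (cases "n < 0") (auto simp: fourier_coeff_hardy_neg hardy_coeff_def)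
  then show ?thesis
    using L2_eqI hardy_incl_inject by blast
qed

instance hardy :: (separable_hilbert_space) banach
proof
  fix X :: "nat \<Rightarrow> 'a hardy" assume X: "Cauchy X"
  have dist: "dist (hardy_incl F) (hardy_incl G) = dist F G" for F G :: "'a hardy"
    by (rule dist_hardy.rep_eq[symmetric])
  have "Cauchy (\<lambda>n. hardy_incl (X n))"
    using X unfolding Cauchy_def dist .
  then obtain G where G: "(\<lambda>n. hardy_incl (X n)) \<longlonglongrightarrow> G"
    unfolding Cauchy_convergent_iff convergent_def by blast
  have "fourier_coeff G n = 0" if "n < 0" for n
  proof (rule LIMSEQ_unique)
    show "(\<lambda>k. fourier_coeff (hardy_incl (X k)) n) \<longlonglongrightarrow> fourier_coeff G n"
      by (rule bounded_linear.tendsto[OF bounded_linear_fourier_coeff G])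
    show "(\<lambda>k. fourier_coeff (hardy_incl (X k)) n) \<longlonglongrightarrow> 0"
      using that by (simp only: fourier_coeff_hardy_neg tendsto_const)
  qed
  then have "hardy_incl (Abs_hardy G) = G"
    by (simp add: Abs_hardy_inverse)
  then obtain H where "G = hardy_incl H"
    by metis
  with G have "X \<longlonglongrightarrow> H"
    by (simp add: tendsto_iff dist)
  then show "convergent X" by (rule convergentI)
qed

definition hardy_monomial :: "nat \<Rightarrow> 'e \<Rightarrow> 'e::separable_hilbert_space hardy" where
  "hardy_monomial n x = Abs_hardy (monomial (int n) x)"

lemma hardy_incl_monomial: "hardy_incl (hardy_monomial n x) = monomial (int n) x"
  unfolding hardy_monomial_def by (rule Abs_hardy_inverse) (simp add: fourier_coeff_monomial)

lemma hardy_coeff_monomial: "hardy_coeff (hardy_monomial n x) m = (if m = n then x else 0)"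
  by (simp add: hardy_coeff_def hardy_incl_monomial fourier_coeff_monomial)

lemma cinner_hardy_monomial: "cinner F (hardy_monomial n x) = cinner (hardy_coeff F n) x"
  by (simp add: hardy_coeff_def cinner_hardy_incl[symmetric] hardy_incl_monomial cinner_monomial)

lemma norm_hardy_monomial [simp]: "norm (hardy_monomial n x) = norm x"
  by (simp add: norm_hardy_incl[symmetric] hardy_incl_monomial)

lemma hardy_monomial_add: "hardy_monomial n (x + y) = hardy_monomial n x + hardy_monomial n y"
  by (rule hardy_eqI) (simp add: hardy_coeff_add hardy_coeff_monomial)

lemma hardy_monomial_scaleC: "hardy_monomial n (c *\<^sub>C x) = c *\<^sub>C hardy_monomial n x"
  by (rule hardy_eqI) (simp add: hardy_coeff_scaleC hardy_coeff_monomial)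

lemma norm_sum_hardy_monomials:
  assumes "finite S" "inj_on e S"
  shows "(norm (\<Sum>i\<in>S. hardy_monomial (e i) (x i)))\<^sup>2 = (\<Sum>i\<in>S. (norm (x i))\<^sup>2)"
proof -
  have "inj_on (\<lambda>i. int (e i)) S"
    using assms(2) by (simp add: inj_on_def)
  from norm_sum_monomials[OF assms(1) this, of x] show ?thesis
    by (simp add: norm_hardy_incl[symmetric] hardy_incl_monomial
      linear_sum[OF bounded_linear.linear[OF bounded_linear_hardy_incl]])
qed

lemma summable_square_fourier_coeff:
  fixes F :: "'e::separable_hilbert_space L2"
  shows "summable (\<lambda>n. (norm (fourier_coeff F (int n)))\<^sup>2)"
proof (rule summableI_nonneg_bounded)
  show "(\<Sum>i<n. (norm (fourier_coeff F (int i)))\<^sup>2) \<le> (norm F)\<^sup>2" for n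
    using bessel_inequality[of "int ` {..<n}" F] by (simp add: sum.reindex)
qed simp

lemma sums_hardy_monomials:
  fixes x :: "nat \<Rightarrow> 'e::separable_hilbert_space"
  assumes "summable (\<lambda>n. (norm (x n))\<^sup>2)"
  obtains G where "(\<lambda>n. hardy_monomial n (x n)) sums G" "\<And>n. hardy_coeff G n = x n"
proof -
  have "summable (\<lambda>n. hardy_monomial n (x n))"
    by (rule summable_orthogonal)
      (use assms in \<open>simp_all add: Re_cinner[symmetric] cinner_hardy_monomial hardy_coeff_monomial\<close>)
  then obtain G where G: "(\<lambda>n. hardy_monomial n (x n)) sums G"
    by (auto simp: summable_def)
  have "hardy_coeff G m = x m" for m
  proof -
    have "(\<lambda>n. hardy_coeff (hardy_monomial n (x n)) m) sums hardy_coeff G m"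
      by (rule bounded_linear.sums[OF bounded_linear_hardy_coeff G])
    moreover have "(\<lambda>n. hardy_coeff (hardy_monomial n (x n)) m) = (\<lambda>n. if n = m then x n else 0)"
      by (auto simp: hardy_coeff_monomial)
    ultimately show ?thesis
      using sums_single[of m x] sums_unique2 by metis
  qed
  with G that show ?thesis by blast
qed

lemma hardy_expansion: "(\<lambda>n. hardy_monomial n (hardy_coeff F n)) sums F"
  using sums_hardy_monomials[OF summable_square_fourier_coeff[of "hardy_incl F"]] hardy_eqI
  unfolding hardy_coeff_def[symmetric] by metis

text \<open>Every element of the Hardy space is the sum of its Fourier series in norm.\<close>

lemma bounded_linear_eq_on_monomials:
  assumes A: "bounded_linear A" and B: "bounded_linear B"
    and eq: "\<And>n x. A (hardy_monomial n x) = B (hardy_monomial n x)"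
  shows "A F = B F"
  using bounded_linear.sums[OF A hardy_expansion[of F]] bounded_linear.sums[OF B hardy_expansion[of F]]
  by (simp add: eq sums_unique2)

text \<open>The orthogonal projection discards the coefficients of negative index; Bessel's inequality makes
  the remaining series converge.\<close>

lemma hardy_proj_characterization:
  "\<exists>!G. \<forall>K. cinner (F - hardy_incl G) (hardy_incl K) = 0"
  "hardy_coeff (THE G. \<forall>K. cinner (F - hardy_incl G) (hardy_incl K) = 0) n = fourier_coeff F (int n)"
proof -
  obtain G where coeff: "\<And>n. hardy_coeff G n = fourier_coeff F (int n)"
    by (rule sums_hardy_monomials[OF summable_square_fourier_coeff[of F]]) (rule that)
  note lin = bounded_bilinear.bounded_linear_right[OF bounded_bilinear_cinner]
  have "cinner (F - hardy_incl G) (hardy_incl K) = 0" for K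
  proof (rule bounded_linear_eq_on_monomials)
    show "bounded_linear (\<lambda>K. cinner (F - hardy_incl G) (hardy_incl K))"
      by (rule bounded_linear_compose[OF lin bounded_linear_hardy_incl])
    show "cinner (F - hardy_incl G) (hardy_incl (hardy_monomial n x)) = 0" for n x
      using coeff[unfolded hardy_coeff_def] by (simp add: hardy_incl_monomial cinner_monomial fourier_coeff_diff)
  qed (rule bounded_linear_zero)
  then have orth: "\<forall>K. cinner (F - hardy_incl G) (hardy_incl K) = 0"
    by simp
  have unique: "G' = G" if "\<forall>K. cinner (F - hardy_incl G') (hardy_incl K) = 0" for G'
    by (rule cinner_ext) (use that orth in \<open>simp add: cinner_hardy_incl[symmetric] cinner_diff_left\<close>)
  show "\<exists>!G. \<forall>K. cinner (F - hardy_incl G) (hardy_incl K) = 0"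
    using orth unique by blast
  show "hardy_coeff (THE G. \<forall>K. cinner (F - hardy_incl G) (hardy_incl K) = 0) n = fourier_coeff F (int n)"
  proof -
    have "(THE G. \<forall>K. cinner (F - hardy_incl G) (hardy_incl K) = 0) = G"
      by (rule the_equality, rule orth, rule unique)
    then show ?thesis by (simp only: coeff)
  qed
qed

lemma hardy_coeff_proj: "hardy_coeff (hardy_proj F) n = fourier_coeff F (int n)"
  unfolding hardy_proj_def by (rule hardy_proj_characterization)

lemma cinner_hardy_proj: "cinner (hardy_proj F) K = cinner F (hardy_incl K)"
proof -
  have "\<forall>K. cinner (F - hardy_incl (hardy_proj F)) (hardy_incl K) = 0"
    unfolding hardy_proj_def by (rule theI'[OF hardy_proj_characterization(1)])
  then have "cinner F (hardy_incl K) - cinner (hardy_incl (hardy_proj F)) (hardy_incl K) = 0"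
    by (simp only: cinner_diff_left)
  then show ?thesis by (simp add: cinner_hardy_incl)
qed

lemma norm_hardy_proj_le: "norm (hardy_proj F) \<le> norm F"
proof -
  have "complex_of_real ((norm (hardy_proj F))\<^sup>2) = cinner F (hardy_incl (hardy_proj F))"
    by (simp only: cinner_self[symmetric] cinner_hardy_proj)
  then have "(norm (hardy_proj F))\<^sup>2 \<le> norm F * norm (hardy_incl (hardy_proj F))"
    by (rule real_cinner_le)
  then have "(norm (hardy_proj F))\<^sup>2 \<le> norm F * norm (hardy_proj F)"
    by (simp only: norm_hardy_incl)
  then show ?thesis
    by (rule le_if_square_le_mult) simp_all
qed

lemma bounded_clinear_hardy_proj: "bounded_clinear hardy_proj"
proof (rule bounded_clinearI)
  show "hardy_proj (F + G) = hardy_proj F + hardy_proj G" for F G :: "'a L2"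
    by (rule hardy_eqI) (simp add: hardy_coeff_add hardy_coeff_proj fourier_coeff_add)
  show "hardy_proj (c *\<^sub>C F) = c *\<^sub>C hardy_proj F" for c and F :: "'a L2"
    by (rule hardy_eqI) (simp add: hardy_coeff_scaleC hardy_coeff_proj fourier_coeff_scaleC)
  show "norm (hardy_proj F) \<le> 1 * norm F" for F :: "'a L2"
    by (simp add: norm_hardy_proj_le)
qed

section \<open>Toeplitz and Hankel operators and their matrices\<close>

lemma L_infinity_clinear: "\<Phi> \<in> L_infinity \<Longrightarrow> z \<in> sphere 0 1 \<Longrightarrow> bounded_clinear (\<Phi> z)"
  by (simp add: L_infinity_def)

lemma bounded_clinear_mult_op:
  assumes \<Phi>: "\<Phi> \<in> L_infinity"
  shows "bounded_clinear (mult_op \<Phi>)"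
proof -
  obtain C where C: "AE z in circle. onorm (\<Phi> z) \<le> C"
    using \<Phi> by (auto simp: L_infinity_def)
  note sq = square_integrable_L_infinity_apply[OF \<Phi>]
  show ?thesis
  proof (rule bounded_clinearI)
    fix F G :: "'a L2" and c
    define f g where "f = rep_L2 F" and "g = rep_L2 G"
    have f: "square_integrable f" and F: "F = abs_L2 f" and g: "square_integrable g" and G: "G = abs_L2 g"
      by (simp_all add: f_def g_def square_integrable_rep_L2)
    note fg = square_integrable_add[OF f g] and cf = square_integrable_scaleC[OF f, of c]
    show "mult_op \<Phi> (F + G) = mult_op \<Phi> F + mult_op \<Phi> G"
      unfolding F G abs_L2_add[OF f g] mult_op_abs_L2[OF \<Phi> f] mult_op_abs_L2[OF \<Phi> g]
        mult_op_abs_L2[OF \<Phi> fg] abs_L2_add[OF sq[OF f] sq[OF g]]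
      by (rule abs_L2_cong[OF sq[OF fg]]) (rule bounded_clinear_add[OF L_infinity_clinear[OF \<Phi>]])
    show "mult_op \<Phi> (c *\<^sub>C F) = c *\<^sub>C mult_op \<Phi> F"
      unfolding F abs_L2_scaleC[OF f] mult_op_abs_L2[OF \<Phi> f] mult_op_abs_L2[OF \<Phi> cf]
        abs_L2_scaleC[OF sq[OF f]]
      by (rule abs_L2_cong[OF sq[OF cf]]) (rule bounded_clinear_scaleC[OF L_infinity_clinear[OF \<Phi>]])
    show "norm (mult_op \<Phi> F) \<le> max 0 C * norm F"
      unfolding F mult_op_abs_L2[OF \<Phi> f]
    proof (rule norm_abs_L2_le[OF sq[OF f] f])
      show "AE z in circle. norm (\<Phi> z (f z)) \<le> max 0 C * norm (f z)"
        using C AE_space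
      proof eventually_elim
        case (elim z)
        then have "bounded_linear (\<Phi> z)"
          using L_infinity_clinear[OF \<Phi>] bounded_clinear_bounded_linear by auto
        then have "norm (\<Phi> z (f z)) \<le> onorm (\<Phi> z) * norm (f z)"
          by (rule onorm)
        also have "\<dots> \<le> max 0 C * norm (f z)"
          using elim by (simp add: mult_right_mono)
        finally show ?case .
      qed
    qed simp
  qed
qed

definition symbol_coeff :: "(complex \<Rightarrow> 'e \<Rightarrow> 'e) \<Rightarrow> int \<Rightarrow> 'e \<Rightarrow> 'e::separable_hilbert_space" where
  "symbol_coeff \<Phi> n x = (LINT z|circle. (z powi (- n)) *\<^sub>C \<Phi> z x)"

lemma fourier_coeff_mult_op_monomial:
  assumes \<Phi>: "\<Phi> \<in> L_infinity"
  shows "fourier_coeff (mult_op \<Phi> (monomial j x)) i = symbol_coeff \<Phi> (i - j) x"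
proof -
  have "fourier_coeff (mult_op \<Phi> (monomial j x)) i =
      (LINT z|circle. (z powi (- i)) *\<^sub>C \<Phi> z ((z powi j) *\<^sub>C x))"
    by (simp add: monomial_def mult_op_abs_L2 \<Phi>
        fourier_coeff_abs_L2[OF square_integrable_L_infinity_apply[OF \<Phi> square_integrable_monomial]])
  also have "\<dots> = symbol_coeff \<Phi> (i - j) x"
    unfolding symbol_coeff_def
  proof (rule Bochner_Integration.integral_cong)
    fix z assume "z \<in> space circle"
    then have z: "z \<in> sphere 0 1" "z \<noteq> 0" by auto
    then show "(z powi (- i)) *\<^sub>C \<Phi> z ((z powi j) *\<^sub>C x) = (z powi (- (i - j))) *\<^sub>C \<Phi> z x"
      using bounded_clinear_scaleC[OF L_infinity_clinear[OF \<Phi> z(1)]]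
      by (simp add: scaleC_scaleC power_int_add[symmetric])
  qed simp
  finally show ?thesis .
qed

lemma conj_flip_abs_L2:
  "square_integrable f \<Longrightarrow> conj_flip (abs_L2 f) = abs_L2 (\<lambda>z. f (cnj z))"
  by (simp add: conj_flip.abs_eq L2_rel_refl)

lemma conj_flip_monomial: "conj_flip (monomial j x) = monomial (- j) x"
  unfolding monomial_def conj_flip_abs_L2[OF square_integrable_monomial]
  by (rule abs_L2_cong[OF square_integrable_cnj[OF square_integrable_monomial]])
    (simp only: complex_cnj_power_int[symmetric] cnj_powi_on_circle)

lemma bounded_clinear_conj_flip: "bounded_clinear (conj_flip :: 'e::separable_hilbert_space L2 \<Rightarrow> 'e L2)"
proof (rule bounded_clinearI)
  fix F G :: "'e L2" and c
  define f g where "f = rep_L2 F" and "g = rep_L2 G"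
  have f: "square_integrable f" and F: "F = abs_L2 f" and g: "square_integrable g" and G: "G = abs_L2 g"
    by (simp_all add: f_def g_def square_integrable_rep_L2)
  note sq = square_integrable_cnj[OF f] square_integrable_cnj[OF g]
  show "conj_flip (F + G) = conj_flip F + conj_flip G"
    by (simp add: F G abs_L2_add f g sq conj_flip_abs_L2 square_integrable_add)
  show "conj_flip (c *\<^sub>C F) = c *\<^sub>C conj_flip F"
    by (simp add: F abs_L2_scaleC f sq conj_flip_abs_L2 square_integrable_scaleC)
  have "(LINT z|circle. (norm (f (cnj z)))\<^sup>2) = (LINT z|distr circle circle cnj. (norm (f z))\<^sup>2)"
    by (rule integral_distr[symmetric, OF measurable_cnj_circle])
      (use f in \<open>simp add: square_integrable_def borel_measurable_integrable\<close>)
  then have "(norm (conj_flip F))\<^sup>2 = (norm F)\<^sup>2"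
    by (simp add: F conj_flip_abs_L2 f sq norm_abs_L2 distr_circle_cnj)
  then show "norm (conj_flip F) \<le> 1 * norm F"
    by simp
qed

lemma bounded_clinear_hardy_incl: "bounded_clinear hardy_incl"
  by (simp add: bounded_clinear_def bounded_linear_hardy_incl hardy_incl_scaleC)

lemma bounded_clinear_toeplitz: "\<Phi> \<in> L_infinity \<Longrightarrow> bounded_clinear (toeplitz \<Phi>)"
  unfolding toeplitz_def[abs_def]
  by (rule bounded_clinear_compose[OF bounded_clinear_hardy_proj
        bounded_clinear_compose[OF bounded_clinear_mult_op bounded_clinear_hardy_incl]])

lemma bounded_clinear_hankel: "\<Phi> \<in> L_infinity \<Longrightarrow> bounded_clinear (hankel \<Phi>)"
  unfolding hankel_def[abs_def]
  by (rule bounded_clinear_compose[OF bounded_clinear_hardy_proj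
        bounded_clinear_compose[OF bounded_clinear_mult_op
          bounded_clinear_compose[OF bounded_clinear_conj_flip bounded_clinear_hardy_incl]]])

definition entry :: "('e hardy \<Rightarrow> 'e hardy) \<Rightarrow> nat \<Rightarrow> nat \<Rightarrow> 'e \<Rightarrow> 'e::separable_hilbert_space" where
  "entry A i j x = hardy_coeff (A (hardy_monomial j x)) i"

lemma entry_toeplitz: "\<Phi> \<in> L_infinity \<Longrightarrow> entry (toeplitz \<Phi>) i j x = symbol_coeff \<Phi> (int i - int j) x"
  by (simp add: entry_def toeplitz_def hardy_coeff_proj hardy_incl_monomial fourier_coeff_mult_op_monomial)

lemma entry_hankel: "\<Phi> \<in> L_infinity \<Longrightarrow> entry (hankel \<Phi>) i j x = symbol_coeff \<Phi> (int i + int j) x"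
  by (simp add: entry_def hankel_def hardy_coeff_proj hardy_incl_monomial conj_flip_monomial
      fourier_coeff_mult_op_monomial)

lemma entry_eqI:
  assumes A: "bounded_clinear A" and B: "bounded_clinear B"
    and eq: "\<And>i j x. entry A i j x = entry B i j x"
  shows "A = B"
proof (rule ext)
  show "A F = B F" for F
  proof (rule bounded_linear_eq_on_monomials[of A B])
    show "A (hardy_monomial n x) = B (hardy_monomial n x)" for n x
      by (rule hardy_eqI) (use eq in \<open>simp add: entry_def\<close>)
  qed (use A B bounded_clinear_bounded_linear in auto)
qed

lemma entry_clinear:
  assumes A: "bounded_clinear A"
  shows "entry A i j (x + y) = entry A i j x + entry A i j y"
    and "entry A i j (c *\<^sub>C x) = c *\<^sub>C entry A i j x"
  by (simp_all add: entry_def hardy_monomial_add hardy_monomial_scaleC bounded_clinear_add[OF A]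
      bounded_clinear_scaleC[OF A] hardy_coeff_add hardy_coeff_scaleC)

lemma sum_norm_entry_le:
  assumes C: "\<And>F. norm (A F) \<le> C * norm F" and "C \<ge> 0" and "finite S"
  shows "(\<Sum>i\<in>S. (norm (entry A i j x))\<^sup>2) \<le> (C * norm x)\<^sup>2"
proof -
  have "(\<Sum>i\<in>S. (norm (entry A i j x))\<^sup>2) =
      (\<Sum>n\<in>int ` S. (norm (fourier_coeff (hardy_incl (A (hardy_monomial j x))) n))\<^sup>2)"
    by (simp add: entry_def hardy_coeff_def sum.reindex)
  also have "\<dots> \<le> (norm (A (hardy_monomial j x)))\<^sup>2"
    using bessel_inequality[of "int ` S"] \<open>finite S\<close> by (simp add: norm_hardy_incl[symmetric])
  also have "\<dots> \<le> (C * norm x)\<^sup>2"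
    using C[of "hardy_monomial j x"] by (intro power_mono) auto
  finally show ?thesis .
qed

section \<open>The shift and its adjoint\<close>

lemma L_infinity_powi: "(\<lambda>z x. (z powi k) *\<^sub>C x) \<in> L_infinity"
  unfolding L_infinity_def mem_Collect_eq
proof (intro conjI ballI allI exI)
  fix z :: complex
  show "bounded_clinear (\<lambda>x::'a. (z powi k) *\<^sub>C x)"
    by (rule bounded_clinearI[of _ "cmod (z powi k)"])
      (simp_all add: scaleC_add_right scaleC_scaleC mult.commute norm_scaleC)
next
  show "(\<lambda>z. (z powi k) *\<^sub>C x) \<in> borel_measurable circle" for x :: 'a
    by measurable
next
  show "AE z in circle. onorm (\<lambda>x::'a. (z powi k) *\<^sub>C x) \<le> 1"
    by (intro AE_I2 onorm_bound) (auto simp: norm_scaleC norm_power_int)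
qed

lemma fourier_coeff_mult_powi:
  "fourier_coeff (mult_op (\<lambda>z x. (z powi k) *\<^sub>C x) F) n = fourier_coeff F (n - k)"
proof -
  define f where "f = rep_L2 F"
  have f: "square_integrable f" and F: "F = abs_L2 f"
    by (simp_all add: f_def square_integrable_rep_L2)
  have "(LINT z|circle. (z powi (- n)) *\<^sub>C (z powi k) *\<^sub>C f z) = (LINT z|circle. (z powi (- (n - k))) *\<^sub>C f z)"
    by (rule Bochner_Integration.integral_cong)
      (use sphere_nonzero in \<open>auto simp: scaleC_scaleC power_int_add[symmetric]\<close>)
  then show ?thesis
    by (simp add: F mult_op_abs_L2[OF L_infinity_powi f] fourier_coeff_abs_L2 f square_integrable_powi)
qed

lemma cinner_mult_powi:
  "cinner (mult_op (\<lambda>z x. (z powi k) *\<^sub>C x) F) G = cinner F (mult_op (\<lambda>z x. (z powi (- k)) *\<^sub>C x) G)"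
proof -
  define f g where "f = rep_L2 F" and "g = rep_L2 G"
  have f: "square_integrable f" and F: "F = abs_L2 f" and g: "square_integrable g" and G: "G = abs_L2 g"
    by (simp_all add: f_def g_def square_integrable_rep_L2)
  have "(LINT z|circle. cinner ((z powi k) *\<^sub>C f z) (g z)) =
      (LINT z|circle. cinner (f z) ((z powi (- k)) *\<^sub>C g z))"
    by (rule Bochner_Integration.integral_cong)
      (simp_all add: cinner_scaleC_left cinner_scaleC_right cnj_powi_on_circle del: complex_cnj_power_int)
  then show ?thesis
    by (simp only: F G mult_op_abs_L2[OF L_infinity_powi f] mult_op_abs_L2[OF L_infinity_powi g]
      cinner_abs_L2 f g square_integrable_powi)
qed

lemma shift_eq: "shift = toeplitz (\<lambda>z x. (z powi 1) *\<^sub>C x)"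
  by (simp add: shift_def)

lemma hardy_coeff_shift:
  "hardy_coeff (shift F) 0 = 0" "hardy_coeff (shift F) (Suc n) = hardy_coeff F n"
  by (simp_all add: shift_eq toeplitz_def hardy_coeff_proj fourier_coeff_mult_powi[of 1, simplified]
      fourier_coeff_hardy_neg hardy_coeff_def[of F])

text \<open>The adjoint of multiplication by z on L2 is multiplication by its inverse, and compressing it to
  the Hardy space gives the backward shift.\<close>

lemma cinner_shift:
  "cinner (shift F) G = cinner F (hardy_proj (mult_op (\<lambda>z x. (z powi (- 1)) *\<^sub>C x) (hardy_incl G)))"
    (is "_ = cinner F ?B")
proof -
  have "cinner (shift F) G = cinner (mult_op (\<lambda>z x. (z powi 1) *\<^sub>C x) (hardy_incl F)) (hardy_incl G)"
    by (simp only: shift_eq toeplitz_def cinner_hardy_proj)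
  also have "\<dots> = cinner (hardy_incl F) (mult_op (\<lambda>z x. (z powi (- 1)) *\<^sub>C x) (hardy_incl G))"
    by (rule cinner_mult_powi)
  also have "\<dots> = cnj (cinner ?B F)"
    by (simp only: cinner_hardy_proj cinner_commute[symmetric])
  finally show ?thesis by (simp only: cinner_commute[symmetric])
qed

lemma shift_adj_eq:
  "shift_adj F = hardy_proj (mult_op (\<lambda>z x. (z powi (- 1)) *\<^sub>C x) (hardy_incl F))"
proof -
  let ?B = "\<lambda>F::'a hardy. hardy_proj (mult_op (\<lambda>z x. (z powi (- 1)) *\<^sub>C x) (hardy_incl F))"
  have "hilbert_adjoint (shift :: 'a hardy \<Rightarrow> _) = ?B"
    unfolding hilbert_adjoint_def
  proof (rule the_equality)
    show "\<forall>F G. cinner (shift F) G = cinner F (?B G)"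
      using cinner_shift by blast
  next
    fix S :: "'a hardy \<Rightarrow> 'a hardy"
    assume S: "\<forall>F G. cinner (shift F) G = cinner F (S G)"
    show "S = ?B"
    proof (rule ext)
      fix G
      show "S G = ?B G"
      proof (rule cinner_ext)
        fix F
        have "cinner F (S G) = cinner F (?B G)"
          using S cinner_shift by metis
        then show "cinner (S G) F = cinner (?B G) F"
          using cinner_commute[of "S G" F] cinner_commute[of "?B G" F] by simp
      qed
    qed
  qed
  then show ?thesis by (rule fun_cong)
qed

lemma hardy_coeff_shift_adj: "hardy_coeff (shift_adj F) n = hardy_coeff F (Suc n)"
  unfolding shift_adj_eq hardy_coeff_proj fourier_coeff_mult_powi
  by (simp add: hardy_coeff_def add.commute)

lemma bounded_clinear_shift: "bounded_clinear shift"
  unfolding shift_eq by (rule bounded_clinear_toeplitz[OF L_infinity_powi])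

lemma bounded_clinear_shift_adj: "bounded_clinear shift_adj"
proof -
  have "hilbert_adjoint shift = toeplitz (\<lambda>z x. (z powi (- 1)) *\<^sub>C (x::'a))"
    by (rule ext) (simp only: shift_adj_eq toeplitz_def)
  then show ?thesis
    by (simp only: bounded_clinear_toeplitz[OF L_infinity_powi])
qed

lemma shift_hardy_monomial: "shift (hardy_monomial n x) = hardy_monomial (Suc n) x"
proof (rule hardy_eqI)
  show "hardy_coeff (shift (hardy_monomial n x)) m = hardy_coeff (hardy_monomial (Suc n) x) m" for m
    by (cases m) (auto simp: hardy_coeff_shift hardy_coeff_monomial)
qed

lemma shift_adj_shift: "shift_adj (shift F) = F"
  by (rule hardy_eqI) (simp add: hardy_coeff_shift_adj hardy_coeff_shift)

lemma shift_adj_const: "shift_adj (hardy_monomial 0 x) = 0"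
  by (rule hardy_eqI) (simp add: hardy_coeff_shift_adj hardy_coeff_monomial hardy_coeff_def[of 0]
      zero_hardy.rep_eq fourier_coeff_zero)

lemma hardy_decompose: "F = hardy_monomial 0 (hardy_coeff F 0) + shift (shift_adj F)"
proof (rule hardy_eqI)
  show "hardy_coeff F m = hardy_coeff (hardy_monomial 0 (hardy_coeff F 0) + shift (shift_adj F)) m" for m
    by (cases m) (simp_all add: hardy_coeff_add hardy_coeff_shift hardy_coeff_shift_adj hardy_coeff_monomial)
qed

text \<open>The shift is isometric, and its range is orthogonal to the constants.\<close>

lemma norm_const_plus_shift:
  "(norm (hardy_monomial 0 x + shift F))\<^sup>2 = (norm x)\<^sup>2 + (norm F)\<^sup>2"
proof -
  have adj: "cinner (shift F) G = cinner F (shift_adj G)" for F G :: "'a hardy"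
    by (simp only: cinner_shift shift_adj_eq)
  have "norm (shift F) = norm F"
    by (rule norm_eq_if_cinner_self_eq) (simp only: adj shift_adj_shift)
  moreover have "orthogonal (hardy_monomial 0 x) (shift F)"
    using adj[of F "hardy_monomial 0 x"] Re_cinner[of "shift F" "hardy_monomial 0 x"]
    by (simp add: orthogonal_def shift_adj_const inner_commute[of "hardy_monomial 0 x"])
  ultimately show ?thesis
    by (simp add: norm_add_Pythagorean)
qed

lemma entry_compose_shift: "entry (\<lambda>F. A (shift F)) i j x = entry A i (Suc j) x"
  by (simp add: entry_def shift_hardy_monomial)

lemma entry_compose_shift_adj: "entry (\<lambda>F. shift_adj (A F)) i j x = entry A (Suc i) j x"
  by (simp add: entry_def hardy_coeff_shift_adj)

lemma entry_add: "entry (\<lambda>F. A F + B F) i j x = entry A i j x + entry B i j x"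
  by (simp add: entry_def hardy_coeff_add)

lemma entry_diff: "entry (\<lambda>F. A F - B F) i j x = entry A i j x - entry B i j x"
  by (simp add: entry_def hardy_coeff_diff)

section \<open>Bounded Toeplitz forms have essentially bounded symbols\<close>

lemma cesaro_mean_null:
  fixes b :: "nat \<Rightarrow> real"
  assumes b: "b \<longlonglongrightarrow> 0" and nonneg: "\<And>n. b n \<ge> 0"
  shows "(\<lambda>N. (\<Sum>i<N. b i) / real N) \<longlonglongrightarrow> 0"
proof (rule LIMSEQ_I)
  fix e :: real assume e: "e > 0"
  obtain K where K: "\<And>n. n \<ge> K \<Longrightarrow> b n < e / 2"
    using LIMSEQ_D[OF b, of "e / 2"] e nonneg by auto
  define B where "B = (\<Sum>i<K. b i)"
  have B: "B \<ge> 0" by (simp add: B_def sum_nonneg nonneg)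
  have le: "(\<Sum>i<N. b i) \<le> B + real N * (e / 2)" for N
  proof (cases "N \<le> K")
    case True
    then have "(\<Sum>i<N. b i) \<le> B"
      unfolding B_def by (intro sum_mono2) (auto simp: nonneg)
    then show ?thesis using e by (simp add: add_increasing2)
  next
    case False
    then have "(\<Sum>i<N. b i) = B + (\<Sum>i=K..<N. b i)"
      unfolding B_def lessThan_atLeast0 by (intro sum.atLeastLessThan_concat[symmetric]) auto
    also have "(\<Sum>i=K..<N. b i) \<le> (\<Sum>i=K..<N. e / 2)"
      using K by (intro sum_mono less_imp_le) auto
    also have "\<dots> \<le> real N * (e / 2)"
      using e by (simp add: mult_right_mono)
    finally show ?thesis by simp
  qed
  obtain M where M: "real M > 2 * B / e" "M > 0"
    using reals_Archimedean2[of "max 1 (2 * B / e)"] by (metis less_max_iff_disj max_less_iff_conj of_nat_0_less_iff zero_less_one order_less_trans)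
  show "\<exists>N0. \<forall>N\<ge>N0. norm ((\<Sum>i<N. b i) / real N - 0) < e"
  proof (intro exI[of _ M] allI impI)
    fix N assume "N \<ge> M"
    then have N: "real N > 2 * B / e" "real N > 0" using M by linarith+
    then have "2 * B < e * real N"
      using e by (simp add: field_simps)
    then have "B + real N * (e / 2) < e * real N"
      by (simp add: field_simps)
    then have "(\<Sum>i<N. b i) < e * real N"
      using le[of N] by linarith
    then have "(\<Sum>i<N. b i) / real N < e"
      using N by (simp add: field_simps)
    moreover have "(\<Sum>i<N. b i) \<ge> 0"
      by (simp add: sum_nonneg nonneg)
    ultimately show "norm ((\<Sum>i<N. b i) / real N - 0) < e"
      by simp
  qed
qed

lemma cesaro_mean:
  fixes a :: "nat \<Rightarrow> 'a::real_normed_vector"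
  assumes "a \<longlonglongrightarrow> L"
  shows "(\<lambda>N. (1 / real N) *\<^sub>R (\<Sum>i<N. a i)) \<longlonglongrightarrow> L"
proof -
  have null: "(\<lambda>N. (\<Sum>i<N. norm (a i - L)) / real N) \<longlonglongrightarrow> 0"
    using assms by (intro cesaro_mean_null) (auto simp: tendsto_norm_zero LIM_zero)
  have "(\<lambda>N. (1 / real N) *\<^sub>R (\<Sum>i<N. a i) - L) \<longlonglongrightarrow> 0"
  proof (rule Lim_null_comparison[OF _ null])
    show "\<forall>\<^sub>F N in sequentially. norm ((1 / real N) *\<^sub>R (\<Sum>i<N. a i) - L) \<le> (\<Sum>i<N. norm (a i - L)) / real N"
    proof (rule eventually_sequentiallyI[of 1])
      fix N :: nat assume "1 \<le> N"
      then have "(1 / real N) *\<^sub>R (\<Sum>i<N. a i) - L = (1 / real N) *\<^sub>R (\<Sum>i<N. a i - L)"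
        by (simp add: sum_subtractf scaleR_diff_right sum_constant_scaleR)
      then show "norm ((1 / real N) *\<^sub>R (\<Sum>i<N. a i) - L) \<le> (\<Sum>i<N. norm (a i - L)) / real N"
        using \<open>1 \<le> N\<close> by (simp add: divide_right_mono sum_norm_le norm_sum)
    qed
  qed
  then show ?thesis by (rule LIM_zero_cancel)
qed

text \<open>Only finite sections of the matrix with entries \<gamma>(i - j) enter the bound. The index set of a
  section being immaterial, sections of a doubly infinite matrix and of its corner satisfy the same
  condition.\<close>

locale bounded_toeplitz_form =
  fixes \<gamma> :: "int \<Rightarrow> 'e::separable_hilbert_space \<Rightarrow> 'e" and C :: real
  assumes add: "\<gamma> n (x + y) = \<gamma> n x + \<gamma> n y"
    and scaleC: "\<gamma> n (c *\<^sub>C x) = c *\<^sub>C \<gamma> n x"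
    and C_nonneg: "C \<ge> 0"
    and bound: "cmod (\<Sum>i<N. \<Sum>j<N. cinner (\<gamma> (int i - int j) (u j)) (v i))
      \<le> C * sqrt (\<Sum>j<N. (norm (u j))\<^sup>2) * sqrt (\<Sum>i<N. (norm (v i))\<^sup>2)"
begin

text \<open>Since N - |n| pairs (i, j) of indices below N have difference n, this is the N-th Fejer mean of
  the series of \<gamma>(n) x z^n. Written like this, its inner
  products with vectors are values of the form that is bounded by C.\<close>

definition fejer_mean :: "nat \<Rightarrow> complex \<Rightarrow> 'e \<Rightarrow> 'e" where
  "fejer_mean N z x = (1 / real N) *\<^sub>R (\<Sum>i<N. \<Sum>j<N. (z powi (int i - int j)) *\<^sub>C \<gamma> (int i - int j) x)"

lemma zero: "\<gamma> n 0 = 0"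
  using add[of n 0 0] by simp

lemma fejer_mean_add: "fejer_mean N z (x + y) = fejer_mean N z x + fejer_mean N z y"
  by (simp add: fejer_mean_def add scaleC_add_right sum.distrib scaleR_add_right)

lemma fejer_mean_scaleC: "fejer_mean N z (c *\<^sub>C x) = c *\<^sub>C fejer_mean N z x"
  by (simp add: fejer_mean_def scaleC scaleC_sum_right scaleC_scaleR_commute scaleC_scaleC mult.commute)

text \<open>Pairing the mean with v is evaluating the form at the vectors z^(-j) x and z^(-i) v, whose
  square sums over a section are N |x|^2 and N |v|^2; the factor N cancels.\<close>

lemma norm_fejer_mean_le:
  assumes z: "z \<in> sphere 0 1"
  shows "norm (fejer_mean N z x) \<le> C * norm x"
proof (cases "N = 0")
  case True
  then show ?thesis using C_nonneg by (simp add: fejer_mean_def)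
next
  case False
  define v where "v = fejer_mean N z x"
  have unit: "cmod (z powi k) = 1" for k
    using z by (simp add: norm_power_int)
  have "cinner v v = (1 / real N) *\<^sub>R
      (\<Sum>i<N. \<Sum>j<N. cinner ((z powi (int i - int j)) *\<^sub>C \<gamma> (int i - int j) x) v)"
    by (simp add: v_def[unfolded fejer_mean_def] cinner_scaleR_left cinner_sum_left)
  also have "(\<Sum>i<N. \<Sum>j<N. cinner ((z powi (int i - int j)) *\<^sub>C \<gamma> (int i - int j) x) v) =
      (\<Sum>i<N. \<Sum>j<N. cinner (\<gamma> (int i - int j) ((z powi (- int j)) *\<^sub>C x)) ((z powi (- int i)) *\<^sub>C v))"
  proof (intro sum.cong refl)
    fix i j
    have "z \<noteq> 0" using z by auto
    then have "z powi (int i - int j) = z powi (- int j) * cnj (z powi (- int i))"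
      unfolding cnj_powi_on_circle[OF z] by (subst power_int_add[symmetric]) auto
    then show "cinner ((z powi (int i - int j)) *\<^sub>C \<gamma> (int i - int j) x) v =
        cinner (\<gamma> (int i - int j) ((z powi (- int j)) *\<^sub>C x)) ((z powi (- int i)) *\<^sub>C v)"
      by (simp only: scaleC cinner_scaleC_left cinner_scaleC_right mult_ac)
  qed
  finally have "cmod (cinner v v) \<le> (1 / real N) *
      (C * sqrt (\<Sum>j<N. (norm ((z powi (- int j)) *\<^sub>C x))\<^sup>2) * sqrt (\<Sum>i<N. (norm ((z powi (- int i)) *\<^sub>C v))\<^sup>2))"
    using bound[where N = N and u = "\<lambda>j. (z powi (- int j)) *\<^sub>C x" and v = "\<lambda>i. (z powi (- int i)) *\<^sub>C v"] by (simp add: divide_right_mono)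
  also have "\<dots> = C * norm x * norm v"
  proof -
    have root: "sqrt (\<Sum>j<N. (norm ((z powi (- int j)) *\<^sub>C w))\<^sup>2) = sqrt (real N) * norm w" for w :: 'e
      by (simp add: norm_scaleC unit real_sqrt_mult)
    have "1 / real N * (C * (sqrt (real N) * norm x) * (sqrt (real N) * norm v)) =
        (sqrt (real N) * sqrt (real N)) / real N * (C * norm x * norm v)"
      by (simp only: divide_inverse mult_ac mult_1)
    also have "\<dots> = C * norm x * norm v"
      using False by simp
    finally show ?thesis
      unfolding root .
  qed
  finally have "(norm v)\<^sup>2 \<le> (C * norm x) * norm v"
    by (simp add: cinner_self norm_power)
  then show ?thesis
    unfolding v_def by (rule le_if_square_le_mult) (simp_all add: C_nonneg)
qed

text \<open>The form is evaluated at a single vector x in column m, against the values of that column.\<close>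

lemma sum_norm_column_le:
  assumes "m < N"
  shows "(\<Sum>i<N. (norm (\<gamma> (int i - int m) x))\<^sup>2) \<le> (C * norm x)\<^sup>2" (is "?S \<le> _")
proof -
  have S: "?S \<ge> 0" by (simp add: sum_nonneg)
  let ?u = "\<lambda>j. if j = m then x else 0"
  have "(\<Sum>i<N. \<Sum>j<N. cinner (\<gamma> (int i - int j) (?u j)) (\<gamma> (int i - int m) x)) =
      (\<Sum>i<N. \<Sum>j<N. if j = m then cinner (\<gamma> (int i - int m) x) (\<gamma> (int i - int m) x) else 0)"
    by (intro sum.cong refl) (auto simp: zero)
  also have "\<dots> = complex_of_real ?S"
    using assms by (simp add: cinner_self)
  finally have "cmod (complex_of_real ?S) \<le> C * sqrt (\<Sum>j<N. (norm (?u j))\<^sup>2) * sqrt ?S"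
    using bound[where N = N and u = ?u and v = "\<lambda>i. \<gamma> (int i - int m) x"] by simp
  also have "(\<Sum>j<N. (norm (?u j))\<^sup>2) = (\<Sum>j<N. if j = m then (norm x)\<^sup>2 else 0)"
    by (intro sum.cong) auto
  also have "\<dots> = (norm x)\<^sup>2"
    using assms by simp
  finally have "?S \<le> (C * norm x) * sqrt ?S"
    using S by (simp del: of_real_sum)
  then have "(sqrt ?S)\<^sup>2 \<le> (C * norm x) * sqrt ?S"
    using S by simp
  then have "sqrt ?S \<le> C * norm x"
    by (rule le_if_square_le_mult) (simp_all add: C_nonneg S)
  then show ?thesis
    by (rule sqrt_le_D)
qed

lemma summable_nonneg_coeffs: "summable (\<lambda>n. (norm (\<gamma> (int n) x))\<^sup>2)"
proof (rule summableI_nonneg_bounded)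
  show "(\<Sum>i<N. (norm (\<gamma> (int i) x))\<^sup>2) \<le> (C * norm x)\<^sup>2" for N
    using sum_norm_column_le[of 0 N x] by (cases "N = 0") simp_all
qed simp

lemma summable_neg_coeffs: "summable (\<lambda>n. (norm (\<gamma> (- int (Suc n)) x))\<^sup>2)"
proof (rule summableI_nonneg_bounded)
  fix N
  have "(\<Sum>i<N. (norm (\<gamma> (- int (Suc i)) x))\<^sup>2) = (\<Sum>i<N. (norm (\<gamma> (- int (Suc (N - Suc i))) x))\<^sup>2)"
    by (rule sum.nat_diff_reindex[symmetric])
  also have "\<dots> = (\<Sum>i<N. (norm (\<gamma> (int i - int N) x))\<^sup>2)"
    by (intro sum.cong refl) (auto simp: of_nat_diff algebra_simps)
  also have "\<dots> \<le> (\<Sum>i<Suc N. (norm (\<gamma> (int i - int N) x))\<^sup>2)"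
    by simp
  also have "\<dots> \<le> (C * norm x)\<^sup>2"
    by (rule sum_norm_column_le) simp
  finally show "(\<Sum>i<N. (norm (\<gamma> (- int (Suc i)) x))\<^sup>2) \<le> (C * norm x)\<^sup>2" .
qed simp

lemma square_integrable_fejer_mean: "square_integrable (\<lambda>z. fejer_mean N z x)"
  and abs_L2_fejer_mean: "abs_L2 (\<lambda>z. fejer_mean N z x) =
    (1 / real N) *\<^sub>R (\<Sum>i<N. \<Sum>j<N. monomial (int i - int j) (\<gamma> (int i - int j) x))"
proof -
  let ?m = "\<lambda>i j z. (z powi (int i - int j)) *\<^sub>C \<gamma> (int i - int j) x"
  have inner: "(\<Sum>j<N. monomial (int i - int j) (\<gamma> (int i - int j) x)) = abs_L2 (\<lambda>z. \<Sum>j<N. ?m i j z)"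
    "square_integrable (\<lambda>z. \<Sum>j<N. ?m i j z)" for i
    using abs_L2_sum[of "{..<N}" "?m i"] by (simp_all add: monomial_def)
  have outer: "(\<Sum>i<N. \<Sum>j<N. monomial (int i - int j) (\<gamma> (int i - int j) x)) = abs_L2 (\<lambda>z. \<Sum>i<N. \<Sum>j<N. ?m i j z)"
    "square_integrable (\<lambda>z. \<Sum>i<N. \<Sum>j<N. ?m i j z)"
    using abs_L2_sum[of "{..<N}" "\<lambda>i z. \<Sum>j<N. ?m i j z"] by (simp_all add: inner)
  show "square_integrable (\<lambda>z. fejer_mean N z x)"
    using square_integrable_scaleC[OF outer(2), of "complex_of_real (1 / real N)"]
    by (simp add: fejer_mean_def scaleR_scaleC)
  show "abs_L2 (\<lambda>z. fejer_mean N z x) =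
      (1 / real N) *\<^sub>R (\<Sum>i<N. \<Sum>j<N. monomial (int i - int j) (\<gamma> (int i - int j) x))"
    using abs_L2_scaleC[OF outer(2), of "complex_of_real (1 / real N)"]
    by (simp add: fejer_mean_def scaleR_scaleC outer(1))
qed

lemma sum_row_split:
  fixes p :: "int \<Rightarrow> 'b::comm_monoid_add"
  assumes "i < N"
  shows "(\<Sum>j<N. p (int i - int j)) = (\<Sum>n<Suc i. p (int n)) + (\<Sum>n<N - Suc i. p (- int (Suc n)))"
proof -
  have "(\<Sum>j<Suc i + k. p (int i - int j)) = (\<Sum>n<Suc i. p (int n)) + (\<Sum>n<k. p (- int (Suc n)))" for k
  proof (induction k)
    case 0
    have "(\<Sum>j<Suc i. p (int i - int j)) = (\<Sum>j<Suc i. p (int (Suc i - Suc j)))"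
      by (intro sum.cong) (auto simp: of_nat_diff)
    then show ?case
      using sum.nat_diff_reindex[of "\<lambda>n. p (int n)" "Suc i"] by simp
  next
    case (Suc k)
    have "(\<Sum>j<Suc i + Suc k. p (int i - int j)) = (\<Sum>j<Suc i + k. p (int i - int j)) + p (int i - int (Suc i + k))"
      by simp
    also have "int i - int (Suc i + k) = - int (Suc k)"
      by simp
    finally show ?case
      unfolding Suc.IH by (simp add: add.assoc)
  qed
  from this[of "N - Suc i"] assms show ?thesis by simp
qed

text \<open>The first and the last column of the sections show that the coefficients are square summable in both
  directions, so the Fourier series converges in L2; the Fejer means are averages of its partial sums and
  converge to the same limit.\<close>

lemma fejer_mean_converges:
  obtains F where "(\<lambda>N. abs_L2 (\<lambda>z. fejer_mean N z x)) \<longlonglongrightarrow> F" "\<And>n. fourier_coeff F n = \<gamma> n x"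
proof -
  let ?p = "\<lambda>n. monomial n (\<gamma> n x)"
  have "summable (\<lambda>n. ?p (int n))"
    by (rule summable_monomials[OF _ summable_nonneg_coeffs]) simp
  then obtain U where U: "(\<lambda>n. ?p (int n)) sums U" by (auto simp: summable_def)
  have "summable (\<lambda>n. ?p (- int (Suc n)))"
    by (rule summable_monomials[OF _ summable_neg_coeffs]) (simp add: inj_def)
  then obtain V where V: "(\<lambda>n. ?p (- int (Suc n))) sums V" by (auto simp: summable_def)
  let ?U = "\<lambda>i. \<Sum>n<Suc i. ?p (int n)" and ?V = "\<lambda>k. \<Sum>n<k. ?p (- int (Suc n))"
  have "abs_L2 (\<lambda>z. fejer_mean N z x) = (1 / real N) *\<^sub>R (\<Sum>i<N. ?U i) + (1 / real N) *\<^sub>R (\<Sum>i<N. ?V i)" for N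
  proof -
    have "(\<Sum>i<N. \<Sum>j<N. ?p (int i - int j)) = (\<Sum>i<N. ?U i + ?V (N - Suc i))"
      by (intro sum.cong refl sum_row_split) auto
    also have "\<dots> = (\<Sum>i<N. ?U i) + (\<Sum>i<N. ?V i)"
      using sum.nat_diff_reindex[of ?V N] by (simp only: sum.distrib)
    finally show ?thesis
      by (simp only: abs_L2_fejer_mean scaleR_add_right)
  qed
  moreover have "(\<lambda>N. (1 / real N) *\<^sub>R (\<Sum>i<N. ?U i)) \<longlonglongrightarrow> U"
    using U[unfolded sums_def] by (intro cesaro_mean) (rule LIMSEQ_Suc)
  moreover have "(\<lambda>N. (1 / real N) *\<^sub>R (\<Sum>i<N. ?V i)) \<longlonglongrightarrow> V"
    using V[unfolded sums_def] by (rule cesaro_mean)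
  ultimately have lim: "(\<lambda>N. abs_L2 (\<lambda>z. fejer_mean N z x)) \<longlonglongrightarrow> U + V"
    by (simp only: tendsto_add)
  have "fourier_coeff (U + V) n = \<gamma> n x" for n
  proof -
    note sums = bounded_linear.sums[OF bounded_linear_fourier_coeff, of _ _ n]
    have "(\<lambda>m. if int m = n then \<gamma> n x else 0) sums fourier_coeff U n"
      using sums[OF U] unfolding fourier_coeff_monomial by (rule sums_cong[THEN iffD1, rotated]) auto
    moreover have "(\<lambda>m. if int m = n then \<gamma> n x else 0) sums (if n \<ge> 0 then \<gamma> n x else 0)"
    proof (cases "n \<ge> 0")
      case True
      then have "(\<lambda>m. if int m = n then \<gamma> n x else 0) = (\<lambda>m. if m = nat n then \<gamma> n x else 0)"
        by (intro ext) auto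
      then show ?thesis using True sums_single[of "nat n" "\<lambda>_. \<gamma> n x"] by simp
    next
      case False
      then have "(\<lambda>m. if int m = n then \<gamma> n x else 0) = (\<lambda>_. 0)"
        by (intro ext) auto
      then show ?thesis using False by simp
    qed
    ultimately have 1: "fourier_coeff U n = (if n \<ge> 0 then \<gamma> n x else 0)"
      by (rule sums_unique2)
    have "(\<lambda>m. if - int (Suc m) = n then \<gamma> n x else 0) sums fourier_coeff V n"
      using sums[OF V] unfolding fourier_coeff_monomial by (rule sums_cong[THEN iffD1, rotated]) auto
    moreover have "(\<lambda>m. if - int (Suc m) = n then \<gamma> n x else 0) sums (if n < 0 then \<gamma> n x else 0)"
    proof (cases "n < 0")
      case True
      then have "(\<lambda>m. if - int (Suc m) = n then \<gamma> n x else 0) = (\<lambda>m. if m = nat (- n - 1) then \<gamma> n x else 0)"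
        by (intro ext) auto
      then show ?thesis using True sums_single[of "nat (- n - 1)" "\<lambda>_. \<gamma> n x"] by simp
    next
      case False
      then have "(\<lambda>m. if - int (Suc m) = n then \<gamma> n x else 0) = (\<lambda>_. 0)"
        by (intro ext) auto
      then show ?thesis using False by simp
    qed
    ultimately have 2: "fourier_coeff V n = (if n < 0 then \<gamma> n x else 0)"
      by (rule sums_unique2)
    show ?thesis by (simp add: fourier_coeff_add 1 2)
  qed
  with lim that show ?thesis by blast
qed

text \<open>The means are bounded by C uniformly in N and z, so convergence almost everywhere for countably many
  dense vectors gives strong convergence almost everywhere. The limit is set to 0 on the exceptional null
  set, as symbols must be bounded operators at every point of the circle.\<close>

theorem symbol_exists:
  obtains \<Phi> where "\<Phi> \<in> L_infinity" "\<And>n x. symbol_coeff \<Phi> n x = \<gamma> n x"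
proof -
  let ?F = "\<lambda>x N. abs_L2 (\<lambda>z. fejer_mean N z x)"
  obtain D :: "'e set" where D: "countable D" "\<And>X. open X \<Longrightarrow> X \<noteq> {} \<Longrightarrow> \<exists>d\<in>D. d \<in> X"
    using countable_dense_exists by blast
  then have "D \<noteq> {}"
    using open_UNIV by blast
  define d where "d = from_nat_into D"
  have dense: "\<exists>l. dist (d l) x < e" if "e > 0" for x e
  proof -
    have "ball x e \<noteq> {}" using that by simp
    then obtain y where "y \<in> D" "dist x y < e"
      using D(2)[OF open_ball, of x e] by auto
    then show ?thesis
      using from_nat_into_surj[OF D(1)] unfolding d_def by (metis dist_commute)
  qed
  have Cauchy: "Cauchy (?F x)" for x
    using fejer_mean_converges[of x] LIMSEQ_imp_Cauchy by metis
  \<comment> \<open>one subsequence along which the means of all dense vectors converge almost everywhere\<close>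
  obtain r where r: "strict_mono r"
    and step: "\<And>k. \<forall>l\<le>k. dist (?F (d l) (r (Suc k))) (?F (d l) (r k)) \<le> (1/2) ^ k"
  proof -
    have "\<exists>N. \<forall>m\<ge>N. \<forall>n\<ge>N. \<forall>l\<le>k. dist (?F (d l) m) (?F (d l) n) \<le> (1/2) ^ k" for k :: nat
    proof -
      have "\<exists>N. \<forall>m\<ge>N. \<forall>n\<ge>N. dist (?F (d l) m) (?F (d l) n) \<le> (1/2) ^ k" for l
        using metric_CauchyD[OF Cauchy, of "(1/2) ^ k" "d l"] zero_less_power[of "1/2::real" k]
        by (auto intro: less_imp_le)
      then obtain N where N: "\<And>l m n. m \<ge> N l \<Longrightarrow> n \<ge> N l \<Longrightarrow> dist (?F (d l) m) (?F (d l) n) \<le> (1/2) ^ k"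
        by metis
      have "N l \<le> (\<Sum>l\<le>k. N l)" if "l \<le> k" for l
        by (rule member_le_sum) (use that in auto)
      then show ?thesis
        using N by (intro exI[of _ "\<Sum>l\<le>k. N l"]) (meson order_trans)
    qed
    then show ?thesis
      by (rule fast_subsequence[where P = "\<lambda>k m n. \<forall>l\<le>k. dist (?F (d l) m) (?F (d l) n) \<le> (1/2) ^ k"]) (rule that)
  qed
  have "AE z in circle. convergent (\<lambda>k. fejer_mean (r k) z (d l))" for l
  proof (rule AE_convergent_of_summable_steps)
    show "square_integrable (\<lambda>z. fejer_mean (r k) z (d l))" for k
      by (rule square_integrable_fejer_mean)
    show "norm (?F (d l) (r (Suc k)) - ?F (d l) (r k)) \<le> (1/2) ^ k" if "k \<ge> l" for k
      using step[of k] that by (simp add: dist_norm)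
    show "summable (\<lambda>k. (1/2::real) ^ k)"
      by simp
  qed
  then have "AE z in circle. \<forall>l. convergent (\<lambda>k. fejer_mean (r k) z (d l))"
    by (simp add: AE_all_countable)
  then obtain Z where Z: "Z \<in> null_sets circle"
    "\<And>z l. z \<in> sphere 0 1 \<Longrightarrow> z \<notin> Z \<Longrightarrow> convergent (\<lambda>k. fejer_mean (r k) z (d l))"
    unfolding eventually_ae_filter by auto
  have conv: "convergent (\<lambda>k. fejer_mean (r k) z x)" if z: "z \<in> sphere 0 1" "z \<notin> Z" for z x
    unfolding Cauchy_convergent_iff[symmetric]
  proof (rule metric_CauchyI)
    fix e :: real assume e: "e > 0"
    have "e / (4 * (C + 1)) > 0" using e C_nonneg by simp
    then obtain l where l: "dist (d l) x < e / (4 * (C + 1))"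
      using dense by blast
    have close: "dist (fejer_mean (r k) z x) (fejer_mean (r k) z (d l)) < e / 4" for k
    proof -
      have "fejer_mean (r k) z x = fejer_mean (r k) z (x - d l) + fejer_mean (r k) z (d l)"
        using fejer_mean_add[of "r k" z "x - d l" "d l"] by simp
      then have "dist (fejer_mean (r k) z x) (fejer_mean (r k) z (d l)) \<le> C * norm (x - d l)"
        using norm_fejer_mean_le[OF z(1), of "r k" "x - d l"] by (simp add: dist_norm)
      also have "\<dots> \<le> (C + 1) * norm (x - d l)"
        by (simp add: mult_right_mono)
      also have "\<dots> < e / 4"
        using l C_nonneg by (simp add: dist_norm norm_minus_commute field_simps)
      finally show ?thesis .
    qed
    have "Cauchy (\<lambda>k. fejer_mean (r k) z (d l))"
      using Z(2)[OF z] by (rule convergent_Cauchy)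
    then obtain K where K: "\<And>k m. k \<ge> K \<Longrightarrow> m \<ge> K \<Longrightarrow>
        dist (fejer_mean (r k) z (d l)) (fejer_mean (r m) z (d l)) < e / 2"
      using metric_CauchyD[of _ "e / 2"] e by (metis half_gt_zero)
    show "\<exists>M. \<forall>k\<ge>M. \<forall>m\<ge>M. dist (fejer_mean (r k) z x) (fejer_mean (r m) z x) < e"
    proof (intro exI[of _ K] allI impI)
      fix k m assume "k \<ge> K" "m \<ge> K"
      then have "dist (fejer_mean (r k) z (d l)) (fejer_mean (r m) z (d l)) < e / 2"
        by (rule K)
      then show "dist (fejer_mean (r k) z x) (fejer_mean (r m) z x) < e"
        using close[of k] close[of m]
          dist_triangle[of "fejer_mean (r k) z x" "fejer_mean (r m) z x" "fejer_mean (r k) z (d l)"]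
          dist_triangle2[of "fejer_mean (r k) z (d l)" "fejer_mean (r m) z x" "fejer_mean (r m) z (d l)"]
        by linarith
    qed
  qed
  define \<Phi> where "\<Phi> z x = (if z \<in> Z then 0 else lim (\<lambda>k. fejer_mean (r k) z x))" for z x
  have lim: "(\<lambda>k. fejer_mean (r k) z x) \<longlonglongrightarrow> \<Phi> z x" if "z \<in> sphere 0 1" "z \<notin> Z" for z x
    using conv[OF that] that by (simp add: \<Phi>_def convergent_LIMSEQ_iff)
  have le: "norm (\<Phi> z x) \<le> C * norm x" if z: "z \<in> sphere 0 1" for z x
  proof (cases "z \<in> Z")
    case True
    then show ?thesis by (simp add: \<Phi>_def C_nonneg)
  next
    case False
    show ?thesis
      by (rule tendsto_upperbound[OF tendsto_norm[OF lim[OF z False]]])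
        (simp_all add: norm_fejer_mean_le[OF z])
  qed
  have clin: "bounded_clinear (\<Phi> z)" if z: "z \<in> sphere 0 1" for z
  proof (rule bounded_clinearI[of _ C])
    show "\<Phi> z (x + y) = \<Phi> z x + \<Phi> z y" for x y
    proof (cases "z \<in> Z")
      case False
      show ?thesis
        by (rule LIMSEQ_unique[OF lim[OF z False]])
          (simp only: fejer_mean_add tendsto_add[OF lim[OF z False] lim[OF z False]])
    qed (simp add: \<Phi>_def)
    show "\<Phi> z (c *\<^sub>C x) = c *\<^sub>C \<Phi> z x" for c x
    proof (cases "z \<in> Z")
      case False
      show ?thesis
        by (rule LIMSEQ_unique[OF lim[OF z False]])
          (simp only: fejer_mean_scaleC bounded_linear.tendsto[OF bounded_linear_scaleC_right lim[OF z False]])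
    qed (simp add: \<Phi>_def)
    show "norm (\<Phi> z x) \<le> C * norm x" for x
      by (rule le[OF z])
  qed
  have Zs [measurable]: "Z \<in> sets circle"
    using Z(1) by auto
  note [measurable] = square_integrable_measurable[OF square_integrable_fejer_mean]
  have meas [measurable]: "(\<lambda>z. \<Phi> z x) \<in> borel_measurable circle" for x
    unfolding \<Phi>_def by measurable
  have "\<Phi> \<in> L_infinity"
    unfolding L_infinity_def
  proof (intro CollectI conjI ballI allI exI)
    show "AE z in circle. onorm (\<Phi> z) \<le> C"
      by (intro AE_I2 onorm_bound) (auto simp: C_nonneg le)
  qed (use clin meas in auto)
  moreover have "symbol_coeff \<Phi> n x = \<gamma> n x" for n x
  proof -
    obtain F where F: "(\<lambda>N. ?F x N) \<longlonglongrightarrow> F" "\<And>n. fourier_coeff F n = \<gamma> n x"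
      using fejer_mean_converges[of x] by blast
    have "(\<lambda>k. fourier_coeff (?F x (r k)) n) \<longlonglongrightarrow> fourier_coeff F n"
      using bounded_linear.tendsto[OF bounded_linear_fourier_coeff LIMSEQ_subseq_LIMSEQ[OF F(1) r]]
      by (simp add: comp_def)
    moreover have "(\<lambda>k. fourier_coeff (?F x (r k)) n) \<longlonglongrightarrow> symbol_coeff \<Phi> n x"
      unfolding symbol_coeff_def fourier_coeff_abs_L2[OF square_integrable_fejer_mean]
    proof (rule integral_dominated_convergence)
      interpret finite_measure circle by (rule finite_measure_circle)
      show "integrable circle (\<lambda>_. C * norm x)" by simp
      have "AE z in circle. z \<notin> Z"
        using Z(1) by (rule AE_not_in)
      then show "AE z in circle. (\<lambda>k. (z powi (- n)) *\<^sub>C fejer_mean (r k) z x) \<longlonglongrightarrow> (z powi (- n)) *\<^sub>C \<Phi> z x"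
        using AE_space
      proof eventually_elim
        case (elim z)
        then show ?case
          by (intro bounded_linear.tendsto[OF bounded_linear_scaleC_right] lim) auto
      qed
      show "AE z in circle. norm ((z powi (- n)) *\<^sub>C fejer_mean (r k) z x) \<le> C * norm x" for k
        by (intro AE_I2) (auto simp: norm_scaleC norm_power_int norm_fejer_mean_le)
    qed measurable
    ultimately show ?thesis
      using F(2) LIMSEQ_unique by metis
  qed
  ultimately show ?thesis using that by blast
qed

end

section \<open>Parrott's theorem\<close>

text \<open>The Lax-Milgram theorem for symmetric forms: s v v - 2 l v is bounded below, the parallelogram law
  makes minimizing sequences Cauchy, and the derivative vanishes at the minimizer.\<close>

lemma coercive_form_represents:
  fixes s :: "'a::{real_inner, banach} \<Rightarrow> 'a \<Rightarrow> real"
  assumes s: "bounded_bilinear s" and sym: "\<And>u v. s u v = s v u"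
    and coercive: "\<delta> > 0" "\<And>v. \<delta> * (norm v)\<^sup>2 \<le> s v v"
    and l: "bounded_linear l"
  obtains k where "\<And>v. s v k = l v"
proof -
  interpret s: bounded_bilinear s by (rule s)
  interpret l: bounded_linear l by (rule l)
  define J where "J v = s v v - 2 * l v" for v
  obtain M where M: "\<And>v. \<bar>l v\<bar> \<le> norm v * M"
    using l.bounded by auto
  have J_ge: "J v \<ge> - (M\<^sup>2 / \<delta>)" for v
  proof -
    have "0 \<le> (\<delta> * norm v - M)\<^sup>2 / \<delta>"
      using coercive(1) by simp
    also have "\<dots> = \<delta> * (norm v)\<^sup>2 - 2 * (norm v * M) + M\<^sup>2 / \<delta>"
      using coercive(1) by (simp add: power2_eq_square field_simps)
    also have "\<dots> \<le> s v v - 2 * l v + M\<^sup>2 / \<delta>"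
      using coercive(2)[of v] M[of v] by (intro add_mono diff_mono) auto
    finally show ?thesis by (simp add: J_def)
  qed
  then have bdd: "bdd_below (range J)"
    by (meson bdd_belowI2)
  define m where "m = Inf (range J)"
  have m: "m \<le> J v" for v
    unfolding m_def using bdd by (simp add: cInf_lower)
  have "\<exists>v. J v < m + inverse (real (Suc n))" for n
  proof -
    have "\<exists>y\<in>range J. y < m + inverse (real (Suc n))"
      by (rule cInf_lessD) (auto simp: m_def)
    then show ?thesis by auto
  qed
  then obtain v where v: "\<And>n. J (v n) < m + inverse (real (Suc n))"
    by metis
  have parallelogram: "\<delta> * (norm (u - w))\<^sup>2 \<le> 2 * (J u - m) + 2 * (J w - m)" for u w
  proof -
    define h where "h = (1/2) *\<^sub>R (u + w)"
    have "4 * J h + s (u - w) (u - w) = 2 * J u + 2 * J w"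
      by (simp add: h_def J_def s.scaleR_left s.scaleR_right l.scaleR s.add_left s.add_right l.add
          s.diff_left s.diff_right sym[of w u] algebra_simps)
    then show ?thesis
      using m[of h] coercive(2)[of "u - w"] by argo
  qed
  have "Cauchy v"
  proof (rule metric_CauchyI)
    fix e :: real assume e: "e > 0"
    have "\<delta> * e\<^sup>2 / 4 > 0" using e coercive(1) by simp
    then obtain K where K: "inverse (real (Suc K)) < \<delta> * e\<^sup>2 / 4"
      using reals_Archimedean by blast
    have small: "J (v n) - m < \<delta> * e\<^sup>2 / 4" if "n \<ge> K" for n
    proof -
      have "inverse (real (Suc n)) \<le> inverse (real (Suc K))"
        using that by (intro le_imp_inverse_le) auto
      then show ?thesis using v[of n] K by linarith
    qed
    show "\<exists>K. \<forall>n\<ge>K. \<forall>p\<ge>K. dist (v n) (v p) < e"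
    proof (intro exI[of _ K] allI impI)
      fix n p assume np: "n \<ge> K" "p \<ge> K"
      have "\<delta> * (norm (v n - v p))\<^sup>2 < \<delta> * e\<^sup>2"
        using parallelogram[of "v n" "v p"] small[OF np(1)] small[OF np(2)] by argo
      then have "(norm (v n - v p))\<^sup>2 < e\<^sup>2"
        using coercive(1) by simp
      then show "dist (v n) (v p) < e"
        using e by (simp add: dist_norm power2_less_imp_less)
    qed
  qed
  then obtain k where k: "v \<longlonglongrightarrow> k"
    unfolding Cauchy_convergent_iff convergent_def by blast
  have "(\<lambda>n. J (v n)) \<longlonglongrightarrow> J k"
    unfolding J_def by (intro tendsto_diff tendsto_mult tendsto_const s.tendsto l.tendsto k)
  moreover have "(\<lambda>n. m + inverse (real (Suc n))) \<longlonglongrightarrow> m + 0"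
    by (intro tendsto_add tendsto_const LIMSEQ_inverse_real_of_nat)
  ultimately have Jk: "J k \<le> m"
    using v by (intro tendsto_le[OF sequentially_bot, of _ "m", simplified])
      (auto intro!: always_eventually less_imp_le)
  have "s w k = l w" for w
  proof -
    \<comment> \<open>a step against the sign of the derivative c along w; the 1 avoids a division by zero\<close>
    define c q t where "c = s w k - l w" and "q = s w w" and "t = - c / (q + 1)"
    have q: "q \<ge> 0"
      using coercive(1) coercive(2)[of w] unfolding q_def by (meson mult_nonneg_nonneg less_imp_le order_trans zero_le_power2)
    have "J (k + t *\<^sub>R w) = J k + 2 * t * c + t\<^sup>2 * q"
      by (simp add: J_def c_def q_def s.scaleR_left s.scaleR_right l.scaleR s.add_left s.add_right l.add
          sym[of k w] power2_eq_square algebra_simps)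
    then have ge: "0 \<le> 2 * t * c + t\<^sup>2 * q"
      using m[of "k + t *\<^sub>R w"] Jk by linarith
    have "2 * t * c + t\<^sup>2 * q = - (c\<^sup>2 * (q + 2)) / (q + 1)\<^sup>2"
      using q by (simp add: t_def power2_eq_square divide_simps) (simp add: algebra_simps)
    then have "c\<^sup>2 * (q + 2) / (q + 1)\<^sup>2 \<le> 0"
      using ge by simp
    then have "c\<^sup>2 * (q + 2) \<le> 0"
      using q by (simp add: divide_le_0_iff)
    then have "c = 0"
      using q by (simp add: mult_le_0_iff)
    then show ?thesis by (simp add: c_def)
  qed
  then show ?thesis by (rule that)
qed

lemma two_mult_le_sum_squares: "2 * (x * y) \<le> x\<^sup>2 + (y::real)\<^sup>2"
  using zero_le_power2[of "x - y"] by (simp add: power2_eq_square algebra_simps)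

lemma two_inner_le:
  assumes "norm x \<le> C * r" "C \<ge> 0" "r \<ge> 0"
  shows "- (C * (r\<^sup>2 + (norm y)\<^sup>2)) \<le> 2 * (x \<bullet> y)"
proof -
  have "- (2 * (x \<bullet> y)) \<le> 2 * (norm x * norm y)"
    using Cauchy_Schwarz_ineq2[of x y] by linarith
  also have "\<dots> \<le> 2 * (C * r * norm y)"
    using assms by (simp add: mult_right_mono)
  also have "\<dots> = C * (2 * (r * norm y))"
    by simp
  also have "\<dots> \<le> C * (r\<^sup>2 + (norm y)\<^sup>2)"
    using assms by (intro mult_left_mono two_mult_le_sum_squares)
  finally show ?thesis by linarith
qed

text \<open>Parrott's theorem, with some slack in the norm: if in the operator matrix with rows (X, M) and (N, D) the
  column of M and D and the row of N and D have norm at most C, then for every C' > C a corner X exists for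
  which the whole matrix has norm at most C'. A matrix T has norm at most C' if and only if the form
  C' |u|^2 + C' |w|^2 + 2 Re <T u, w> is nonnegative. The part of this form that involves only D is an inner
  product; the functional given by N a is represented in it by a vector k, and taking M applied to the
  first component of k for X a completes the square.\<close>

lemma parrott:
  fixes D :: "'b::{complex_inner, banach} \<Rightarrow> 'd::{complex_inner, banach}"
    and M :: "'b \<Rightarrow> 'c::complex_inner" and N :: "'a::complex_inner \<Rightarrow> 'd"
  assumes D: "bounded_clinear D" and M: "bounded_clinear M" and N: "bounded_clinear N"
    and C: "0 \<le> C" "C < C'"
    and col: "\<And>b. (norm (M b))\<^sup>2 + (norm (D b))\<^sup>2 \<le> (C * norm b)\<^sup>2"
    and row: "\<And>a b. (norm (N a + D b))\<^sup>2 \<le> C\<^sup>2 * ((norm a)\<^sup>2 + (norm b)\<^sup>2)"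
  obtains X where "bounded_clinear X"
    "\<And>a b. (norm (X a + M b))\<^sup>2 + (norm (N a + D b))\<^sup>2 \<le> C'\<^sup>2 * ((norm a)\<^sup>2 + (norm b)\<^sup>2)"
proof -
  have C': "C' > 0" using C by simp
  define s where "s u v = C' * (u \<bullet> v) + D (fst u) \<bullet> snd v + D (fst v) \<bullet> snd u" for u v :: "'b \<times> 'd"
  have D_le: "norm (D b) \<le> C * norm b" for b
  proof (rule power2_le_imp_le)
    show "(norm (D b))\<^sup>2 \<le> (C * norm b)\<^sup>2"
      using col[of b] by (rule order_trans[rotated]) simp
  qed (simp add: C)
  note linD = bounded_clinear_add[OF D] bounded_clinear_scaleC[OF D]
    linear_scale[OF bounded_linear.linear[OF bounded_clinear_bounded_linear[OF D]]]
  have norm_pair: "(norm v)\<^sup>2 = (norm (fst v))\<^sup>2 + (norm (snd v))\<^sup>2" for v :: "'b \<times> 'd"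
    by (simp add: norm_prod_def)
  have fst_le: "norm (fst v) \<le> norm v" and snd_le: "norm (snd v) \<le> norm v" for v :: "'b \<times> 'd"
    by (simp_all add: norm_prod_def real_le_rsqrt)
  have bilinear: "bounded_bilinear s"
  proof
    show "s (u + u') v = s u v + s u' v" for u u' v
      by (simp add: s_def linD inner_add_left inner_add_right algebra_simps)
    show "s u (v + v') = s u v + s u v'" for u v v'
      by (simp add: s_def linD inner_add_left inner_add_right algebra_simps)
    show "s (r *\<^sub>R u) v = r *\<^sub>R s u v" for r u v
      by (simp add: s_def linD algebra_simps)
    show "s u (r *\<^sub>R v) = r *\<^sub>R s u v" for r u v
      by (simp add: s_def linD algebra_simps)
    have cross: "\<bar>D (fst u) \<bullet> snd v\<bar> \<le> C * (norm u * norm v)" for u v :: "'b \<times> 'd"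
    proof -
      have "\<bar>D (fst u) \<bullet> snd v\<bar> \<le> norm (D (fst u)) * norm (snd v)"
        by (rule Cauchy_Schwarz_ineq2)
      also have "\<dots> \<le> (C * norm u) * norm v"
        using D_le[of "fst u"] fst_le[of u] snd_le[of v] C(1)
        by (intro mult_mono) (auto intro: order_trans mult_left_mono)
      finally show ?thesis by simp
    qed
    have "norm (s u v) \<le> norm u * norm v * (C' + C + C)" for u v
    proof -
      have "\<bar>C' * (u \<bullet> v)\<bar> \<le> C' * (norm u * norm v)"
        using Cauchy_Schwarz_ineq2[of u v] C' by (simp add: abs_mult)
      then show ?thesis
        using cross[of u v] cross[of v u] unfolding s_def by (simp add: algebra_simps)
    qed
    then show "\<exists>K. \<forall>u v. norm (s u v) \<le> norm u * norm v * K" by blast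
  qed
  have sym: "s u v = s v u" for u v
    by (simp add: s_def inner_commute)
  have s_self: "s v v = C' * ((norm (fst v))\<^sup>2 + (norm (snd v))\<^sup>2) + 2 * (D (fst v) \<bullet> snd v)" for v
    by (simp add: s_def inner_prod_def power2_norm_eq_inner)
  have coercive: "(C' - C) * (norm v)\<^sup>2 \<le> s v v" for v
    using two_inner_le[OF D_le[of "fst v"] C(1), of "snd v"]
    unfolding s_self norm_pair by (simp add: algebra_simps)
  have pos_col: "0 \<le> s v v + 2 * (M (fst v) \<bullet> c) + C' * (norm c)\<^sup>2" for v c
  proof -
    define b d where "b = fst v" and "d = snd v"
    have "norm (M b, D b) \<le> C * norm b"
      by (rule power2_le_imp_le) (use col[of b] C in \<open>simp_all add: norm_prod_def\<close>)
    from two_inner_le[OF this C(1), of "(c, d)"]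
    have "- (C * ((norm b)\<^sup>2 + ((norm c)\<^sup>2 + (norm d)\<^sup>2))) \<le> 2 * (M b \<bullet> c + D b \<bullet> d)"
      by (simp add: norm_prod_def)
    moreover have "C * ((norm b)\<^sup>2 + ((norm c)\<^sup>2 + (norm d)\<^sup>2)) \<le> C' * ((norm b)\<^sup>2 + ((norm c)\<^sup>2 + (norm d)\<^sup>2))"
      using C by (intro mult_right_mono) auto
    ultimately show ?thesis
      unfolding s_self b_def[symmetric] d_def[symmetric] by (simp add: algebra_simps)
  qed
  have pos_row: "0 \<le> s v v + 2 * (N a \<bullet> snd v) + C' * (norm a)\<^sup>2" for v a
  proof -
    define b d where "b = fst v" and "d = snd v"
    have "norm (N a + D b) \<le> C * norm (a, b)"
      by (rule power2_le_imp_le) (use row[of a b] C in \<open>simp_all add: norm_prod_def power_mult_distrib\<close>)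
    from two_inner_le[OF this C(1), of d]
    have "- (C * ((norm a)\<^sup>2 + (norm b)\<^sup>2 + (norm d)\<^sup>2)) \<le> 2 * (N a \<bullet> d + D b \<bullet> d)"
      by (simp add: norm_prod_def inner_add_left)
    moreover have "C * ((norm a)\<^sup>2 + (norm b)\<^sup>2 + (norm d)\<^sup>2) \<le> C' * ((norm a)\<^sup>2 + (norm b)\<^sup>2 + (norm d)\<^sup>2)"
      using C by (intro mult_right_mono) auto
    ultimately show ?thesis
      unfolding s_self b_def[symmetric] d_def[symmetric] by (simp add: algebra_simps)
  qed
  have "\<exists>k. \<forall>v. s v k = N a \<bullet> snd v" for a
  proof -
    have "bounded_linear (\<lambda>v. N a \<bullet> snd v)"
      by (rule bounded_linear_compose[OF bounded_linear_inner_right bounded_linear_snd])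
    from coercive_form_represents[OF bilinear sym _ coercive this] C(2) show ?thesis
      by (metis diff_gt_0_iff_gt)
  qed
  then obtain k where k: "\<And>a v. s v (k a) = N a \<bullet> snd v"
    by metis
  have k_unique: "k a = w" if "\<And>v. s v w = N a \<bullet> snd v" for a w
  proof -
    have "s (k a - w) (k a - w) = 0"
      using k[of "k a - w" a] that[of "k a - w"] by (simp add: bounded_bilinear.diff_right[OF bilinear])
    then have "(norm (k a - w))\<^sup>2 \<le> 0"
      using coercive[of "k a - w"] C(2) by (simp add: mult_le_0_iff)
    then show ?thesis by simp
  qed
  have k_add: "k (a + a') = k a + k a'" for a a'
    by (rule k_unique)
      (simp add: bounded_bilinear.add_right[OF bilinear] k bounded_clinear_add[OF N] inner_add_left)
  have k_scaleC: "k (c *\<^sub>C a) = (c *\<^sub>C fst (k a), c *\<^sub>C snd (k a))" for c a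
  proof (rule k_unique)
    fix v
    have "s v (c *\<^sub>C fst (k a), c *\<^sub>C snd (k a)) = s (cnj c *\<^sub>C fst v, cnj c *\<^sub>C snd v) (k a)"
      by (simp add: s_def inner_prod_def linD inner_scaleC)
    also have "\<dots> = N (c *\<^sub>C a) \<bullet> snd v"
      by (simp add: k bounded_clinear_scaleC[OF N] inner_scaleC)
    finally show "s v (c *\<^sub>C fst (k a), c *\<^sub>C snd (k a)) = N (c *\<^sub>C a) \<bullet> snd v" .
  qed
  define X where "X a = M (fst (k a))" for a
  have X: "(norm (X a + M b))\<^sup>2 + (norm (N a + D b))\<^sup>2 \<le> C'\<^sup>2 * ((norm a)\<^sup>2 + (norm b)\<^sup>2)" for a b
  proof -
    define W where "W = (norm (X a + M b))\<^sup>2 + (norm (N a + D b))\<^sup>2"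
    \<comment> \<open>the pair (c, d) minimizes the form when a and b are fixed\<close>
    define c d where "c = (- 1 / C') *\<^sub>R (X a + M b)" and "d = (- 1 / C') *\<^sub>R (N a + D b)"
    let ?v = "(b, d)"
    have "s (?v + k a) (?v + k a) = s ?v ?v + 2 * (N a \<bullet> d) + s (k a) (k a)"
      using k[of ?v a] sym[of "k a" ?v]
      by (simp add: bounded_bilinear.add_left[OF bilinear] bounded_bilinear.add_right[OF bilinear])
    moreover have "M (fst (?v + k a)) = M b + X a"
      by (simp add: X_def bounded_clinear_add[OF M])
    ultimately have 1: "0 \<le> s ?v ?v + 2 * (N a \<bullet> d) + s (k a) (k a) + 2 * ((M b + X a) \<bullet> c) + C' * (norm c)\<^sup>2"
      using pos_col[of "?v + k a" c] by simp
    have "s (- k a) (- k a) = s (k a) (k a)"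
      by (simp add: bounded_bilinear.minus_left[OF bilinear] bounded_bilinear.minus_right[OF bilinear])
    then have 2: "s (k a) (k a) \<le> C' * (norm a)\<^sup>2"
      using pos_row[of "- k a" a] k[of "k a" a] by simp
    have "0 \<le> C' * ((norm a)\<^sup>2 + (norm b)\<^sup>2) + C' * ((norm c)\<^sup>2 + (norm d)\<^sup>2)
        + 2 * ((X a + M b) \<bullet> c + (N a + D b) \<bullet> d)"
      using 1 2 unfolding s_self by (simp add: inner_add_left algebra_simps)
    also have "(norm c)\<^sup>2 + (norm d)\<^sup>2 = W / C'\<^sup>2"
      by (simp add: c_def d_def W_def power_divide add_divide_distrib)
    also have "(X a + M b) \<bullet> c + (N a + D b) \<bullet> d = - (W / C')"
      by (simp add: c_def d_def W_def power2_norm_eq_inner add_divide_distrib)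
    finally have "W / C' \<le> C' * ((norm a)\<^sup>2 + (norm b)\<^sup>2)"
      using C' by (simp add: power2_eq_square)
    then show ?thesis
      unfolding W_def[symmetric] using C' by (simp add: field_simps power2_eq_square)
  qed
  have "bounded_clinear X"
  proof (rule bounded_clinearI)
    show "X (a + a') = X a + X a'" for a a'
      by (simp add: X_def k_add bounded_clinear_add[OF M])
    show "X (c *\<^sub>C a) = c *\<^sub>C X a" for c a
      by (simp add: X_def k_scaleC bounded_clinear_scaleC[OF M])
    show "norm (X a) \<le> C' * norm a" for a
    proof (rule power2_le_imp_le)
      have "(norm (X a))\<^sup>2 \<le> (norm (X a + M 0))\<^sup>2 + (norm (N a + D 0))\<^sup>2"
        by (simp add: bounded_clinear_zero[OF M])
      also have "\<dots> \<le> (C' * norm a)\<^sup>2"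
        using X[of a 0] by (simp add: power_mult_distrib)
      finally show "(norm (X a))\<^sup>2 \<le> (C' * norm a)\<^sup>2" .
    qed (use C' in simp)
  qed
  with X that show ?thesis by blast
qed

section \<open>Toeplitz and Hankel operators are recognized by their matrices\<close>

text \<open>The form is the pairing of A applied to one polynomial with another polynomial; p and q choose the
  degrees of their monomials, so that sections can start anywhere or have reversed columns.\<close>

lemma entry_form_bound:
  assumes A: "bounded_clinear A" and C: "\<And>F. norm (A F) \<le> C * norm F" "C \<ge> 0"
    and inj: "inj_on p {..<N::nat}" "inj_on q {..<N}"
  shows "cmod (\<Sum>i<N. \<Sum>j<N. cinner (entry A (p i) (q j) (u j)) (v i))
    \<le> C * sqrt (\<Sum>j<N. (norm (u j))\<^sup>2) * sqrt (\<Sum>i<N. (norm (v i))\<^sup>2)"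
proof -
  let ?U = "\<Sum>j<N. hardy_monomial (q j) (u j)" and ?V = "\<Sum>i<N. hardy_monomial (p i) (v i)"
  have norm: "norm ?U = sqrt (\<Sum>j<N. (norm (u j))\<^sup>2)" "norm ?V = sqrt (\<Sum>i<N. (norm (v i))\<^sup>2)"
    using norm_sum_hardy_monomials[OF finite_lessThan inj(1), of v]
      norm_sum_hardy_monomials[OF finite_lessThan inj(2), of u]
    by (auto intro: real_sqrt_unique[symmetric])
  have eq: "cinner (A ?U) ?V = (\<Sum>i<N. \<Sum>j<N. cinner (entry A (p i) (q j) (u j)) (v i))"
    by (simp add: cinner_sum_right cinner_hardy_monomial bounded_clinear_sum[OF A] entry_def
        linear_sum[OF bounded_linear.linear[OF bounded_linear_hardy_coeff]] cinner_sum_left)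
  have "cmod (\<Sum>i<N. \<Sum>j<N. cinner (entry A (p i) (q j) (u j)) (v i)) \<le> norm (A ?U) * norm ?V"
    unfolding eq[symmetric] by (rule cmod_cinner_le)
  also have "\<dots> \<le> C * norm ?U * norm ?V"
    using C(1)[of ?U] by (simp add: mult_right_mono)
  finally show ?thesis unfolding norm .
qed

text \<open>The Brown-Halmos theorem for operator-valued symbols.\<close>

theorem is_toeplitz_iff:
  assumes A: "bounded_clinear A"
  shows "is_toeplitz A \<longleftrightarrow> (\<forall>i j x. entry A (Suc i) (Suc j) x = entry A i j x)"
proof
  assume "is_toeplitz A"
  then obtain \<Phi> where "\<Phi> \<in> L_infinity" "A = toeplitz \<Phi>"
    by (auto simp: is_toeplitz_def)
  then show "\<forall>i j x. entry A (Suc i) (Suc j) x = entry A i j x"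
    by (simp add: entry_toeplitz)
next
  assume diag: "\<forall>i j x. entry A (Suc i) (Suc j) x = entry A i j x"
  obtain C where C: "C > 0" "\<And>F. norm (A F) \<le> C * norm F"
    using bounded_clinear_norm_le[OF A] by blast
  define \<gamma> where "\<gamma> k = entry A (nat k) (nat (- k))" for k
  have shift: "entry A (i + n) (j + n) x = entry A i j x" for i j n x
    by (induction n) (simp_all add: diag)
  have \<gamma>: "entry A i j x = \<gamma> (int i - int j) x" for i j x
  proof (cases "j \<le> i")
    case True
    then show ?thesis using shift[of "i - j" j 0 x] by (simp add: \<gamma>_def nat_diff_distrib')
  next
    case False
    then show ?thesis using shift[of 0 i "j - i" x] by (simp add: \<gamma>_def nat_diff_distrib')
  qed
  interpret bounded_toeplitz_form \<gamma> C
  proof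
    show "cmod (\<Sum>i<N. \<Sum>j<N. cinner (\<gamma> (int i - int j) (u j)) (v i))
        \<le> C * sqrt (\<Sum>j<N. (norm (u j))\<^sup>2) * sqrt (\<Sum>i<N. (norm (v i))\<^sup>2)" for N u v
      using entry_form_bound[OF A C(2), where p = "\<lambda>i. i" and q = "\<lambda>i. i"] C(1) by (simp add: \<gamma>)
  qed (use C(1) in \<open>simp_all add: \<gamma>_def entry_clinear[OF A]\<close>)
  obtain \<Phi> where \<Phi>: "\<Phi> \<in> L_infinity" "\<And>n x. symbol_coeff \<Phi> n x = \<gamma> n x"
    using symbol_exists by blast
  have "A = toeplitz \<Phi>"
    by (rule entry_eqI[OF A bounded_clinear_toeplitz[OF \<Phi>(1)]]) (simp add: entry_toeplitz \<Phi> \<gamma>)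
  then show "is_toeplitz A"
    using \<Phi>(1) by (auto simp: is_toeplitz_def)
qed

text \<open>The matrix of a Hankel operator H is constant along antidiagonals. If one more coefficient is placed in
  front of its sequence of coefficients, then the rows below the new first row, and the columns beside the new
  first column, form copies of H, so only the corner is unknown and Parrott's theorem supplies it.\<close>

lemma hankel_extension:
  fixes H :: "'e::separable_hilbert_space hardy \<Rightarrow> 'e hardy"
  assumes H: "bounded_clinear H" and hankel: "\<And>F. H (shift F) = shift_adj (H F)"
    and le: "\<And>F. norm (H F) \<le> C * norm F" and C: "0 \<le> C" "C < C'"
  obtains H' where "bounded_clinear H'" "\<And>F. shift_adj (H' F) = H F" "\<And>F. H' (shift F) = H F"
    "\<And>F. norm (H' F) \<le> C' * norm F"
proof -
  have norm_split: "(norm F)\<^sup>2 = (norm (hardy_coeff F 0))\<^sup>2 + (norm (shift_adj F))\<^sup>2" for F :: "'e hardy"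
    using norm_const_plus_shift[of "hardy_coeff F 0" "shift_adj F"] hardy_decompose[of F] by metis
  have le2: "(norm (H F))\<^sup>2 \<le> (C * norm F)\<^sup>2" for F
    using le[of F] by (simp add: power_mono)
  have coeff0: "bounded_clinear (\<lambda>F::'e hardy. hardy_coeff F 0)"
    by (simp add: bounded_clinear_def bounded_linear_hardy_coeff hardy_coeff_scaleC)
  have const: "bounded_clinear (hardy_monomial 0 :: 'e \<Rightarrow> _)"
    by (rule bounded_clinearI[of _ 1]) (simp_all add: hardy_monomial_add hardy_monomial_scaleC)
  obtain X where X: "bounded_clinear X"
    "\<And>a b. (norm (X a + hardy_coeff (H b) 0))\<^sup>2 + (norm (H (hardy_monomial 0 a) + shift_adj (H b)))\<^sup>2
      \<le> C'\<^sup>2 * ((norm a)\<^sup>2 + (norm b)\<^sup>2)"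
  proof (rule parrott[of "\<lambda>b. shift_adj (H b)" "\<lambda>b. hardy_coeff (H b) 0" "\<lambda>a. H (hardy_monomial 0 a)" C C'])
    show "bounded_clinear (\<lambda>b. shift_adj (H b))"
      by (rule bounded_clinear_compose[OF bounded_clinear_shift_adj H])
    show "bounded_clinear (\<lambda>b. hardy_coeff (H b) 0)"
      by (rule bounded_clinear_compose[OF coeff0 H])
    show "bounded_clinear (\<lambda>a. H (hardy_monomial 0 a))"
      by (rule bounded_clinear_compose[OF H const])
    show "(norm (hardy_coeff (H b) 0))\<^sup>2 + (norm (shift_adj (H b)))\<^sup>2 \<le> (C * norm b)\<^sup>2" for b
      using le2[of b] by (simp only: norm_split[of "H b"])
    show "(norm (H (hardy_monomial 0 a) + shift_adj (H b)))\<^sup>2 \<le> C\<^sup>2 * ((norm a)\<^sup>2 + (norm b)\<^sup>2)" for a b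
      using le2[of "hardy_monomial 0 a + shift b"]
      by (simp add: bounded_clinear_add[OF H] hankel power_mult_distrib norm_const_plus_shift)
  qed (use C that in auto)
  \<comment> \<open>in the decomposition into constants and the range of the shift, the new operator has the corner X,
    the rest of its first row is the first row of H, and the rows below are those of H\<close>
  define H' where "H' F = hardy_monomial 0 (X (hardy_coeff F 0) + hardy_coeff (H (shift_adj F)) 0) + shift (H F)" for F
  have H_decompose: "H F = H (hardy_monomial 0 (hardy_coeff F 0)) + shift_adj (H (shift_adj F))" for F
    using hardy_decompose[of F] by (metis bounded_clinear_add[OF H] hankel)
  have "bounded_clinear H'"
    unfolding H'_def
    by (rule bounded_clinear_plus[OF bounded_clinear_compose[OF const
          bounded_clinear_plus[OF bounded_clinear_compose[OF X(1) coeff0]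
            bounded_clinear_compose[OF coeff0 bounded_clinear_compose[OF H bounded_clinear_shift_adj]]]]
          bounded_clinear_compose[OF bounded_clinear_shift H]])
  moreover have "shift_adj (H' F) = H F" for F
    by (simp add: H'_def bounded_clinear_add[OF bounded_clinear_shift_adj] shift_adj_const shift_adj_shift)
  moreover have "H' (shift F) = H F" for F
    using hardy_decompose[of "H F"]
    by (simp add: H'_def hardy_coeff_shift shift_adj_shift hankel bounded_clinear_zero[OF X(1)])
  moreover have "norm (H' F) \<le> C' * norm F" for F
  proof (rule power2_le_imp_le)
    show "(norm (H' F))\<^sup>2 \<le> (C' * norm F)\<^sup>2"
      using X(2)[of "hardy_coeff F 0" "shift_adj F"]
      unfolding H'_def norm_const_plus_shift H_decompose[symmetric] norm_split[symmetric] power_mult_distrib .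
  qed (use C in simp)
  ultimately show ?thesis by (rule that)
qed

text \<open>Extending over and over, with norms increasing to C + 1, yields Hankel operators whose matrices
  are ever larger sections of one doubly infinite Hankel matrix. After reversing the order of the columns
  these sections become sections of a Toeplitz matrix, for which the symbol has been constructed.\<close>

theorem nehari:
  fixes H :: "'e::separable_hilbert_space hardy \<Rightarrow> 'e hardy"
  assumes H: "bounded_clinear H" and hankel: "\<And>i j x. entry H (Suc i) j x = entry H i (Suc j) x"
  obtains \<Phi> where "\<Phi> \<in> L_infinity" "H = hankel \<Phi>"
proof -
  obtain C where C: "C > 0" "\<And>F. norm (H F) \<le> C * norm F"
    using bounded_clinear_norm_le[OF H] by blast
  define P :: "nat \<Rightarrow> ('e hardy \<Rightarrow> 'e hardy) \<Rightarrow> bool" where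
    "P n G \<longleftrightarrow> (n = 0 \<longrightarrow> G = H) \<and> bounded_clinear G \<and> (\<forall>F. G (shift F) = shift_adj (G F)) \<and>
      (\<forall>F. norm (G F) \<le> (C + 1 - (1/2) ^ n) * norm F)" for n G
  have "\<exists>E. \<forall>n. P n (E n) \<and> (\<forall>F. shift_adj (E (Suc n) F) = E n F)"
  proof (rule dependent_nat_choice)
    have "(\<lambda>F. H (shift F)) = (\<lambda>F. shift_adj (H F))"
      by (rule entry_eqI)
        (simp_all add: bounded_clinear_compose[OF H bounded_clinear_shift]
          bounded_clinear_compose[OF bounded_clinear_shift_adj H] entry_compose_shift entry_compose_shift_adj hankel)
    then have "P 0 H"
      using H C by (simp add: P_def fun_eq_iff)
    then show "\<exists>G. P 0 G" by blast
  next
    fix G n assume G: "P n G"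
    have "(1/2::real) ^ n \<le> 1" by (simp add: power_le_one)
    then have "0 \<le> C + 1 - (1/2) ^ n" using C(1) by linarith
    moreover have "C + 1 - (1/2) ^ n < C + 1 - (1/2) ^ Suc n" by simp
    ultimately obtain G' where "bounded_clinear G'" "\<And>F. shift_adj (G' F) = G F" "\<And>F. G' (shift F) = G F"
      "\<And>F. norm (G' F) \<le> (C + 1 - (1/2) ^ Suc n) * norm F"
      using hankel_extension[of G "C + 1 - (1/2) ^ n" "C + 1 - (1/2) ^ Suc n"] G unfolding P_def by blast
    then show "\<exists>G'. P (Suc n) G' \<and> (\<forall>F. shift_adj (G' F) = G F)"
      by (intro exI[of _ G']) (simp add: P_def)
  qed
  then obtain E where E: "\<And>n. P n (E n)" and step: "\<And>n F. shift_adj (E (Suc n) F) = E n F"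
    by blast
  have E0: "E 0 = H" and lin: "bounded_clinear (E n)" and commute: "E n (shift F) = shift_adj (E n F)" for n F
    using E[of n] E[of 0] by (simp_all add: P_def)
  have le: "norm (E n F) \<le> (C + 1) * norm F" for n F
  proof -
    have "norm (E n F) \<le> (C + 1 - (1/2) ^ n) * norm F"
      using E[of n] by (simp add: P_def)
    also have "\<dots> \<le> (C + 1) * norm F"
      by (intro mult_right_mono) auto
    finally show ?thesis .
  qed
  have entry_step: "entry (E (Suc n)) (Suc i) j x = entry (E n) i j x" for n i j x
    using step[of n "hardy_monomial j x"] by (simp add: entry_def hardy_coeff_shift_adj[symmetric])
  have entry_anti: "entry (E n) i j x = entry (E n) (i + j) 0 x" for n i j x
  proof (induction j arbitrary: i)
    case (Suc j)
    have "entry (E n) i (Suc j) x = entry (E n) (Suc i) j x"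
      using commute[of n "hardy_monomial j x"]
      by (simp add: entry_def hardy_coeff_shift_adj[symmetric] shift_hardy_monomial)
    then show ?case using Suc[of "Suc i"] by simp
  qed simp
  define \<gamma> where "\<gamma> k = (if k \<ge> 0 then entry H (nat k) 0 else entry (E (nat (- k))) 0 0)" for k
  have \<gamma>0: "entry (E n) i 0 x = \<gamma> (int i - int n) x" for n i x
  proof (induction n arbitrary: i)
    case (Suc n)
    show ?case
    proof (cases i)
      case 0
      then show ?thesis by (simp add: \<gamma>_def nat_add_distrib)
    next
      case (Suc i')
      then show ?thesis using Suc.IH[of i'] by (simp add: entry_step)
    qed
  qed (simp add: E0 \<gamma>_def)
  have \<gamma>: "entry (E n) i j x = \<gamma> (int i + int j - int n) x" for n i j x
    using entry_anti[of n i j x] \<gamma>0[of n "i + j" x] by simp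
  interpret bounded_toeplitz_form \<gamma> "C + 1"
  proof
    fix N and u v :: "nat \<Rightarrow> 'e"
    have "(\<Sum>i<N. \<Sum>j<N. cinner (\<gamma> (int i - int j) (u j)) (v i)) =
        (\<Sum>i<N. \<Sum>j<N. cinner (entry (E N) i (N - j) (u j)) (v i))"
      by (intro sum.cong refl) (simp add: \<gamma> of_nat_diff)
    also have "cmod \<dots> \<le> (C + 1) * sqrt (\<Sum>j<N. (norm (u j))\<^sup>2) * sqrt (\<Sum>i<N. (norm (v i))\<^sup>2)"
      by (rule entry_form_bound[OF lin le]) (use C(1) in \<open>auto simp: inj_on_def\<close>)
    finally show "cmod (\<Sum>i<N. \<Sum>j<N. cinner (\<gamma> (int i - int j) (u j)) (v i))
        \<le> (C + 1) * sqrt (\<Sum>j<N. (norm (u j))\<^sup>2) * sqrt (\<Sum>i<N. (norm (v i))\<^sup>2)" .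
  qed (use C(1) in \<open>simp_all add: \<gamma>_def entry_clinear[OF lin] entry_clinear[OF H]\<close>)
  obtain \<Phi> where \<Phi>: "\<Phi> \<in> L_infinity" "\<And>n x. symbol_coeff \<Phi> n x = \<gamma> n x"
    using symbol_exists by blast
  have "H = hankel \<Phi>"
    by (rule entry_eqI[OF H bounded_clinear_hankel[OF \<Phi>(1)]])
      (use \<gamma>[of 0] in \<open>simp add: entry_hankel \<Phi> E0\<close>)
  with \<Phi>(1) show ?thesis by (rule that)
qed

theorem is_hankel_iff:
  assumes A: "bounded_clinear A"
  shows "is_hankel A \<longleftrightarrow> (\<forall>i j x. entry A (Suc i) j x = entry A i (Suc j) x)"
proof
  assume "is_hankel A"
  then obtain \<Phi> where "\<Phi> \<in> L_infinity" "A = hankel \<Phi>"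
    by (auto simp: is_hankel_def)
  then show "\<forall>i j x. entry A (Suc i) j x = entry A i (Suc j) x"
    by (simp add: entry_hankel ac_simps)
next
  assume "\<forall>i j x. entry A (Suc i) j x = entry A i (Suc j) x"
  then show "is_hankel A"
    using nehari[OF A] by (metis is_hankel_def)
qed

section \<open>Solving the wave equation for operator matrices\<close>

text \<open>A discretization of the wave equation, where j is time: its solutions are the sums of a function
  of i - j and a function of i + j.\<close>

definition wave_equation :: "(nat \<Rightarrow> nat \<Rightarrow> 'a::ab_group_add) \<Rightarrow> bool" where
  "wave_equation a \<longleftrightarrow> (\<forall>i j. a i (Suc j) + a (Suc (Suc i)) (Suc j) = a (Suc i) j + a (Suc i) (Suc (Suc j)))"

text \<open>By the bound for n = 1 the steps of the sequence tend to zero. If the sequence were not Cauchy, then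
  two of its translates would start at distance at least e, and their terms would stay e / 2 apart for as
  long as desired, against the bound.\<close>

lemma convergent_if_translates_square_summable:
  fixes g :: "nat \<Rightarrow> 'a::banach"
  assumes bound: "\<And>n K. (\<Sum>k<K. (norm (g (k + n) - g k))\<^sup>2) \<le> M"
  shows "convergent g"
proof (rule ccontr)
  assume "\<not> convergent g"
  then have "\<not> Cauchy g"
    by (simp add: Cauchy_convergent_iff)
  then obtain e where e: "e > 0" and "\<forall>P. \<exists>p\<ge>P. \<exists>q\<ge>P. \<not> dist (g p) (g q) < e"
    unfolding Cauchy_def by blast
  then have far: "\<exists>p q. P \<le> p \<and> p \<le> q \<and> e \<le> norm (g q - g p)" for P
    by (metis dist_commute dist_norm linorder_not_less nle_le)
  \<comment> \<open>K differences of norm at least e / 2 exceed the bound M\<close>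
  obtain K where K: "real K > 4 * M / e\<^sup>2" "K > 0"
    using reals_Archimedean2[of "max 1 (4 * M / e\<^sup>2)"]
    by (metis less_max_iff_disj max_less_iff_conj of_nat_0_less_iff zero_less_one order_less_trans)
  have "summable (\<lambda>k. (norm (g (k + 1) - g k))\<^sup>2)"
    by (rule summableI_nonneg_bounded) (use bound[of 1] in auto)
  then have "(\<lambda>k. sqrt ((norm (g (k + 1) - g k))\<^sup>2)) \<longlonglongrightarrow> sqrt 0"
    by (intro tendsto_real_sqrt summable_LIMSEQ_zero)
  then have "(\<lambda>k. norm (g (k + 1) - g k)) \<longlonglongrightarrow> 0"
    by simp
  moreover have "e / (4 * real K) > 0"
    using e K by simp
  ultimately obtain P where P: "\<And>k. k \<ge> P \<Longrightarrow> norm (g (k + 1) - g k) < e / (4 * real K)"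
    using LIMSEQ_D by fastforce
  obtain p q where pq: "P \<le> p" "p \<le> q" "e \<le> norm (g q - g p)"
    using far by blast
  have near: "norm (g (r + k) - g r) \<le> real k * (e / (4 * real K))" if "r \<ge> P" for r k
  proof (induction k)
    case (Suc k)
    have "norm (g (r + Suc k) - g r) \<le> norm (g (r + k + 1) - g (r + k)) + norm (g (r + k) - g r)"
      using norm_triangle_ineq[of "g (r + k + 1) - g (r + k)" "g (r + k) - g r"] by simp
    also have "\<dots> \<le> e / (4 * real K) + real k * (e / (4 * real K))"
      using P[of "r + k"] that Suc by (intro add_mono) auto
    finally show ?case by (simp add: algebra_simps add_divide_distrib)
  qed simp
  have apart: "(e / 2)\<^sup>2 \<le> (norm (g (p + k + (q - p)) - g (p + k)))\<^sup>2" if "k < K" for k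
  proof -
    have "real k * (e / (4 * real K)) \<le> real K * (e / (4 * real K))"
      using that e by (intro mult_right_mono) auto
    also have "\<dots> = e / 4" using K by simp
    finally have k: "real k * (e / (4 * real K)) \<le> e / 4" .
    have "norm (g q - g p) \<le> norm (g (q + k) - g (p + k)) + norm (g (q + k) - g q) + norm (g (p + k) - g p)"
      using norm_triangle_ineq4[of "(g (q + k) - g (p + k)) + (g (p + k) - g p)" "g (q + k) - g q"]
        norm_triangle_ineq[of "g (q + k) - g (p + k)" "g (p + k) - g p"] by simp
    then have "e / 2 \<le> norm (g (q + k) - g (p + k))"
      using near[of q k] near[of p k] pq k by linarith
    moreover have idx: "p + k + (q - p) = q + k" using pq by simp
    ultimately show ?thesis
      unfolding idx using e by (intro power_mono) auto
  qed
  have "real K * (e / 2)\<^sup>2 = (\<Sum>k<K. (e / 2)\<^sup>2)"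
    by simp
  also have "\<dots> \<le> (\<Sum>k<K. (norm (g (p + k + (q - p)) - g (p + k)))\<^sup>2)"
    by (rule sum_mono) (simp add: apart)
  also have "\<dots> = (\<Sum>k\<in>(+) p ` {..<K}. (norm (g (k + (q - p)) - g k))\<^sup>2)"
    by (simp add: sum.reindex)
  also have "\<dots> \<le> (\<Sum>k<p + K. (norm (g (k + (q - p)) - g k))\<^sup>2)"
    by (rule sum_mono2) auto
  also have "\<dots> \<le> M"
    by (rule bound)
  finally have "real K * (e / 2)\<^sup>2 \<le> M" .
  moreover have "M < real K * (e / 2)\<^sup>2"
    using K e by (simp add: field_simps power2_eq_square)
  ultimately show False by simp
qed

lemma norm_diff_square_le: "(norm (x - y))\<^sup>2 \<le> 2 * (norm x)\<^sup>2 + 2 * (norm (y::'a::real_normed_vector))\<^sup>2"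
proof -
  have "(norm (x - y))\<^sup>2 \<le> (norm x + norm y)\<^sup>2"
    by (intro power_mono norm_triangle_ineq4) simp
  also have "\<dots> \<le> 2 * (norm x)\<^sup>2 + 2 * (norm y)\<^sup>2"
    using two_mult_le_sum_squares[of "norm x" "norm y"] by (simp add: power2_eq_square algebra_simps)
  finally show ?thesis .
qed

text \<open>By the equation, a i (j+1) - a (i+1) j is constant along diagonals, which means that the difference of
  a and its translate along the diagonal is constant along antidiagonals.\<close>

lemma wave_equation_translate_difference:
  assumes wave: "wave_equation a"
  shows "a (i + n) (j + k + n) - a i (j + k) = a (i + k + n) (j + n) - a (i + k) j"
proof -
  have inv: "a (i + n) (Suc j + n) - a (Suc i + n) (j + n) = a i (Suc j) - a (Suc i) j" for i j
  proof (induction n)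
    case (Suc n)
    have "a (i + n) (Suc (j + n)) + a (Suc (Suc (i + n))) (Suc (j + n)) =
        a (Suc (i + n)) (j + n) + a (Suc (i + n)) (Suc (Suc (j + n)))"
      using wave by (simp add: wave_equation_def)
    then have "a (Suc (i + n)) (Suc (Suc (j + n))) - a (Suc (Suc (i + n))) (Suc (j + n)) =
        a (i + n) (Suc (j + n)) - a (Suc (i + n)) (j + n)"
      by (metis add_diff_cancel_left add_diff_cancel_right)
    then show ?case
      using Suc by simp
  qed simp
  have step: "a (i + n) (Suc j + n) - a i (Suc j) = a (Suc i + n) (j + n) - a (Suc i) j" for i j
    using inv[of i j] by (simp add: algebra_simps)
  show ?thesis
  proof (induction k arbitrary: i)
    case (Suc k)
    show ?case
      using step[of i "j + k"] Suc[of "Suc i"] by simp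
  qed simp
qed

text \<open>The entries along each diagonal converge: a translate of the matrix along the diagonal differs
  from the matrix by a Hankel matrix, so increments along a diagonal are entries in a single column,
  where they are square summable uniformly in the translation. The limits form a bounded Toeplitz
  matrix, and what remains is a Hankel matrix.\<close>

theorem toeplitz_plus_hankel_if_wave_equation:
  fixes A :: "'e::separable_hilbert_space hardy \<Rightarrow> 'e hardy"
  assumes A: "bounded_clinear A" and wave: "\<And>x. wave_equation (\<lambda>i j. entry A i j x)"
  obtains \<Phi> \<Psi> where "\<Phi> \<in> L_infinity" "\<Psi> \<in> L_infinity" "A = (\<lambda>F. toeplitz \<Phi> F + hankel \<Psi> F)"
proof -
  obtain C where C: "C > 0" "\<And>F. norm (A F) \<le> C * norm F"
    using bounded_clinear_norm_le[OF A] by blast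
  note translate = wave_equation_translate_difference[OF wave]
  have conv: "convergent (\<lambda>n. entry A (i + n) (j + n) x)" for i j x
  proof (rule convergent_if_translates_square_summable)
    fix n K
    have col: "(\<Sum>k<K. (norm (entry A (i + k + k + m) (j + m) x))\<^sup>2) \<le> (C * norm x)\<^sup>2" for m
      using sum_norm_entry_le[OF C(2), of "(\<lambda>k. i + k + k + m) ` {..<K}" "j + m" x] C(1)
      by (simp add: sum.reindex inj_on_def)
    have "(\<Sum>k<K. (norm (entry A (i + (k + n)) (j + (k + n)) x - entry A (i + k) (j + k) x))\<^sup>2) =
        (\<Sum>k<K. (norm (entry A (i + k + k + n) (j + n) x - entry A (i + k + k + 0) (j + 0) x))\<^sup>2)"
      using translate[of "i + _" n j] by (simp add: add.assoc)
    also have "\<dots> \<le> (\<Sum>k<K. 2 * (norm (entry A (i + k + k + n) (j + n) x))\<^sup>2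
        + 2 * (norm (entry A (i + k + k + 0) (j + 0) x))\<^sup>2)"
      by (intro sum_mono norm_diff_square_le)
    also have "\<dots> \<le> 4 * (C * norm x)\<^sup>2"
      using col[of n] col[of 0] by (simp add: sum.distrib sum_distrib_left[symmetric])
    finally show "(\<Sum>k<K. (norm (entry A (i + (k + n)) (j + (k + n)) x - entry A (i + k) (j + k) x))\<^sup>2)
        \<le> 4 * (C * norm x)\<^sup>2" .
  qed
  define \<gamma> where "\<gamma> k x = lim (\<lambda>n. entry A (nat k + n) (nat (- k) + n) x)" for k x
  have lim: "(\<lambda>n. entry A (i + n) (j + n) x) \<longlonglongrightarrow> \<gamma> (int i - int j) x" for i j x
  proof -
    define m where "m = min i j"
    have "(\<lambda>n. entry A (nat (int i - int j) + n) (nat (- (int i - int j)) + n) x) \<longlonglongrightarrow> \<gamma> (int i - int j) x"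
      using conv unfolding \<gamma>_def convergent_LIMSEQ_iff .
    note lim = LIMSEQ_ignore_initial_segment[OF this, of m]
    have index: "nat (int i - int j) + (n + m) = i + n" "nat (- (int i - int j)) + (n + m) = j + n" for n
      by (auto simp: m_def min_def)
    show ?thesis
      using lim by (simp only: index)
  qed
  have lim_k: "(\<lambda>n. entry A (nat k + n) (nat (- k) + n) x) \<longlonglongrightarrow> \<gamma> k x" for k x
    using conv unfolding \<gamma>_def convergent_LIMSEQ_iff .
  interpret bounded_toeplitz_form \<gamma> C
  proof
    show "\<gamma> k (x + y) = \<gamma> k x + \<gamma> k y" for k x y
      by (rule LIMSEQ_unique[OF lim_k]) (simp only: entry_clinear[OF A] tendsto_add[OF lim_k lim_k])
    show "\<gamma> k (c *\<^sub>C x) = c *\<^sub>C \<gamma> k x" for k c x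
      by (rule LIMSEQ_unique[OF lim_k])
        (simp only: entry_clinear[OF A] bounded_linear.tendsto[OF bounded_linear_scaleC_right lim_k])
    show "0 \<le> C" using C(1) by simp
    fix N and u v :: "nat \<Rightarrow> 'e"
    have "(\<lambda>n. cmod (\<Sum>i<N. \<Sum>j<N. cinner (entry A (i + n) (j + n) (u j)) (v i)))
        \<longlonglongrightarrow> cmod (\<Sum>i<N. \<Sum>j<N. cinner (\<gamma> (int i - int j) (u j)) (v i))"
      by (intro tendsto_norm tendsto_sum tendsto_cinner tendsto_const lim)
    then show "cmod (\<Sum>i<N. \<Sum>j<N. cinner (\<gamma> (int i - int j) (u j)) (v i))
        \<le> C * sqrt (\<Sum>j<N. (norm (u j))\<^sup>2) * sqrt (\<Sum>i<N. (norm (v i))\<^sup>2)"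
    proof (rule tendsto_upperbound)
      show "\<forall>\<^sub>F n in sequentially. cmod (\<Sum>i<N. \<Sum>j<N. cinner (entry A (i + n) (j + n) (u j)) (v i))
          \<le> C * sqrt (\<Sum>j<N. (norm (u j))\<^sup>2) * sqrt (\<Sum>i<N. (norm (v i))\<^sup>2)"
        using C(1) by (intro always_eventually allI entry_form_bound[OF A C(2)]) (auto simp: inj_on_def)
    qed simp
  qed
  obtain \<Phi> where \<Phi>: "\<Phi> \<in> L_infinity" "\<And>n x. symbol_coeff \<Phi> n x = \<gamma> n x"
    using symbol_exists by blast
  let ?H = "\<lambda>F. A F - toeplitz \<Phi> F"
  have H: "bounded_clinear ?H"
    by (rule bounded_clinear_minus[OF A bounded_clinear_toeplitz[OF \<Phi>(1)]])
  have H_lim: "(\<lambda>n. entry A i j x - entry A (i + n) (j + n) x) \<longlonglongrightarrow> entry ?H i j x" for i j x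
    using tendsto_diff[OF tendsto_const lim] by (simp add: entry_diff entry_toeplitz \<Phi>)
  have "entry ?H (Suc i) j x = entry ?H i (Suc j) x" for i j x
  proof (rule LIMSEQ_unique[OF H_lim])
    have "entry A i (Suc j) x - entry A (i + n) (Suc j + n) x =
        entry A (Suc i) j x - entry A (Suc i + n) (j + n) x" for n
      using translate[of i n j 1 x] by (simp add: algebra_simps)
    then show "(\<lambda>n. entry A (Suc i) j x - entry A (Suc i + n) (j + n) x) \<longlonglongrightarrow> entry ?H i (Suc j) x"
      using H_lim[of i "Suc j" x] by simp
  qed
  then obtain \<Psi> where \<Psi>: "\<Psi> \<in> L_infinity" "?H = hankel \<Psi>"
    using nehari[OF H] by blast
  have "A = (\<lambda>F. toeplitz \<Phi> F + hankel \<Psi> F)"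
    unfolding \<Psi>(2)[symmetric] by simp
  with \<Phi>(1) \<Psi>(1) show ?thesis by (rule that)
qed

section \<open>Toeplitz + Hankel operators\<close>

theorem theorem1p1:
  fixes A :: "'e::separable_hilbert_space hardy \<Rightarrow> 'e hardy"
  assumes "bounded_clinear A"
  shows
    "((\<exists>\<Phi>\<in>L_infinity. \<exists>\<Psi>\<in>L_infinity. A = (\<lambda>F. toeplitz \<Phi> F + hankel \<Psi> F)) \<longleftrightarrow>
        is_toeplitz (\<lambda>F. A (shift F) - shift_adj (A F))) \<and>
     (is_toeplitz (\<lambda>F. A (shift F) - shift_adj (A F)) \<longleftrightarrow>
        is_hankel (\<lambda>F. shift_adj (A (shift F)) - A F)) \<and>
     (is_hankel (\<lambda>F. shift_adj (A (shift F)) - A F) \<longleftrightarrow>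
        (\<forall>F. A (shift F) + shift_adj (shift_adj (A (shift F))) =
             shift_adj (A F) + shift_adj (A (shift (shift F)))))"
proof -
  note A = assms
  note S = bounded_clinear_shift and S' = bounded_clinear_shift_adj
  note AS = bounded_clinear_compose[OF A S] and S'A = bounded_clinear_compose[OF S' A]
  note S'AS = bounded_clinear_compose[OF S' AS] and ASS = bounded_clinear_compose[OF AS S]
  note entries = entry_add entry_diff entry_compose_shift_adj entry_compose_shift[of A]
    entry_compose_shift[of "\<lambda>F. A (shift F)"]
  let ?W = "\<forall>x. wave_equation (\<lambda>i j. entry A i j x)"
  have wave: "?W \<longleftrightarrow> (\<forall>i j x. entry A i (Suc j) x + entry A (Suc (Suc i)) (Suc j) x =
      entry A (Suc i) j x + entry A (Suc i) (Suc (Suc j)) x)"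
    by (auto simp: wave_equation_def)
  have "(\<forall>F. A (shift F) + shift_adj (shift_adj (A (shift F))) =
      shift_adj (A F) + shift_adj (A (shift (shift F)))) \<longleftrightarrow>
    (\<lambda>F. A (shift F) + shift_adj (shift_adj (A (shift F)))) =
      (\<lambda>F. shift_adj (A F) + shift_adj (A (shift (shift F))))" (is "?four \<longleftrightarrow> ?L = ?R")
    by (simp add: fun_eq_iff)
  also have "\<dots> \<longleftrightarrow> (\<forall>i j x. entry ?L i j x = entry ?R i j x)"
  proof
    show "?L = ?R" if "\<forall>i j x. entry ?L i j x = entry ?R i j x"
      by (rule entry_eqI[OF bounded_clinear_plus[OF AS bounded_clinear_compose[OF S' S'AS]]
            bounded_clinear_plus[OF S'A bounded_clinear_compose[OF S' ASS]]]) (use that in blast)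
  qed simp
  also have "\<dots> \<longleftrightarrow> ?W"
    unfolding wave entries ..
  finally have four: "?four \<longleftrightarrow> ?W" .
  have two: "is_toeplitz (\<lambda>F. A (shift F) - shift_adj (A F)) \<longleftrightarrow> ?W"
    unfolding is_toeplitz_iff[OF bounded_clinear_minus[OF AS S'A]] wave entries
    by (auto simp: algebra_simps)
  have three: "is_hankel (\<lambda>F. shift_adj (A (shift F)) - A F) \<longleftrightarrow> ?W"
    unfolding is_hankel_iff[OF bounded_clinear_minus[OF S'AS A]] wave entries
    by (auto simp: algebra_simps)
  have one: "(\<exists>\<Phi>\<in>L_infinity. \<exists>\<Psi>\<in>L_infinity. A = (\<lambda>F. toeplitz \<Phi> F + hankel \<Psi> F)) \<longleftrightarrow> ?W" (is "?one \<longleftrightarrow> _")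
  proof
    assume ?one
    then obtain \<Phi> \<Psi> where "\<Phi> \<in> L_infinity" "\<Psi> \<in> L_infinity" "A = (\<lambda>F. toeplitz \<Phi> F + hankel \<Psi> F)"
      by blast
    then have ent: "entry A i j x = symbol_coeff \<Phi> (int i - int j) x + symbol_coeff \<Psi> (int i + int j) x" for i j x
      by (simp add: entry_add entry_toeplitz entry_hankel)
    show ?W
      unfolding wave unfolding ent by (simp add: algebra_simps)
  next
    assume ?W
    then obtain \<Phi> \<Psi> where "\<Phi> \<in> L_infinity" "\<Psi> \<in> L_infinity" "A = (\<lambda>F. toeplitz \<Phi> F + hankel \<Psi> F)"
      using toeplitz_plus_hankel_if_wave_equation[OF A] by blast
    then show ?one by blast
  qed
  show ?thesis
    by (simp only: one two three four)
qed

end
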